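(* Fix an integer $k\ge1$ and $\lambda\in(0,1)$. There exist constants $c=c(\lambda,k)>0$ and $\delta=\delta(\lambda,k)\in(0,1)$ such that for all sufficiently large $m$ the following holds. Let $R$ be an axis-parallel $m\times k$ rectangle contained in $[-n/2,n/2]\times[0,k]$, and $\xi$ a boundary condition for $\Lambda^0_{n,k}$ no edge of which intersects $R$. If $\sigma\sim\pi^\xi_{n,k}$, then $\pi^\xi_{n,k}\big(C_R(\sigma)\le\delta m\big)\le e^{-cm}$.
   Context: For integers $n,k\ge1$, $\Lambda^0_{n,k}$ is the set of integer points in $[-n/2,n/2]\times[0,k]$. Edges are open straight segments with endpoints in $\Lambda^0_{n,k}$; $|e|$ is the $\ell_1$ length. A triangulation of $\Lambda^0_{n,k}$ is a maximal set of pairwise disjoint edges containing no point of $\Lambda^0_{n,k}$; all triangulations share the same set $\Lambda_{n,k}$ of edge midpoints, and $\sigma_x$ is the edge of $\sigma$ with midpoint $x$. A boundary condition $\xi$ is a set of pairwise disjoint edges containing no point of $\Lambda^0_{n,k}$ and containing the unit boundary segments of the rectangle; $\Omega^\xi_{n,k}$ is the set of triangulations containing all edges of $\xi$, and for $\lambda>0$, $\pi^\xi_{n,k}(\sigma)\propto\lambda^{\sum_{x\in\Lambda_{n,k}}|\sigma_x|}$ on $\Omega^\xi_{n,k}$. A top-to-bottom crossing of unit verticals at horizontal coordinate $a\in\mathbb{Z}$ means that $\sigma$ contains all $k$ unit vertical edges $\{a\}\times(j,j+1)$, $j=0,\dots,k-1$. $C_R(\sigma)$ is the number of integers $a$ such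 that $\sigma$ has a top-to-bottom crossing of unit verticals at coordinate $a$ lying inside $R$. *)

theory Defs
  imports "HOL-Analysis.Analysis"
begin

text \<open>Lattice points are pairs of integers; an edge is an unordered pair {p,q} of
distinct points, standing for the open straight segment between them.\<close>

definition pt :: "int \<times> int \<Rightarrow> real \<times> real" where
  "pt p = (real_of_int (fst p), real_of_int (snd p))"

definition Lam0 :: "nat \<Rightarrow> nat \<Rightarrow> (int \<times> int) set" where
  "Lam0 n k = {(a,b). \<bar>2*a\<bar> \<le> int n \<and> 0 \<le> b \<and> b \<le> int k}"

definition box :: "nat \<Rightarrow> nat \<Rightarrow> (real \<times> real) set" where
  "box n k = {(x,y). \<bar>x\<bar> \<le> real n / 2 \<and> 0 \<le> y \<and> y \<le> real k}"

definition oseg :: "(int \<times> int) set \<Rightarrow> (real \<times> real) set" where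
  "oseg e = {x. \<exists>p q. e = {p,q} \<and> p \<noteq> q \<and> x \<in> open_segment (pt p) (pt q)}"

definition l1dist :: "int \<times> int \<Rightarrow> int \<times> int \<Rightarrow> int" where
  "l1dist p q = \<bar>fst p - fst q\<bar> + \<bar>snd p - snd q\<bar>"

text \<open>l1 length of an edge {p,q}: the double sum over ordered pairs counts |p-q|_1 twice.\<close>
definition elen :: "(int \<times> int) set \<Rightarrow> real" where
  "elen e = (\<Sum>p\<in>e. \<Sum>q\<in>e. real_of_int (l1dist p q)) / 2"

definition valid_edge :: "nat \<Rightarrow> nat \<Rightarrow> (int \<times> int) set \<Rightarrow> bool" where
  "valid_edge n k e \<longleftrightarrow>
     (\<exists>p q. p \<in> Lam0 n k \<and> q \<in> Lam0 n k \<and> p \<noteq> q \<and> e = {p,q}) \<and>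
     (\<forall>z\<in>Lam0 n k. pt z \<notin> oseg e)"

definition edge_config :: "nat \<Rightarrow> nat \<Rightarrow> (int \<times> int) set set \<Rightarrow> bool" where
  "edge_config n k E \<longleftrightarrow>
     (\<forall>e\<in>E. valid_edge n k e) \<and>
     (\<forall>e\<in>E. \<forall>e'\<in>E. e \<noteq> e' \<longrightarrow> oseg e \<inter> oseg e' = {})"

definition triangulation :: "nat \<Rightarrow> nat \<Rightarrow> (int \<times> int) set set \<Rightarrow> bool" where
  "triangulation n k \<sigma> \<longleftrightarrow>
     edge_config n k \<sigma> \<and> (\<forall>E. edge_config n k E \<and> \<sigma> \<subseteq> E \<longrightarrow> E = \<sigma>)"

definition unit_boundary_edges :: "nat \<Rightarrow> nat \<Rightarrow> (int \<times> int) set set" where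
  "unit_boundary_edges n k =
     {e. \<exists>p q. p \<in> Lam0 n k \<and> q \<in> Lam0 n k \<and> l1dist p q = 1 \<and> e = {p,q} \<and>
            oseg e \<subseteq> frontier (box n k)}"

definition boundary_condition :: "nat \<Rightarrow> nat \<Rightarrow> (int \<times> int) set set \<Rightarrow> bool" where
  "boundary_condition n k \<xi> \<longleftrightarrow> edge_config n k \<xi> \<and> unit_boundary_edges n k \<subseteq> \<xi>"

definition Omega :: "nat \<Rightarrow> nat \<Rightarrow> (int \<times> int) set set \<Rightarrow> (int \<times> int) set set set" where
  "Omega n k \<xi> = {\<sigma>. triangulation n k \<sigma> \<and> \<xi> \<subseteq> \<sigma>}"

definition weight :: "real \<Rightarrow> (int \<times> int) set set \<Rightarrow> real" where
  "weight lam \<sigma> = lam powr (\<Sum>e\<in>\<sigma>. elen e)"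

definition piprob :: "nat \<Rightarrow> nat \<Rightarrow> real \<Rightarrow> (int \<times> int) set set
                      \<Rightarrow> ((int \<times> int) set set \<Rightarrow> bool) \<Rightarrow> real" where
  "piprob n k lam \<xi> P =
     (\<Sum>\<sigma>\<in>{\<sigma>\<in>Omega n k \<xi>. P \<sigma>}. weight lam \<sigma>) / (\<Sum>\<sigma>\<in>Omega n k \<xi>. weight lam \<sigma>)"

definition vcrossing :: "nat \<Rightarrow> (int \<times> int) set set \<Rightarrow> int \<Rightarrow> bool" where
  "vcrossing k \<sigma> a \<longleftrightarrow> (\<forall>j::int. 0 \<le> j \<and> j < int k \<longrightarrow> {(a,j),(a,j+1)} \<in> \<sigma>)"

text \<open>C_R for R = [x0, x0+m] x [0,k].\<close>
definition CR :: "nat \<Rightarrow> real \<Rightarrow> real \<Rightarrow> (int \<times> int) set set \<Rightarrow> nat" where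
  "CR k x0 m \<sigma> = card {a::int. x0 \<le> real_of_int a \<and> real_of_int a \<le> x0 + m \<and> vcrossing k \<sigma> a}"

end

theory Submission
  imports Defs
begin

text \<open>
Flipping an edge of horizontal extent at least 2 that is longest in both adjacent triangles shortens it and keeps its
midpoint. If its height is at least 2, the gain is proportional to its extent; if a column is crossed by a long edge of
height at least 2, then the longest such edge is flippable in this way. As these flips do not interfere, a Peierls
estimate shows that with overwhelming probability most columns of a sparse grid are crossed only by short edges and by
edges of height 1. The weights are compared by removing edges that enter the rectangle only, so the bounds do not depend
on the region outside.

At such a column, flipping the longest crossing edge until none is left creates a top-to-bottom crossing. The
triangulation can be recovered from the result and from the set of edges removed. The long ones among these have height 1
and are encoded by the numbers of edges at each distance from the column, as in a partition, so that the sum over all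
removed sets of \<open>lam\<close> to the length gained is bounded by a constant. Hence a column is at most a constant factor more
likely to be uncrossed than crossed, also jointly over the grid columns, and an exponential Markov inequality concludes.
\<close>

section \<open>Lattice segments\<close>

text \<open>The obstacle is an edge of height 1: its flip may shorten it by only 2, whatever its
  extent, because an apex can sit next to one of its ends. No Peierls factor per edge controls such
  edges. A height of at least 2 makes both parts of a flipped edge non-horizontal, and unimodularity
  then balances them, which yields a gain proportional to the extent. Height-1 edges are counted all
  together instead: at a column that is not \<open>bad\<close> they interlock so rigidly that their
  numbers determine them, and a partition generating function, finite for every
  \<open>lam < 1\<close>, bounds the count uniformly in \<open>n\<close>. The states of different
  columns are dependent. They are therefore treated one at a time inside a product of statuses, and
  the grid spacing lets a cut at one column pay for its side effects on the others. All geometry is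
  integral: edges are primitive vectors, and \<open>wedge\<close>, twice the signed area of a
  triangle, is 1 or -1 exactly when two vectors form a lattice basis. Local configurations can then
  be moved to a unit base or a unit square.\<close>

definition wedge :: "int \<times> int \<Rightarrow> int \<times> int \<Rightarrow> int" where
  "wedge u v = fst u * snd v - snd u * fst v"

text \<open>Common points of two open segments, written with parameters and integer ends rather than
  through \<open>oseg\<close>, so that integer affine maps can carry the relation along.\<close>

definition meet :: "int \<times> int \<Rightarrow> int \<times> int \<Rightarrow> int \<times> int \<Rightarrow> int \<times> int \<Rightarrow> bool" where
  "meet p q r s \<longleftrightarrow> (\<exists>\<alpha> \<beta>::real. 0 < \<alpha> \<and> \<alpha> < 1 \<and> 0 < \<beta> \<and> \<beta> < 1 \<and>
     real_of_int (fst p) + \<alpha> * real_of_int (fst q - fst p) = real_of_int (fst r) + \<beta> * real_of_int (fst s - fst r) \<and>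
     real_of_int (snd p) + \<alpha> * real_of_int (snd q - snd p) = real_of_int (snd r) + \<beta> * real_of_int (snd s - snd r))"

lemma meetI:
  fixes \<alpha> \<beta> :: real
  assumes "0 < \<alpha>" "\<alpha> < 1" "0 < \<beta>" "\<beta> < 1"
    "real_of_int (fst p) + \<alpha> * real_of_int (fst q - fst p) = real_of_int (fst r) + \<beta> * real_of_int (fst s - fst r)"
    "real_of_int (snd p) + \<alpha> * real_of_int (snd q - snd p) = real_of_int (snd r) + \<beta> * real_of_int (snd s - snd r)"
  shows "meet p q r s"
  using assms unfolding meet_def by blast

lemma meetE:
  assumes "meet p q r s"
  obtains \<alpha> \<beta> :: real where "0 < \<alpha>" "\<alpha> < 1" "0 < \<beta>" "\<beta> < 1"
    "real_of_int (fst p) + \<alpha> * real_of_int (fst q - fst p) = real_of_int (fst r) + \<beta> * real_of_int (fst s - fst r)"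
    "real_of_int (snd p) + \<alpha> * real_of_int (snd q - snd p) = real_of_int (snd r) + \<beta> * real_of_int (snd s - snd r)"
  using assms unfolding meet_def by blast

lemma pt_eq_iff [simp]: "pt p = pt q \<longleftrightarrow> p = q"
  by (auto simp: pt_def prod_eq_iff)

lemma in_open_segment_pt:
  assumes "p \<noteq> q"
  shows "x \<in> open_segment (pt p) (pt q) \<longleftrightarrow> (\<exists>u::real. 0 < u \<and> u < 1 \<and>
     x = (real_of_int (fst p) + u * real_of_int (fst q - fst p),
          real_of_int (snd p) + u * real_of_int (snd q - snd p)))"
proof -
  have "(1-u) *\<^sub>R pt p + u *\<^sub>R pt q = (real_of_int (fst p) + u * real_of_int (fst q - fst p),
          real_of_int (snd p) + u * real_of_int (snd q - snd p))" for u
    by (simp add: pt_def algebra_simps)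
  then show ?thesis using assms unfolding in_segment by simp
qed

lemma oseg_pair: "p \<noteq> q \<Longrightarrow> oseg {p,q} = open_segment (pt p) (pt q)"
proof -
  assume "p \<noteq> q"
  have "open_segment (pt a) (pt b) = open_segment (pt p) (pt q)" if "{p,q} = {a,b}" for a b
    using that unfolding doubleton_eq_iff by (metis open_segment_commute)
  then show ?thesis unfolding oseg_def using \<open>p \<noteq> q\<close> by blast
qed

lemma oseg_meet:
  assumes "p \<noteq> q" "r \<noteq> s"
  shows "oseg {p,q} \<inter> oseg {r,s} \<noteq> {} \<longleftrightarrow> meet p q r s"
proof -
  have "oseg {p,q} \<inter> oseg {r,s} \<noteq> {} \<longleftrightarrow>
    (\<exists>x. x \<in> open_segment (pt p) (pt q) \<and> x \<in> open_segment (pt r) (pt s))"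
    using assms by (auto simp: oseg_pair)
  also have "\<dots> \<longleftrightarrow> meet p q r s"
    unfolding in_open_segment_pt[OF assms(1)] in_open_segment_pt[OF assms(2)] meet_def
    by (auto simp: prod_eq_iff)
  finally show ?thesis .
qed

lemma pt_in_oseg:
  assumes "p \<noteq> q"
  shows "pt z \<in> oseg {p,q} \<longleftrightarrow> (\<exists>u::real. 0 < u \<and> u < 1 \<and>
     real_of_int (fst z) = real_of_int (fst p) + u * real_of_int (fst q - fst p) \<and>
     real_of_int (snd z) = real_of_int (snd p) + u * real_of_int (snd q - snd p))"
  unfolding oseg_pair[OF assms] in_open_segment_pt[OF assms] by (auto simp: pt_def)

lemma meet_commute: "meet p q r s \<longleftrightarrow> meet r s p q"
proof -
  have "meet r s p q" if "meet p q r s" for p q r s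
    using that
  proof (rule meetE)
    fix \<alpha> \<beta> :: real
    assume *: "0 < \<alpha>" "\<alpha> < 1" "0 < \<beta>" "\<beta> < 1"
     "real_of_int (fst p) + \<alpha> * real_of_int (fst q - fst p) = real_of_int (fst r) + \<beta> * real_of_int (fst s - fst r)"
     "real_of_int (snd p) + \<alpha> * real_of_int (snd q - snd p) = real_of_int (snd r) + \<beta> * real_of_int (snd s - snd r)"
    show ?thesis
      by (rule meetI[of \<beta> \<alpha>]) (use * in simp_all)
  qed
  then show ?thesis by blast
qed

lemma meet_swap: "meet p q r s \<longleftrightarrow> meet q p r s"
proof -
  have "meet q p r s" if "meet p q r s" for p q
    using that
  proof (rule meetE)
    fix \<alpha> \<beta> :: real
    assume *: "0 < \<alpha>" "\<alpha> < 1" "0 < \<beta>" "\<beta> < 1"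
     "real_of_int (fst p) + \<alpha> * real_of_int (fst q - fst p) = real_of_int (fst r) + \<beta> * real_of_int (fst s - fst r)"
     "real_of_int (snd p) + \<alpha> * real_of_int (snd q - snd p) = real_of_int (snd r) + \<beta> * real_of_int (snd s - snd r)"
    show ?thesis
      by (rule meetI[of "1-\<alpha>" \<beta>]) (use * in \<open>simp_all add: algebra_simps\<close>)
  qed
  then show ?thesis by blast
qed

text \<open>An affine map keeps the parameter of a point on a segment, and a nonzero determinant
  makes the coordinate equations before and after the map equivalent.\<close>

lemma meet_affine:
  fixes X Y :: "int \<times> int \<Rightarrow> int"
  assumes X: "\<And>z. X z = a * fst z + b * snd z + e" and Y: "\<And>z. Y z = c * fst z + d * snd z + f"
    and nz: "a * d - b * c \<noteq> 0"
  shows "meet p q r s \<longleftrightarrow> meet (X p, Y p) (X q, Y q) (X r, Y r) (X s, Y s)"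
proof -
  have lin: "(x = y \<and> x' = y') \<longleftrightarrow>
       real_of_int a * x + real_of_int b * x' + real_of_int e = real_of_int a * y + real_of_int b * y' + real_of_int e \<and>
       real_of_int c * x + real_of_int d * x' + real_of_int f = real_of_int c * y + real_of_int d * y' + real_of_int f" (is "?l \<longleftrightarrow> ?r")
    for x y x' y' :: real
  proof
    assume ?r
    then have 1: "real_of_int a * (x-y) + real_of_int b * (x'-y') = 0"
          and 2: "real_of_int c * (x-y) + real_of_int d * (x'-y') = 0" by (simp_all add: algebra_simps)
    have "real_of_int (a*d-b*c) * (x-y) = real_of_int d * (real_of_int a * (x-y) + real_of_int b * (x'-y'))
        - real_of_int b * (real_of_int c * (x-y) + real_of_int d * (x'-y'))" by (simp add: algebra_simps)
    moreover have "real_of_int (a*d-b*c) * (x'-y') = real_of_int a * (real_of_int c * (x-y) + real_of_int d * (x'-y'))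
        - real_of_int c * (real_of_int a * (x-y) + real_of_int b * (x'-y'))" by (simp add: algebra_simps)
    ultimately have "real_of_int (a*d-b*c) * (x-y) = 0" "real_of_int (a*d-b*c) * (x'-y') = 0"
      using 1 2 by simp_all
    moreover have "real_of_int (a*d-b*c) \<noteq> 0" using nz of_int_eq_0_iff by blast
    ultimately show ?l by simp
  qed simp
  have eq: "real_of_int (X p) + \<alpha> * real_of_int (X q - X p) =
      real_of_int a * (real_of_int (fst p) + \<alpha> * real_of_int (fst q - fst p))
     + real_of_int b * (real_of_int (snd p) + \<alpha> * real_of_int (snd q - snd p)) + real_of_int e"
   "real_of_int (Y p) + \<alpha> * real_of_int (Y q - Y p) =
      real_of_int c * (real_of_int (fst p) + \<alpha> * real_of_int (fst q - fst p))
     + real_of_int d * (real_of_int (snd p) + \<alpha> * real_of_int (snd q - snd p)) + real_of_int f" for \<alpha> p q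
    by (simp_all add: X Y algebra_simps)
  show ?thesis unfolding meet_def fst_conv snd_conv eq lin[symmetric] ..
qed


lemma finite_has_max_value:
  fixes f :: "'a \<Rightarrow> 'b::linorder"
  assumes "finite A" "A \<noteq> {}"
  shows "\<exists>x\<in>A. \<forall>y\<in>A. f y \<le> f x"
proof -
  have "Max (f ` A) \<in> f ` A" using assms by (intro Max_in) auto
  then obtain x where "x \<in> A" "Max (f ` A) = f x" by auto
  moreover have "f y \<le> Max (f ` A)" if "y \<in> A" for y using that assms by (intro Max_ge) auto
  ultimately show ?thesis by auto
qed

lemma meet_swap2: "meet p q r s \<longleftrightarrow> meet p q s r"
  by (metis meet_commute meet_swap)

section \<open>Segments as graphs over the vertical coordinate\<close>

definition xat :: "int \<times> int \<Rightarrow> int \<times> int \<Rightarrow> real \<Rightarrow> real" where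
  "xat g h y = real_of_int (fst g) + (y - real_of_int (snd g)) * real_of_int (fst h - fst g) / real_of_int (snd h - snd g)"

lemma xat_convex:
  assumes "y = (1-t) * y0 + t * y1"
  shows "xat g h y = (1-t) * xat g h y0 + t * xat g h y1"
proof -
  define c where "c = real_of_int (fst h - fst g) / real_of_int (snd h - snd g)"
  have "xat g h y = real_of_int (fst g) + (y - real_of_int (snd g)) * c" for y
    unfolding xat_def c_def by simp
  then have eq: "\<And>y. xat g h y = real_of_int (fst g) + (y - real_of_int (snd g)) * c" .
  show ?thesis unfolding eq assms by (simp add: algebra_simps)
qed

lemma xat_upper: "snd g < snd h \<Longrightarrow> xat g h (real_of_int (snd h)) = real_of_int (fst h)"
  unfolding xat_def by simp

lemma xat_lower: "xat g h (real_of_int (snd g)) = real_of_int (fst g)"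
  unfolding xat_def by simp

lemma xat_at:
  assumes "snd g < snd h"
    "y = real_of_int (snd g) + \<alpha> * real_of_int (snd h - snd g)"
  shows "xat g h y = real_of_int (fst g) + \<alpha> * real_of_int (fst h - fst g)"
proof -
  have "real_of_int (snd h - snd g) \<noteq> 0" using assms(1) by linarith
  then show ?thesis unfolding xat_def assms(2) by (simp del: of_int_diff)
qed

lemma meet_xatI:
  assumes "snd g < snd h" "snd g' < snd h'"
    "real_of_int (snd g) < y" "y < real_of_int (snd h)" "real_of_int (snd g') < y" "y < real_of_int (snd h')"
    "xat g h y = xat g' h' y"
  shows "meet g h g' h'"
proof -
  define \<alpha> where "\<alpha> = (y - real_of_int (snd g)) / real_of_int (snd h - snd g)"
  define \<beta> where "\<beta> = (y - real_of_int (snd g')) / real_of_int (snd h' - snd g')"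
  have pos: "real_of_int (snd h - snd g) > 0" "real_of_int (snd h' - snd g') > 0" using assms(1,2) by auto
  have "0 < \<alpha>" "\<alpha> < 1" "0 < \<beta>" "\<beta> < 1"
    using assms pos unfolding \<alpha>_def \<beta>_def by (auto simp: field_simps)
  moreover have y: "y = real_of_int (snd g) + \<alpha> * real_of_int (snd h - snd g)"
    "y = real_of_int (snd g') + \<beta> * real_of_int (snd h' - snd g')"
    using pos unfolding \<alpha>_def \<beta>_def by (simp_all del: of_int_diff)
  moreover note xat_at[OF assms(1) y(1)] xat_at[OF assms(2) y(2)]
  ultimately show ?thesis using assms(7) by (intro meetI[of \<alpha> \<beta>]) auto
qed

text \<open>The difference of two affine functions changes sign, so it vanishes strictly between
  \<open>y1\<close> and \<open>y2\<close>; \<open>t\<close> is the explicit relative position of the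
  zero.\<close>

lemma meet_swap_order:
  assumes "snd g < snd h" "snd g' < snd h'" and y: "y1 < y2"
    "real_of_int (snd g) \<le> y1" "y2 \<le> real_of_int (snd h)" "real_of_int (snd g') \<le> y1" "y2 \<le> real_of_int (snd h')"
    and lt: "xat g h y1 < xat g' h' y1" "xat g h y2 > xat g' h' y2"
  shows "meet g h g' h'"
proof -
  define d1 where "d1 = xat g' h' y1 - xat g h y1"
  define d2 where "d2 = xat g h y2 - xat g' h' y2"
  define t where "t = d1 / (d1 + d2)"
  have d: "d1 > 0" "d2 > 0" using lt unfolding d1_def d2_def by auto
  then have t: "0 < t" "t < 1" unfolding t_def by (auto simp: field_simps)
  define z where "z = (1-t) * y1 + t * y2"
  have zz: "z = y1 + t * (y2 - y1)" "z = y2 - (1-t) * (y2-y1)" unfolding z_def by (simp_all add: algebra_simps)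
  have z: "y1 < z" "z < y2" unfolding zz(1) using t y apply simp
    using zz t y by (smt (verit) mult_pos_pos)
  have "xat g h z - xat g' h' z = - (1-t) * d1 + t * d2"
    unfolding xat_convex[OF z_def] d1_def d2_def by (simp add: algebra_simps)
  also have "\<dots> = - d1 + t * (d1 + d2)" by (simp add: algebra_simps)
  also have "\<dots> = 0" unfolding t_def using d by simp
  finally show ?thesis using z assms by (intro meet_xatI[of g h g' h' z]) auto
qed

text \<open>The point \<open>v\<close> below is the lower one of the upper ends of the two innermost edges crossing the strip
  between heights 0 and 1; its triangle over the unit base has a lattice point at height 1.\<close>
lemma strip_apex:
  fixes E :: "((int \<times> int) \<times> (int \<times> int)) set" and v0 :: "int \<times> int"
  assumes fin: "finite E"
    and low: "\<And>g h. (g,h) \<in> E \<Longrightarrow> snd g \<le> 0 \<and> snd h \<ge> 1"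
    and ncr: "\<And>g h g' h'. (g,h) \<in> E \<Longrightarrow> (g',h') \<in> E \<Longrightarrow> (g,h) \<noteq> (g',h') \<Longrightarrow> \<not> meet g h g' h'"
    and base: "\<And>g h. (g,h) \<in> E \<Longrightarrow> xat g h 0 \<le> 0 \<or> xat g h 0 \<ge> 1"
    and v0: "snd v0 \<ge> 1"
  shows "\<exists>v i. (v = v0 \<or> (\<exists>g. (g,v) \<in> E)) \<and> snd v \<ge> 1 \<and>
     fst v \<le> i * snd v \<and> i * snd v \<le> snd v + fst v - 1 \<and>
     (\<forall>(g,h)\<in>E. (xat g h 0 \<le> 0 \<and> xat g h 1 \<le> real_of_int i) \<or> (xat g h 0 \<ge> 1 \<and> xat g h 1 \<ge> real_of_int i))"
proof -
  define L where "L = {e\<in>E. xat (fst e) (snd e) 0 \<le> 0}"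
  define R where "R = {e\<in>E. xat (fst e) (snd e) 0 \<ge> 1}"
  have finL: "finite L" and finR: "finite R" unfolding L_def R_def using fin by auto
  have LR: "E = L \<union> R" using base unfolding L_def R_def by force
  let ?x1 = "\<lambda>e. xat (fst e) (snd e) 1"
  \<comment> \<open>The two bounds are the abscissas at height 1 of the segments from (0,0) and from
    (1,0) to \<open>v\<close>: no edge of \<open>L\<close> passes right of the first, none of
    \<open>R\<close> left of the second.\<close>
  define ok where "ok v \<longleftrightarrow> (v = v0 \<or> (\<exists>g. (g,v) \<in> E)) \<and> snd v \<ge> 1 \<and>
     (\<forall>e\<in>L. ?x1 e \<le> real_of_int (fst v) / real_of_int (snd v)) \<and>
     (\<forall>e\<in>R. ?x1 e \<ge> 1 + (real_of_int (fst v) - 1) / real_of_int (snd v))" for v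
  have conv: "xat g h 1 = (1 - 1 / real_of_int Y) * xat g h 0 + (1 / real_of_int Y) * xat g h (real_of_int Y)"
    if "Y \<ge> 1" for g h Y
    using that by (intro xat_convex) (simp add: field_simps)
  have wt: "1 - 1 / real_of_int Y \<ge> 0" if "Y \<ge> 1" for Y using that by simp
  \<comment> \<open>At height 0 the edges of \<open>L\<close> lie left of those of \<open>R\<close>;
    without crossings this order persists up to the lower of the two upper ends.\<close>
  have order: "xat g h y \<le> xat g' h' y"
    if "(g,h) \<in> L" "(g',h') \<in> R" "0 < y" "y \<le> real_of_int (snd h)" "y \<le> real_of_int (snd h')" for g h g' h' y
  proof (rule ccontr)
    assume "\<not> ?thesis"
    moreover have "(g,h) \<in> E" "(g',h') \<in> E" "(g,h) \<noteq> (g',h')" "xat g h 0 < xat g' h' 0"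
      using that unfolding L_def R_def by auto
    ultimately show False using ncr[of g h g' h'] that meet_swap_order[of g h g' h' 0 y]
        low[of g h] low[of g' h'] by auto
  qed
  have okL: "ok (snd f)" if f: "f \<in> L" "\<And>e. e \<in> L \<Longrightarrow> ?x1 e \<le> ?x1 f"
    and g: "\<And>e. e \<in> R \<Longrightarrow> \<exists>e'\<in>R. ?x1 e' \<le> ?x1 e \<and> snd (snd e') \<ge> snd (snd f)" for f
  proof -
    obtain a v where fv: "f = (a,v)" by (cases f) auto
    have v: "(a,v) \<in> E" "snd v \<ge> 1" "snd a \<le> 0" using f(1) low[of a v] unfolding fv L_def by auto
    have xv: "xat a v (real_of_int (snd v)) = real_of_int (fst v)" using v by (intro xat_upper) auto
    have b1: "?x1 f \<le> real_of_int (fst v) / real_of_int (snd v)"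
      unfolding fv fst_conv snd_conv conv[OF v(2)] xv
      using f(1) wt[OF v(2)] unfolding fv L_def by (simp add: mult_nonneg_nonpos)
    moreover have "?x1 e \<ge> 1 + (real_of_int (fst v) - 1) / real_of_int (snd v)" if eR: "e \<in> R" for e
    proof -
      obtain e' where e': "e' \<in> R" "?x1 e' \<le> ?x1 e" "snd (snd e') \<ge> snd v" using g[OF eR] unfolding fv by auto
      obtain g h where gh: "e' = (g,h)" by (cases e') auto
      have "real_of_int (fst v) \<le> xat g h (real_of_int (snd v))"
        using order[of a v g h "real_of_int (snd v)"] f(1) e' v unfolding fv gh xv by simp
      moreover have "xat g h 0 \<ge> 1" using e' unfolding gh R_def by simp
      ultimately have "?x1 e' \<ge> (1 - 1 / real_of_int (snd v)) * 1 + (1 / real_of_int (snd v)) * real_of_int (fst v)"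
        unfolding gh fst_conv snd_conv conv[OF v(2)] using wt[OF v(2)] v(2)
        by (intro add_mono mult_left_mono) auto
      then show ?thesis using e'(2) by (simp add: diff_divide_distrib)
    qed
    moreover have "?x1 e \<le> real_of_int (fst v) / real_of_int (snd v)" if "e \<in> L" for e
      using f(2)[OF that] b1 by linarith
    moreover have "snd f = v" using fv by simp
    ultimately show ?thesis unfolding ok_def using v by blast
  qed
  have okR: "ok (snd f)" if f: "f \<in> R" "\<And>e. e \<in> R \<Longrightarrow> ?x1 e \<ge> ?x1 f"
    and g: "\<And>e. e \<in> L \<Longrightarrow> \<exists>e'\<in>L. ?x1 e' \<ge> ?x1 e \<and> snd (snd e') \<ge> snd (snd f)" for f
  proof -
    obtain a v where fv: "f = (a,v)" by (cases f) auto
    have v: "(a,v) \<in> E" "snd v \<ge> 1" "snd a \<le> 0" using f(1) low[of a v] unfolding fv R_def by auto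
    have xv: "xat a v (real_of_int (snd v)) = real_of_int (fst v)" using v by (intro xat_upper) auto
    have "xat a v 0 \<ge> 1" using f(1) unfolding fv R_def by simp
    then have "?x1 f \<ge> (1 - 1 / real_of_int (snd v)) * 1 + (1 / real_of_int (snd v)) * real_of_int (fst v)"
      unfolding fv fst_conv snd_conv conv[OF v(2)] xv using wt[OF v(2)] v(2)
      by (intro add_mono mult_left_mono) auto
    then have b1: "?x1 f \<ge> 1 + (real_of_int (fst v) - 1) / real_of_int (snd v)" by (simp add: diff_divide_distrib)
    moreover have "?x1 e \<le> real_of_int (fst v) / real_of_int (snd v)" if eR: "e \<in> L" for e
    proof -
      obtain e' where e': "e' \<in> L" "?x1 e \<le> ?x1 e'" "snd (snd e') \<ge> snd v" using g[OF eR] unfolding fv by auto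
      obtain g h where gh: "e' = (g,h)" by (cases e') auto
      have "real_of_int (fst v) \<ge> xat g h (real_of_int (snd v))"
        using order[of g h a v "real_of_int (snd v)"] f(1) e' v unfolding fv gh xv by simp
      moreover have "xat g h 0 \<le> 0" using e' unfolding gh L_def by simp
      ultimately have "?x1 e' \<le> (1 - 1 / real_of_int (snd v)) * 0 + (1 / real_of_int (snd v)) * real_of_int (fst v)"
        unfolding gh fst_conv snd_conv conv[OF v(2)] using wt[OF v(2)] v(2)
        by (intro add_mono mult_left_mono) auto
      then show ?thesis using e'(2) by simp
    qed
    moreover have "?x1 e \<ge> 1 + (real_of_int (fst v) - 1) / real_of_int (snd v)" if "e \<in> R" for e
      using f(2)[OF that] b1 by linarith
    moreover have "snd f = v" using fv by simp
    ultimately show ?thesis unfolding ok_def using v by blast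
  qed
  have "\<exists>v. ok v"
  proof -
    have mL: "\<exists>f\<in>L. \<forall>e\<in>L. ?x1 e \<le> ?x1 f" if "L \<noteq> {}"
      using finite_has_max_value[OF finL that] .
    have mR: "\<exists>f\<in>R. \<forall>e\<in>R. ?x1 e \<ge> ?x1 f" if "R \<noteq> {}"
      using finite_has_max_value[OF finR that, of "\<lambda>e. - ?x1 e"] by simp
    consider "L = {}" "R = {}" | "L \<noteq> {}" "R = {}" | "L = {}" "R \<noteq> {}" | "L \<noteq> {}" "R \<noteq> {}" by blast
    then show ?thesis
    proof cases
      case 1 then show ?thesis using v0 unfolding ok_def by blast
    next
      case 2 then show ?thesis using mL okL by blast
    next
      case 3 then show ?thesis using mR okR by blast
    next
      case 4
      obtain f g where f: "f\<in>L" "\<And>e. e\<in>L \<Longrightarrow> ?x1 e \<le> ?x1 f" and g: "g\<in>R" "\<And>e. e\<in>R \<Longrightarrow> ?x1 e \<ge> ?x1 g"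
        using mL mR 4 by blast
      show ?thesis
      proof (cases "snd (snd f) \<le> snd (snd g)")
        case True then have "ok (snd f)" using f g by (intro okL; blast)
        then show ?thesis by blast
      next
        case False then have "snd (snd g) \<le> snd (snd f)" by simp
        then have "ok (snd g)" using f g by (intro okR; blast)
        then show ?thesis by blast
      qed
    qed
  qed
  then obtain v where v: "ok v" ..
  define Y where "Y = snd v"
  \<comment> \<open>The ceiling of \<open>fst v / Y\<close>. The admissible interval up to
    \<open>1 + (fst v - 1) / Y\<close> has ends in multiples of \<open>1 / Y\<close> and length
    \<open>1 - 1 / Y\<close>, so it contains this integer.\<close>
  define i where "i = (fst v + Y - 1) div Y"
  have Y: "Y \<ge> 1" using v unfolding ok_def Y_def by simp
  have "(fst v + Y - 1) = Y * i + (fst v + Y - 1) mod Y" unfolding i_def by simp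
  moreover have "0 \<le> (fst v + Y - 1) mod Y" "(fst v + Y - 1) mod Y < Y" using Y by auto
  ultimately have i: "fst v \<le> i * Y" "i * Y \<le> Y + fst v - 1" by (auto simp: mult.commute)
  have ir: "real_of_int (fst v) \<le> real_of_int i * real_of_int Y" "real_of_int i * real_of_int Y \<le> real_of_int Y + real_of_int (fst v) - 1"
    using i by (metis of_int_le_iff of_int_mult, metis (mono_tags, opaque_lifting) of_int_le_iff of_int_mult of_int_add of_int_diff of_int_1)
  have ib: "real_of_int (fst v) / real_of_int Y \<le> real_of_int i" "real_of_int i \<le> 1 + (real_of_int (fst v) - 1) / real_of_int Y"
    using ir Y by (auto simp: field_simps)
  have "(xat g h 0 \<le> 0 \<and> xat g h 1 \<le> real_of_int i) \<or> (xat g h 0 \<ge> 1 \<and> xat g h 1 \<ge> real_of_int i)"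
    if E: "(g,h) \<in> E" for g h
  proof -
    consider "(g,h) \<in> L" | "(g,h) \<in> R" using E LR by blast
    then show ?thesis
    proof cases
      case 1
      then have "xat g h 0 \<le> 0" unfolding L_def by simp
      moreover have "xat g h 1 \<le> real_of_int (fst v) / real_of_int Y"
        using v 1 unfolding ok_def Y_def by (metis fst_conv snd_conv)
      ultimately show ?thesis using ib by linarith
    next
      case 2
      then have "xat g h 0 \<ge> 1" unfolding R_def by simp
      moreover have "xat g h 1 \<ge> 1 + (real_of_int (fst v) - 1) / real_of_int Y"
        using v 2 unfolding ok_def Y_def by (metis fst_conv snd_conv)
      ultimately show ?thesis using ib by linarith
    qed
  qed
  then show ?thesis using v i unfolding ok_def Y_def by (intro exI[of _ v] exI[of _ i]) auto
qed

section \<open>Triangles of a triangulation\<close>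

lemma wedge_self [simp]: "wedge u u = 0"
  by (simp add: wedge_def)

lemma wedge_linear:
  "wedge (u + v) w = wedge u w + wedge v w" "wedge w (u + v) = wedge w u + wedge w v"
  "wedge (u - v) w = wedge u w - wedge v w" "wedge w (u - v) = wedge w u - wedge w v"
  by (auto simp: wedge_def algebra_simps)

lemma wedge_antisym: "wedge u v = - wedge v u"
  by (simp add: wedge_def)

lemma coprime_of_wedge: "\<bar>wedge u v\<bar> = 1 \<Longrightarrow> coprime (fst u) (snd u)"
proof (rule coprimeI)
  fix c assume "\<bar>wedge u v\<bar> = 1" "c dvd fst u" "c dvd snd u"
  then have "c dvd wedge u v" unfolding wedge_def by simp
  then show "is_unit c" using \<open>\<bar>wedge u v\<bar> = 1\<close> by (metis dvd_abs_iff)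
qed

lemma Lam0_iff: "z \<in> Lam0 n k \<longleftrightarrow> 2 * fst z \<le> int n \<and> - 2 * fst z \<le> int n \<and> - snd z \<le> 0 \<and> snd z \<le> int k"
  by (cases z) (auto simp: Lam0_def)

text \<open>If the coordinate differences have gcd \<open>g > 1\<close>, the point at parameter
  \<open>1 / g\<close> is a lattice point and stays in the rectangle by convexity. Conversely a
  Bezout combination shows that a lattice point on the line has an integer parameter, so none lies
  strictly inside.\<close>

lemma valid_edge_iff:
  "valid_edge n k {p,q} \<longleftrightarrow> p \<in> Lam0 n k \<and> q \<in> Lam0 n k \<and> p \<noteq> q \<and> coprime (fst q - fst p) (snd q - snd p)"
    (is "?l \<longleftrightarrow> ?r")
proof
  assume l: ?l
  then have pq: "p \<in> Lam0 n k" "q \<in> Lam0 n k" "p \<noteq> q"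
    unfolding valid_edge_def by (auto simp: doubleton_eq_iff)
  define g where "g = gcd (fst q - fst p) (snd q - snd p)"
  have g0: "g > 0" using pq(3) unfolding g_def by (auto simp: prod_eq_iff)
  obtain a b where ab: "fst q - fst p = g * a" "snd q - snd p = g * b"
    using gcd_dvd1[of "fst q - fst p" "snd q - snd p"] gcd_dvd2[of "fst q - fst p" "snd q - snd p"]
    unfolding g_def[symmetric] by (elim dvdE) blast
  have "g = 1"
  proof (rule ccontr)
    assume "g \<noteq> 1"
    then have g2: "g \<ge> 2" using g0 by linarith
    define z where "z = (fst p + a, snd p + b)"
    have btw: "lo \<le> x + c \<and> x + c \<le> hi"
      if b: "lo \<le> x" "x \<le> hi" "lo \<le> x + g * c" "x + g * c \<le> hi" for x c lo hi :: int
    proof (cases "c \<ge> 0")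
      case True then have "c \<le> g * c" using g2 by (simp add: mult_le_cancel_right1)
      then show ?thesis using True b by linarith
    next
      case False then have "g * c \<le> c" using g2 by (simp add: mult_le_cancel_right1)
      then show ?thesis using False b by linarith
    qed
    have qq: "fst q = fst p + g * a" "snd q = snd p + g * b" using ab by auto
    have "- int n \<le> 2 * fst p + 2 * a \<and> 2 * fst p + 2 * a \<le> int n"
      by (rule btw) (use pq(1,2) in \<open>auto simp: Lam0_iff qq algebra_simps\<close>)
    moreover have "0 \<le> snd p + b \<and> snd p + b \<le> int k"
      by (rule btw) (use pq(1,2) in \<open>auto simp: Lam0_iff qq\<close>)
    ultimately have "z \<in> Lam0 n k" unfolding Lam0_iff z_def by auto
    moreover have "pt z \<in> oseg {p,q}"
      unfolding pt_in_oseg[OF pq(3)] ab z_def using g2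
      by (intro exI[of _ "1 / real_of_int g"]) auto
    ultimately show False using l unfolding valid_edge_def by blast
  qed
  then have "coprime (fst q - fst p) (snd q - snd p)" unfolding g_def coprime_iff_gcd_eq_1 .
  then show ?r using pq by blast
next
  assume r: ?r
  have "pt z \<notin> oseg {p,q}" for z
  proof
    assume "pt z \<in> oseg {p,q}"
    then obtain u :: real where u: "0 < u" "u < 1"
     "real_of_int (fst z) = real_of_int (fst p) + u * real_of_int (fst q - fst p)"
     "real_of_int (snd z) = real_of_int (snd p) + u * real_of_int (snd q - snd p)"
      using r pt_in_oseg[of p q z] by blast
    obtain a b where ab: "a * (fst q - fst p) + b * (snd q - snd p) = 1"
      using r bezout_int[of "fst q - fst p" "snd q - snd p"] unfolding coprime_iff_gcd_eq_1 by metis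
    have "u = u * real_of_int (a * (fst q - fst p) + b * (snd q - snd p))" unfolding ab by simp
    also have "\<dots> = real_of_int a * (u * real_of_int (fst q - fst p)) + real_of_int b * (u * real_of_int (snd q - snd p))"
      by (simp add: algebra_simps)
    also have "\<dots> = real_of_int (a * (fst z - fst p) + b * (snd z - snd p))" using u(3,4) by simp
    finally have "u \<in> \<int>" by (metis Ints_of_int)
    then show False using u by (auto elim!: Ints_cases)
  qed
  then show ?l using r unfolding valid_edge_def by blast
qed

lemma valid_edgeE:
  assumes "valid_edge n k e"
  obtains p q where "e = {p,q}" "p \<noteq> q" "p \<in> Lam0 n k" "q \<in> Lam0 n k"
  using assms unfolding valid_edge_def by metis

lemma tri_valid: "triangulation n k \<sigma> \<Longrightarrow> e \<in> \<sigma> \<Longrightarrow> valid_edge n k e"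
  unfolding triangulation_def edge_config_def by simp

lemma tri_edge:
  assumes "triangulation n k \<sigma>" "{p,q} \<in> \<sigma>"
  shows "p \<noteq> q" "p \<in> Lam0 n k" "q \<in> Lam0 n k" "coprime (fst q - fst p) (snd q - snd p)"
  using tri_valid[OF assms] unfolding valid_edge_iff by auto

lemma tri_not_meet:
  assumes "triangulation n k \<sigma>" "{p,q} \<in> \<sigma>" "{r,s} \<in> \<sigma>" "{p,q} \<noteq> {r,s}"
  shows "\<not> meet p q r s"
proof -
  have "\<forall>e\<in>\<sigma>. \<forall>e'\<in>\<sigma>. e \<noteq> e' \<longrightarrow> oseg e \<inter> oseg e' = {}"
    using assms(1) unfolding triangulation_def edge_config_def by (elim conjE)
  then have "oseg {p,q} \<inter> oseg {r,s} = {}" using assms(2-4) by (metis (no_types))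
  then show ?thesis using oseg_meet[of p q r s] tri_edge[OF assms(1,2)] tri_edge[OF assms(1,3)] by blast
qed

text \<open>Adding a valid edge that meets no other edge gives a larger configuration, so by
  maximality it was already present.\<close>

lemma tri_memI:
  assumes tri: "triangulation n k \<sigma>" and val: "valid_edge n k {p,q}"
    and nm: "\<And>r s. {r,s} \<in> \<sigma> \<Longrightarrow> {r,s} \<noteq> {p,q} \<Longrightarrow> \<not> meet p q r s"
  shows "{p,q} \<in> \<sigma>"
proof -
  have pq: "p \<noteq> q" using val unfolding valid_edge_iff by simp
  have d: "oseg {p,q} \<inter> oseg e = {}" if e: "e \<in> \<sigma>" "e \<noteq> {p,q}" for e
  proof -
    obtain r s where "e = {r,s}" "r \<noteq> s" by (rule valid_edgeE[OF tri_valid[OF tri e(1)]])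
    then show ?thesis using nm e oseg_meet[OF pq, of r s] by blast
  qed
  have d': "oseg e \<inter> oseg {p,q} = {}" if e: "e \<in> \<sigma>" "e \<noteq> {p,q}" for e
    using d[OF e] by blast
  have "edge_config n k (insert {p,q} \<sigma>)"
    using tri val d d' unfolding triangulation_def edge_config_def ball_simps insert_iff by metis
  then show ?thesis using tri unfolding triangulation_def by blast
qed

lemma finite_Lam0: "finite (Lam0 n k)"
proof (rule finite_subset)
  show "Lam0 n k \<subseteq> {-int n..int n} \<times> {0..int k}" unfolding Lam0_def by auto
qed auto

lemma tri_subset_Pow: "triangulation n k \<sigma> \<Longrightarrow> \<sigma> \<subseteq> Pow (Lam0 n k)"
  using valid_edgeE[OF tri_valid] by blast

lemma tri_finite: "triangulation n k \<sigma> \<Longrightarrow> finite \<sigma>"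
  using finite_subset[OF tri_subset_Pow] finite_Lam0 by blast

lemma finite_Omega: "finite (Omega n k \<xi>)"
proof (rule finite_subset)
  show "Omega n k \<xi> \<subseteq> Pow (Pow (Lam0 n k))" unfolding Omega_def using tri_subset_Pow by blast
qed (simp add: finite_Lam0)

lemma convex_bound:
  fixes Y w1 w2 x y z t N :: int
  assumes "w1 \<ge> 0" "w2 \<ge> 0" "w1 + w2 + 1 = Y" "x \<le> N" "y \<le> N" "z \<le> N" "Y * t = w1 * x + w2 * y + z"
  shows "t \<le> N"
proof -
  have "Y * t \<le> w1 * N + w2 * N + N" using assms by (simp add: add_mono mult_left_mono)
  also have "\<dots> = Y * N" using assms(3) by (auto simp: algebra_simps)
  finally have "Y * t \<le> Y * N" .
  moreover have "Y > 0" using assms(1-3) by linarith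
  ultimately show ?thesis by (simp only: mult_le_cancel_left_pos)
qed

text \<open>\<open>r\<close> is the average of \<open>p\<close>, \<open>q\<close>, \<open>v\<close>
  with weights \<open>w1 / Y\<close>, \<open>w2 / Y\<close>, \<open>1 / Y\<close>, and the rectangle
  is convex; clearing denominators keeps the computation integral.\<close>

lemma Lam0_convex:
  assumes "w1 \<ge> 0" "w2 \<ge> 0" "w1 + w2 + 1 = Y" "p \<in> Lam0 n k" "q \<in> Lam0 n k" "v \<in> Lam0 n k"
    "Y * fst r = w1 * fst p + w2 * fst q + fst v" "Y * snd r = w1 * snd p + w2 * snd q + snd v"
  shows "r \<in> Lam0 n k"
proof -
  note L = Lam0_iff
  note cb = convex_bound[OF assms(1,2,3)]
  show ?thesis unfolding L
  proof (intro conjI)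
    show "2 * fst r \<le> int n" by (rule cb[of "2 * fst p" _ "2 * fst q" "2 * fst v"]) (use assms L in \<open>auto simp: algebra_simps\<close>)
    show "- 2 * fst r \<le> int n" by (rule cb[of "- 2 * fst p" _ "- 2 * fst q" "- 2 * fst v"]) (use assms L in \<open>auto simp: algebra_simps\<close>)
    show "- snd r \<le> 0" by (rule cb[of "- snd p" _ "- snd q" "- snd v"]) (use assms L in \<open>auto simp: algebra_simps\<close>)
    show "snd r \<le> int k" by (rule cb[of "snd p" _ "snd q" "snd v"]) (use assms L in \<open>auto simp: algebra_simps\<close>)
  qed
qed

section \<open>Triangles on the two sides of an edge\<close>

lemma meet_horizontal:
  assumes "snd g \<le> y0" "y0 \<le> snd h" "snd g < snd h"
    "real_of_int a < xat g h (real_of_int y0)" "xat g h (real_of_int y0) < real_of_int a + 1"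
  shows "meet g h (a,y0) (a+1,y0)"
proof -
  \<comment> \<open>The ends have integer abscissas, while at height \<open>y0\<close> the abscissa
    lies strictly between consecutive integers.\<close>
  have "snd g \<noteq> y0" "y0 \<noteq> snd h" using assms xat_lower[of g h] xat_upper[of g h] by auto
  then have lt: "snd g < y0" "y0 < snd h" using assms by auto
  define \<alpha> where "\<alpha> = (real_of_int y0 - real_of_int (snd g)) / real_of_int (snd h - snd g)"
  define \<beta> where "\<beta> = xat g h (real_of_int y0) - real_of_int a"
  have pos: "real_of_int (snd h - snd g) > 0" using lt by simp
  have \<alpha>: "0 < \<alpha>" "\<alpha> < 1" unfolding \<alpha>_def using lt pos by (auto simp: field_simps)
  have y: "real_of_int y0 = real_of_int (snd g) + \<alpha> * real_of_int (snd h - snd g)"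
    unfolding \<alpha>_def using pos by simp
  show ?thesis
    by (rule meetI[of \<alpha> \<beta>]) (use \<alpha> assms y xat_at[OF assms(3) y] in \<open>simp_all add: \<beta>_def\<close>)
qed

text \<open>The common point has height strictly between 0 and 1, whereas ends have integer heights;
  so the ends lie on different sides of the strip.\<close>

lemma meet_height_in_unit:
  assumes "meet (x,0) (x',1) g h"
  shows "(snd g \<le> 0 \<and> snd h \<ge> 1) \<or> (snd h \<le> 0 \<and> snd g \<ge> 1)"
  using assms
proof (rule meetE)
  fix \<alpha> \<beta> :: real
  assume *: "0 < \<alpha>" "\<alpha> < 1" "0 < \<beta>" "\<beta> < 1"
    "real_of_int (snd (x,0)) + \<alpha> * real_of_int (snd (x',1) - snd (x,0)) = real_of_int (snd g) + \<beta> * real_of_int (snd h - snd g)"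
  then have \<alpha>: "\<alpha> = (1-\<beta>) * real_of_int (snd g) + \<beta> * real_of_int (snd h)" by (simp add: algebra_simps)
  show ?thesis
  proof (rule ccontr)
    assume "\<not> ?thesis"
    then consider "snd g \<le> 0 \<and> snd h \<le> 0" | "snd g \<ge> 1 \<and> snd h \<ge> 1" by linarith
    then show False
    proof cases
      case 1 then have "\<alpha> \<le> 0" unfolding \<alpha> using * by (intro add_nonpos_nonpos mult_nonneg_nonpos) auto
      then show False using * by simp
    next
      case 2 then have "(1-\<beta>) * 1 + \<beta> * 1 \<le> \<alpha>" unfolding \<alpha> using * by (intro add_mono mult_left_mono) auto
      then show False using * by simp
    qed
  qed
qed

lemma meet_xatD:
  assumes "meet (x,0) (x',1) g h" "snd g \<le> 0" "snd h \<ge> 1"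
  obtains \<alpha> :: real where "0 < \<alpha>" "\<alpha> < 1"
    "(1-\<alpha>) * xat g h 0 + \<alpha> * xat g h 1 = (1-\<alpha>) * real_of_int x + \<alpha> * real_of_int x'"
  using assms(1)
proof (rule meetE)
  fix \<alpha> \<beta> :: real
  assume *: "0 < \<alpha>" "\<alpha> < 1" "0 < \<beta>" "\<beta> < 1"
    "real_of_int (fst (x,0)) + \<alpha> * real_of_int (fst (x',1) - fst (x,0)) = real_of_int (fst g) + \<beta> * real_of_int (fst h - fst g)"
    "real_of_int (snd (x,0)) + \<alpha> * real_of_int (snd (x',1) - snd (x,0)) = real_of_int (snd g) + \<beta> * real_of_int (snd h - snd g)"
  have "snd g < snd h" using assms by simp
  moreover have "\<alpha> = real_of_int (snd g) + \<beta> * real_of_int (snd h - snd g)" using * by simp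
  ultimately have "xat g h \<alpha> = real_of_int (fst g) + \<beta> * real_of_int (fst h - fst g)" by (rule xat_at)
  moreover have "xat g h \<alpha> = (1-\<alpha>) * xat g h 0 + \<alpha> * xat g h 1" by (rule xat_convex) simp
  ultimately show thesis using * by (intro that[of \<alpha>]) (simp_all add: algebra_simps)
qed

lemma bezout_wedge:
  assumes "coprime (fst d) (snd d)"
  obtains c where "wedge d c = 1"
proof -
  obtain a b where "a * fst d + b * snd d = 1"
    using assms bezout_int[of "fst d" "snd d"] by (auto simp: coprime_iff_gcd_eq_1)
  then have "wedge d (-b, a) = 1" by (simp add: wedge_def algebra_simps)
  then show thesis by (rule that)
qed

lemma wedge_expand:
  assumes "wedge d c = 1"
  shows "fst w = wedge w c * fst d + wedge d w * fst c" "snd w = wedge w c * snd d + wedge d w * snd c"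
proof -
  have "wedge w c * fst d + wedge d w * fst c = wedge d c * fst w" "wedge w c * snd d + wedge d w * snd c = wedge d c * snd w"
    by (simp_all add: wedge_def algebra_simps)
  then show "fst w = wedge w c * fst d + wedge d w * fst c" "snd w = wedge w c * snd d + wedge d w * snd c" using assms by simp_all
qed

text \<open>The new coordinates of \<open>z\<close> are those of \<open>z - p\<close> in the basis
  \<open>d\<close>, \<open>c\<close>; they send \<open>p\<close> to the origin and
  \<open>p + d\<close> to (1,0).\<close>

lemma meet_wedge_coords:
  assumes "wedge d c = 1"
  shows "meet g h g' h' \<longleftrightarrow> meet (wedge (g-p) c, wedge d (g-p)) (wedge (h-p) c, wedge d (h-p))
     (wedge (g'-p) c, wedge d (g'-p)) (wedge (h'-p) c, wedge d (h'-p))"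
  by (rule meet_affine[where a = "snd c" and b = "- fst c" and c = "- snd d" and d = "fst d"
      and e = "- wedge p c" and f = "- wedge d p"])
    (use assms in \<open>auto simp: wedge_def algebra_simps\<close>)

lemma wedge_coords_inj:
  assumes "wedge d c = 1" "wedge (g-p) c = wedge (h-p) c" "wedge d (g-p) = wedge d (h-p)"
  shows "g = h"
  using wedge_expand[OF assms(1), of "g-p"] wedge_expand[OF assms(1), of "h-p"] assms(2,3)
  by (auto simp: prod_eq_iff)

text \<open>In a basis starting with \<open>q - p\<close> the edge is a unit base, and at height 1
  there is a lattice point that no edge separates from the base. The two sides to that point meet no
  other edge, so maximality puts them into \<sigma>. The point \<open>v0\<close> ensures that the
  rectangle extends to this side of the edge.\<close>

theorem apex_exists:
  assumes tri: "triangulation n k \<sigma>" and pq: "{p,q} \<in> \<sigma>"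
    and v0: "v0 \<in> Lam0 n k" "wedge (q - p) (v0 - p) > 0"
  shows "\<exists>r\<in>Lam0 n k. wedge (q - p) (r - p) = 1 \<and> {p,r} \<in> \<sigma> \<and> {q,r} \<in> \<sigma>"
proof -
  note e = tri_edge[OF tri pq]
  define d where "d = q - p"
  obtain c where c: "wedge d c = 1" using bezout_wedge[of d] e(4) unfolding d_def by auto
  define X where "X z = wedge (z - p) c" for z
  define Y where "Y z = wedge d (z - p)" for z
  define \<phi> where "\<phi> z = (X z, Y z)" for z
  have meet_\<phi>: "meet g h g' h' \<longleftrightarrow> meet (\<phi> g) (\<phi> h) (\<phi> g') (\<phi> h')" for g h g' h'
    unfolding \<phi>_def X_def Y_def by (rule meet_wedge_coords[OF c])
  have inj: "\<phi> g = \<phi> h \<Longrightarrow> g = h" for g h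
    unfolding \<phi>_def X_def Y_def using wedge_coords_inj[OF c, of g p h] by simp
  have XYp: "X p = 0" "Y p = 0" unfolding X_def Y_def by (auto simp: wedge_def)
  have XYq: "X q = 1" "Y q = 0" using c unfolding X_def Y_def d_def by auto
  define E where "E = (\<lambda>(g,h). (\<phi> g, \<phi> h)) ` {(g,h). {g,h} \<in> \<sigma> \<and> Y g \<le> 0 \<and> Y h \<ge> 1}"
  have "{(g,h). {g,h} \<in> \<sigma> \<and> Y g \<le> 0 \<and> Y h \<ge> 1} \<subseteq> Lam0 n k \<times> Lam0 n k"
    using tri_edge[OF tri] by blast
  then have finE: "finite E" unfolding E_def using finite_Lam0 finite_subset by blast
  have EI: "(\<phi> g, \<phi> h) \<in> E" if "{g,h} \<in> \<sigma>" "Y g \<le> 0" "Y h \<ge> 1" for g h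
    unfolding E_def using that by auto
  have EE: "\<exists>g0 h0. g = \<phi> g0 \<and> h = \<phi> h0 \<and> {g0,h0} \<in> \<sigma> \<and> Y g0 \<le> 0 \<and> Y h0 \<ge> 1" if "(g,h) \<in> E" for g h
    using that unfolding E_def by auto
  have "\<exists>v i. (v = \<phi> v0 \<or> (\<exists>g. (g,v) \<in> E)) \<and> snd v \<ge> 1 \<and>
     fst v \<le> i * snd v \<and> i * snd v \<le> snd v + fst v - 1 \<and>
     (\<forall>(g,h)\<in>E. (xat g h 0 \<le> 0 \<and> xat g h 1 \<le> real_of_int i) \<or> (xat g h 0 \<ge> 1 \<and> xat g h 1 \<ge> real_of_int i))"
  proof (rule strip_apex[OF finE])
    show "snd (\<phi> v0) \<ge> 1" using v0(2) unfolding \<phi>_def Y_def d_def by simp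
  next
    fix g h assume "(g,h) \<in> E"
    then show "snd g \<le> 0 \<and> snd h \<ge> 1" using EE[of g h] unfolding \<phi>_def by auto
  next
    fix g h g' h' assume a: "(g,h) \<in> E" "(g',h') \<in> E" "(g,h) \<noteq> (g',h')"
    obtain g0 h0 where 1: "g = \<phi> g0" "h = \<phi> h0" "{g0,h0} \<in> \<sigma>" "Y g0 \<le> 0" "Y h0 \<ge> 1" using EE[OF a(1)] by blast
    obtain g0' h0' where 2: "g' = \<phi> g0'" "h' = \<phi> h0'" "{g0',h0'} \<in> \<sigma>" "Y g0' \<le> 0" "Y h0' \<ge> 1" using EE[OF a(2)] by blast
    have "{g0,h0} \<noteq> {g0',h0'}" using 1 2 a(3) by (auto simp: doubleton_eq_iff)
    then show "\<not> meet g h g' h'" using tri_not_meet[OF tri 1(3) 2(3)] meet_\<phi> 1 2 by blast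
  next
    fix g h assume a: "(g,h) \<in> E"
    obtain g0 h0 where 1: "g = \<phi> g0" "h = \<phi> h0" "{g0,h0} \<in> \<sigma>" "Y g0 \<le> 0" "Y h0 \<ge> 1" using EE[OF a(1)] by blast
    have "{g0,h0} \<noteq> {p,q}" using XYp XYq 1 by (auto simp: doubleton_eq_iff)
    then have "\<not> meet g h (\<phi> p) (\<phi> q)" using tri_not_meet[OF tri 1(3) pq] meet_\<phi> 1 by blast
    then have "\<not> meet g h (0,0) (0+1,0)" unfolding \<phi>_def XYp XYq by simp
    moreover have "snd g \<le> 0" "0 \<le> snd h" "snd g < snd h" using 1 unfolding \<phi>_def by auto
    ultimately have "\<not> (0 < xat g h 0 \<and> xat g h 0 < 1)" using meet_horizontal[of g 0 h 0] by auto
    then show "xat g h 0 \<le> 0 \<or> 1 \<le> xat g h 0" by auto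
  qed
  then obtain v i where v: "v = \<phi> v0 \<or> (\<exists>g. (g,v) \<in> E)" "snd v \<ge> 1"
     "fst v \<le> i * snd v" "i * snd v \<le> snd v + fst v - 1" and
     i: "\<And>g h. (g,h)\<in>E \<Longrightarrow> (xat g h 0 \<le> 0 \<and> xat g h 1 \<le> real_of_int i) \<or> (xat g h 0 \<ge> 1 \<and> xat g h 1 \<ge> real_of_int i)"
    by blast
  obtain w where w: "v = \<phi> w" "w \<in> Lam0 n k" using v(1) v0(1) EE tri_edge[OF tri] by blast
  define r where "r = (fst p + i * fst d + fst c, snd p + i * snd d + snd c)"
  have cc: "fst d * snd c - snd d * fst c = 1" using c unfolding wedge_def .
  have Xr: "X r = i"
  proof -
    have "X r = i * (fst d * snd c - snd d * fst c)" unfolding X_def r_def wedge_def by (simp add: algebra_simps)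
    then show ?thesis using cc by simp
  qed
  have Yr: "Y r = 1"
  proof -
    have "Y r = fst d * snd c - snd d * fst c" unfolding Y_def r_def wedge_def by (simp add: algebra_simps)
    then show ?thesis using cc by simp
  qed
  have expand: "fst z = fst p + X z * fst d + Y z * fst c" "snd z = snd p + X z * snd d + Y z * snd c" for z
    using wedge_expand[OF c, of "z - p"] unfolding X_def Y_def by simp_all
  have qd: "fst q = fst p + fst d" "snd q = snd p + snd d" unfolding d_def by auto
  \<comment> \<open>The inequalities for \<open>i\<close> are exactly the nonnegativity of the
    weights that express \<open>r\<close> through \<open>p\<close>, \<open>q\<close> and
    \<open>w\<close>.\<close>
  have rL: "r \<in> Lam0 n k"
  proof (rule Lam0_convex[OF _ _ _ e(2,3) w(2)])
    show "Y w - 1 - (i * Y w - X w) \<ge> 0" "i * Y w - X w \<ge> 0" using v unfolding w \<phi>_def by auto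
    show "Y w - 1 - (i * Y w - X w) + (i * Y w - X w) + 1 = Y w" by simp
    show "Y w * fst r = (Y w - 1 - (i * Y w - X w)) * fst p + (i * Y w - X w) * fst q + fst w"
      unfolding r_def qd expand(1)[of w] fst_conv by (simp add: algebra_simps)
    show "Y w * snd r = (Y w - 1 - (i * Y w - X w)) * snd p + (i * Y w - X w) * snd q + snd w"
      unfolding r_def qd expand(2)[of w] snd_conv by (simp add: algebra_simps)
  qed
  have no_lat: False if gh: "{g,h} \<in> \<sigma>" and z: "z \<in> Lam0 n k"
    and Yz: "Y g < Y z" "Y z < Y h" and x: "xat (\<phi> g) (\<phi> h) (real_of_int (Y z)) = real_of_int (X z)" for g h z
  proof -
    define u where "u = (real_of_int (Y z) - real_of_int (Y g)) / real_of_int (Y h - Y g)"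
    have u01: "0 < u" "u < 1" unfolding u_def using Yz by (auto simp: field_simps)
    have yz: "real_of_int (Y z) = real_of_int (Y g) + u * real_of_int (Y h - Y g)" unfolding u_def using Yz by simp
    have xz: "real_of_int (X z) = real_of_int (X g) + u * real_of_int (X h - X g)"
      using xat_at[of "\<phi> g" "\<phi> h" "real_of_int (Y z)" u] yz x Yz unfolding \<phi>_def by simp
    have fs: "real_of_int (fst z) = real_of_int (fst p) + real_of_int (X z) * real_of_int (fst d) + real_of_int (Y z) * real_of_int (fst c)"
      "real_of_int (snd z) = real_of_int (snd p) + real_of_int (X z) * real_of_int (snd d) + real_of_int (Y z) * real_of_int (snd c)" for z
      using arg_cong[OF expand(1)[of z], of real_of_int] arg_cong[OF expand(2)[of z], of real_of_int] by simp_all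
    have "pt z \<in> oseg {g,h}"
      unfolding pt_in_oseg[OF tri_edge(1)[OF tri gh]]
    proof (intro exI conjI)
      show "0 < u" "u < 1" by fact+
      show "real_of_int (fst z) = real_of_int (fst g) + u * real_of_int (fst h - fst g)"
        unfolding of_int_diff fs(1)[of z] fs(1)[of g] fs(1)[of h] xz yz by (simp add: algebra_simps)
      show "real_of_int (snd z) = real_of_int (snd g) + u * real_of_int (snd h - snd g)"
        unfolding of_int_diff fs(2)[of z] fs(2)[of g] fs(2)[of h] xz yz by (simp add: algebra_simps)
    qed
    then show False using tri_valid[OF tri gh] z unfolding valid_edge_def by blast
  qed
  have side: "{P,r} \<in> \<sigma>" if P: "P \<in> Lam0 n k" "Y P = 0" "X P = 0 \<or> X P = 1" for P
  proof (rule tri_memI[OF tri])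
    have "r \<noteq> P" using Yr P by auto
    moreover have "coprime (fst (r - P)) (snd (r - P))"
    proof (rule coprime_of_wedge[of _ d])
      have "wedge (r - P) d = Y P - Y r" unfolding Y_def by (simp add: wedge_linear wedge_antisym[of d])
      then show "\<bar>wedge (r - P) d\<bar> = 1" using Yr P by simp
    qed
    ultimately show "valid_edge n k {P,r}" using P rL unfolding valid_edge_iff by auto
  next
    have key: "\<not> meet P r g h" if gh: "{g,h} \<in> \<sigma>" "{g,h} \<noteq> {P,r}" and Y: "Y g \<le> 0" "Y h \<ge> 1" for g h
    proof
      assume "meet P r g h"
      then have "meet (X P, 0) (i, 1) (\<phi> g) (\<phi> h)" unfolding meet_\<phi>[of P] using P Xr Yr by (simp add: \<phi>_def)
      then obtain \<alpha> where \<alpha>: "0 < \<alpha>" "\<alpha> < 1"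
       "(1-\<alpha>) * xat (\<phi> g) (\<phi> h) 0 + \<alpha> * xat (\<phi> g) (\<phi> h) 1 = (1-\<alpha>) * real_of_int (X P) + \<alpha> * real_of_int i"
        by (rule meet_xatD) (use Y in \<open>auto simp: \<phi>_def\<close>)
      define a where "a = xat (\<phi> g) (\<phi> h) 0"
      define b where "b = xat (\<phi> g) (\<phi> h) 1"
      have ab: "(1-\<alpha>) * a + \<alpha> * b = (1-\<alpha>) * real_of_int (X P) + \<alpha> * real_of_int i" using \<alpha>(3) unfolding a_def b_def .
      \<comment> \<open>Compared with the side from \<open>P\<close> to \<open>r\<close>, the edge
        deviates in the same direction at both heights. A common point therefore makes it pass
        through \<open>P\<close> and \<open>r\<close>, and as no lattice point lies inside an edge,
        it is the side itself.\<close>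
      have "a = real_of_int (X P) \<and> b = real_of_int i"
      proof -
        have pos: "1 - \<alpha> > 0" "\<alpha> > 0" using \<alpha> by auto
        have "(1-\<alpha>) * (a - real_of_int (X P)) + \<alpha> * (b - real_of_int i) = 0" using ab by (simp add: algebra_simps)
        moreover have "(a \<le> 0 \<and> b \<le> real_of_int i) \<or> (a \<ge> 1 \<and> b \<ge> real_of_int i)"
          using i[OF EI[OF gh(1) Y]] unfolding a_def b_def .
        then have "(a - real_of_int (X P) \<le> 0 \<and> b - real_of_int i \<le> 0) \<or> (a - real_of_int (X P) \<ge> 0 \<and> b - real_of_int i \<ge> 0)"
          using P(3) by auto
        moreover have "s = 0 \<and> t = 0" if "(1-\<alpha>) * s + \<alpha> * t = 0" "(s \<le> 0 \<and> t \<le> 0) \<or> (s \<ge> 0 \<and> t \<ge> 0)" for s t :: real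
        proof -
          from that(2) show ?thesis
          proof
            assume st: "s \<le> 0 \<and> t \<le> 0"
            then have "(1-\<alpha>) * s \<le> 0" "\<alpha> * t \<le> 0" using pos by (auto simp: mult_nonneg_nonpos)
            then have "(1-\<alpha>) * s = 0" "\<alpha> * t = 0" using that(1) by linarith+
            then show ?thesis using pos by simp
          next
            assume st: "s \<ge> 0 \<and> t \<ge> 0"
            then have "(1-\<alpha>) * s \<ge> 0" "\<alpha> * t \<ge> 0" using pos by auto
            then have "(1-\<alpha>) * s = 0" "\<alpha> * t = 0" using that(1) by linarith+
            then show ?thesis using pos by simp
          qed
        qed
        ultimately have "a - real_of_int (X P) = 0 \<and> b - real_of_int i = 0" by blast
        then show ?thesis by simp
      qed
      then have xP: "xat (\<phi> g) (\<phi> h) (real_of_int (Y P)) = real_of_int (X P)"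
        and xr: "xat (\<phi> g) (\<phi> h) (real_of_int (Y r)) = real_of_int (X r)"
        unfolding a_def b_def P(2) Xr Yr by simp_all
      have "Y g = 0" using no_lat[OF gh(1) P(1) _ _ xP] Y P(2) by (cases "Y g < 0") auto
      moreover have "Y h = 1" using no_lat[OF gh(1) rL _ _ xr] Y Yr by (cases "Y h > 1") auto
      ultimately have "\<phi> g = \<phi> P" "\<phi> h = \<phi> r"
        using xP xr xat_lower[of "\<phi> g" "\<phi> h"] xat_upper[of "\<phi> g" "\<phi> h"] P(2) Yr unfolding \<phi>_def by auto
      then have "g = P" "h = r" using inj by auto
      then show False using gh(2) by simp
    qed
    fix g h assume gh: "{g,h} \<in> \<sigma>" "{g,h} \<noteq> {P,r}"
    show "\<not> meet P r g h"
    proof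
      assume m: "meet P r g h"
      then have "meet (X P, 0) (i, 1) (\<phi> g) (\<phi> h)" unfolding meet_\<phi>[of P] using P Xr Yr by (simp add: \<phi>_def)
      then have "(Y g \<le> 0 \<and> Y h \<ge> 1) \<or> (Y h \<le> 0 \<and> Y g \<ge> 1)"
        using meet_height_in_unit unfolding \<phi>_def by fastforce
      then show False using key[of g h] key[of h g] gh m meet_swap2[of P r g h] by (auto simp: insert_commute)
    qed
  qed
  have "{p,r} \<in> \<sigma>" "{q,r} \<in> \<sigma>" using side[of p] side[of q] e XYp XYq by auto
  then show ?thesis using rL Yr unfolding Y_def d_def by blast
qed

text \<open>Two apexes at height 1 differ by a multiple \<open>t\<close> of \<open>q - p\<close>.
  For \<open>t > 0\<close> the sides \<open>p r'\<close> and \<open>q r\<close> cross, at parameter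
  \<open>1 / (1 + t)\<close> on both.\<close>

lemma apex_unique_aux:
  assumes tri: "triangulation n k \<sigma>" and r: "{q,r} \<in> \<sigma>" "wedge (q-p) (r-p) = 1"
    and r': "{p,r'} \<in> \<sigma>" "wedge (q-p) (r'-p) = 1" and t: "wedge (r'-p) (r-p) > 0"
  shows False
proof -
  define t where "t = real_of_int (wedge (r'-p) (r-p))"
  have t0: "t > 0" unfolding t_def using t by simp
  define \<alpha> where "\<alpha> = 1 / (1 + t)"
  have \<alpha>: "0 < \<alpha>" "\<alpha> < 1" "\<alpha> * t = 1 - \<alpha>" unfolding \<alpha>_def using t0 by (auto simp: field_simps)
  have ex: "fst r' - fst p = wedge (r'-p) (r-p) * (fst q - fst p) + (fst r - fst p)"
     "snd r' - snd p = wedge (r'-p) (r-p) * (snd q - snd p) + (snd r - snd p)"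
    using wedge_expand[OF r(2), of "r'-p"] r'(2) by simp_all
  have m: "meet p r' q r"
  proof (rule meetI[OF \<alpha>(1,2) \<alpha>(1,2)])
    show "real_of_int (fst p) + \<alpha> * real_of_int (fst r' - fst p) = real_of_int (fst q) + \<alpha> * real_of_int (fst r - fst q)"
    proof -
      have "\<alpha> * real_of_int (fst r' - fst p) = (\<alpha> * t) * real_of_int (fst q - fst p) + \<alpha> * real_of_int (fst r - fst p)"
        unfolding ex t_def by (simp add: algebra_simps)
      then show ?thesis unfolding \<alpha>(3) by (simp add: algebra_simps)
    qed
    show "real_of_int (snd p) + \<alpha> * real_of_int (snd r' - snd p) = real_of_int (snd q) + \<alpha> * real_of_int (snd r - snd q)"
    proof -
      have "\<alpha> * real_of_int (snd r' - snd p) = (\<alpha> * t) * real_of_int (snd q - snd p) + \<alpha> * real_of_int (snd r - snd p)"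
        unfolding ex t_def by (simp add: algebra_simps)
      then show ?thesis unfolding \<alpha>(3) by (simp add: algebra_simps)
    qed
  qed
  have "r' \<noteq> q" "r \<noteq> p" using r'(2) r(2) by (auto simp: wedge_def)
  moreover have "p \<noteq> q" using r(2) by (auto simp: wedge_def)
  ultimately have "{p,r'} \<noteq> {q,r}" by (auto simp: doubleton_eq_iff)
  then show False using tri_not_meet[OF tri r'(1) r(1)] m by blast
qed

lemma apex_unique:
  assumes tri: "triangulation n k \<sigma>" and r: "{p,r} \<in> \<sigma>" "{q,r} \<in> \<sigma>" "wedge (q-p) (r-p) = 1"
    and r': "{p,r'} \<in> \<sigma>" "{q,r'} \<in> \<sigma>" "wedge (q-p) (r'-p) = 1"
  shows "r = r'"
proof -
  have "\<not> wedge (r'-p) (r-p) > 0" "\<not> wedge (r-p) (r'-p) > 0"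
    using apex_unique_aux[OF tri] assms by blast+
  then have "wedge (r'-p) (r-p) = 0" using wedge_antisym[of "r'-p" "r-p"] by linarith
  then show ?thesis using wedge_coords_inj[OF r(3), of r p r'] r r'(3) by (simp add: wedge_def)
qed

section \<open>Flips\<close>

lemma meet_vertical_unit:
  assumes "snd g \<le> 0" "snd h \<ge> 1" "0 < y" "y < 1" "xat g h y = real_of_int a"
  shows "meet g h (a,0) (a,1)"
proof (rule meet_xatI[where y = y])
  show "xat g h y = xat (a,0) (a,1) y" using assms by (simp add: xat_def)
qed (use assms in auto)

lemma xat_slope: "xat g h 1 - xat g h 0 = real_of_int (fst h - fst g) / real_of_int (snd h - snd g)"
  unfolding xat_def diff_divide_distrib[symmetric] add_diff_cancel_left by (simp add: algebra_simps flip: diff_divide_distrib)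

text \<open>The cases compare the abscissas \<open>a\<close> and \<open>b\<close> at heights 0 and 1
  with the square. The segment crosses a side unless it passes through two opposite corners; then
  its slope is 1 or -1, and primitivity makes it a diagonal.\<close>

lemma square_cross_aux:
  assumes m: "meet (0,0) (1,1) g h" and cop: "coprime (fst h - fst g) (snd h - snd g)"
    and Y: "snd g \<le> 0" "snd h \<ge> 1"
  shows "meet (0,0) (1,0) g h \<or> meet (0,0) (0,1) g h \<or> meet (1,0) (1,1) g h \<or> meet (0,1) (1,1) g h
    \<or> {g,h} = {(0,0),(1,1)} \<or> {g,h} = {(1,0),(0,1)}"
proof -
  obtain t where t: "0 < t" "t < 1" "(1-t) * xat g h 0 + t * xat g h 1 = (1-t) * real_of_int 0 + t * real_of_int 1"
    using meet_xatD[OF m Y] by blast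
  define a where "a = xat g h 0"
  define b where "b = xat g h 1"
  have ab: "(1-t) * a = t * (1 - b)" using t(3) unfolding a_def b_def by (simp add: algebra_simps)
  have D: "snd g < snd h" using Y by simp
  have slope: "real_of_int (fst h - fst g) = (b - a) * real_of_int (snd h - snd g)"
    unfolding a_def b_def xat_slope using D by simp
  have bot: "meet (0,0) (1,0) g h" if "0 < a" "a < 1"
    using meet_horizontal[of g 0 h 0] that Y D meet_commute unfolding a_def by auto
  have top: "meet (0,1) (1,1) g h" if "0 < b" "b < 1"
    using meet_horizontal[of g 1 h 0] that Y D meet_commute unfolding b_def by auto
  have vert: "meet (c,0) (c,1) g h" if "0 < y" "y < 1" "(1-y) * a + y * b = real_of_int c" for c y
  proof -
    have "xat g h y = (1-y) * a + y * b" unfolding a_def b_def by (rule xat_convex) simp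
    then show ?thesis using meet_vertical_unit[OF Y that(1,2)] that(3) meet_commute by metis
  qed
  have ends: "snd g = 0 \<and> snd h = 1" if "\<bar>fst h - fst g\<bar> = snd h - snd g"
  proof -
    have "snd h - snd g dvd fst h - fst g" using that by (metis dvd_abs_iff dvd_refl)
    then have "is_unit (snd h - snd g)" by (rule coprime_common_divisor[OF cop]) simp
    then have "snd h - snd g = 1" using Y by auto
    then show ?thesis using Y by linarith
  qed
  consider "0 < a" "a < 1" | "a = 0" | "a < 0" | "a = 1" | "a > 1" by linarith
  then show ?thesis
  proof cases
    case 1 then show ?thesis using bot by blast
  next
    case 2
    then have b: "b = 1" using ab t by auto
    then have "real_of_int (fst h - fst g) = real_of_int (snd h - snd g)" using slope 2 by simp
    then have "fst h - fst g = snd h - snd g" unfolding of_int_eq_iff .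
    then have e: "snd g = 0" "snd h = 1" using ends D by auto
    then have "fst g = 0" "fst h = 1" using xat_lower[of g h] xat_upper[OF D] 2 b unfolding a_def b_def by auto
    then have "g = (0,0)" "h = (1,1)" using e by (auto simp: prod_eq_iff)
    then show ?thesis by blast
  next
    case 3
    have "(1-t) * a < 0" using 3 t by (simp add: mult_less_0_iff)
    then have "1 - b < 0" using ab t by (simp add: mult_less_0_iff)
    then have b: "b > 1" by simp
    define y where "y = - a / (b - a)"
    have y: "0 < y" "y < 1" "(1-y) * a + y * b = real_of_int 0"
      using 3 b unfolding y_def by (auto simp: field_simps)
    then show ?thesis using vert by blast
  next
    case 4
    then have tb: "t * b = 2 * t - 1" using ab by (simp add: algebra_simps)
    show ?thesis
    proof (cases "b = 0")
      case True
      then have "real_of_int (fst h - fst g) = real_of_int (- (snd h - snd g))" using slope 4 by simp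
      then have "fst h - fst g = - (snd h - snd g)" unfolding of_int_eq_iff .
      then have e: "snd g = 0" "snd h = 1" using ends D by auto
      then have "fst g = 1" "fst h = 0" using xat_lower[of g h] xat_upper[OF D] 4 True unfolding a_def b_def by auto
      then have "g = (1,0)" "h = (0,1)" using e by (auto simp: prod_eq_iff)
      then show ?thesis by blast
    next
      case False
      have "b < 1"
      proof (rule ccontr)
        assume "\<not> b < 1" then have "t * 1 \<le> t * b" using t by (intro mult_left_mono) auto
        then show False using tb t by simp
      qed
      then consider "0 < b" "b < 1" | "b < 0" using False by linarith
      then show ?thesis
      proof cases
        case 1 then show ?thesis using top by blast
      next
        case 2
        define y where "y = a / (a - b)"
        have y: "0 < y" "y < 1" "(1-y) * a + y * b = real_of_int 0"
          using 2 4 unfolding y_def by (auto simp: field_simps)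
        then show ?thesis using vert by blast
      qed
    qed
  next
    case 5
    have "b < 1"
    proof (rule ccontr)
      assume "\<not> b < 1" then have "t * (1-b) \<le> 0" using t by (simp add: mult_nonneg_nonpos)
      moreover have "(1-t) * a > 0" using t 5 by simp
      ultimately show False using ab by simp
    qed
    define y where "y = (a - 1) / (a - b)"
    have "y * (a - b) = a - 1" using 5 \<open>b < 1\<close> unfolding y_def by simp
    then have "(1-y) * a + y * b = real_of_int 1" by (simp add: algebra_simps)
    moreover have "0 < y" "y < 1" using 5 \<open>b < 1\<close> unfolding y_def by (auto simp: field_simps)
    ultimately show ?thesis using vert by blast
  qed
qed

lemma square_cross:
  assumes m: "meet (0,0) (1,1) g h" and cop: "coprime (fst h - fst g) (snd h - snd g)"
  shows "meet (0,0) (1,0) g h \<or> meet (0,0) (0,1) g h \<or> meet (1,0) (1,1) g h \<or> meet (0,1) (1,1) g h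
    \<or> {g,h} = {(0,0),(1,1)} \<or> {g,h} = {(1,0),(0,1)}"
  using meet_height_in_unit[OF m]
proof
  assume "snd g \<le> 0 \<and> 1 \<le> snd h"
  then show ?thesis using square_cross_aux[OF m cop] by blast
next
  assume Y: "snd h \<le> 0 \<and> 1 \<le> snd g"
  have "meet (0,0) (1,1) h g" using m meet_swap2 by blast
  moreover have "coprime (fst g - fst h) (snd g - snd h)" using cop
    by (metis coprime_minus_left_iff coprime_minus_right_iff minus_diff_eq)
  ultimately show ?thesis using square_cross_aux[of h g] Y meet_swap2[of _ _ g h] by (simp add: insert_commute)
qed

lemma square_cross_anti:
  assumes m: "meet (1,0) (0,1) g h" and cop: "coprime (fst h - fst g) (snd h - snd g)"
  shows "meet (0,0) (1,0) g h \<or> meet (0,0) (0,1) g h \<or> meet (1,0) (1,1) g h \<or> meet (0,1) (1,1) g h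
    \<or> {g,h} = {(0,0),(1,1)} \<or> {g,h} = {(1,0),(0,1)}"
proof -
  define \<rho> :: "int \<times> int \<Rightarrow> int \<times> int" where "\<rho> z = (1 - fst z, snd z)" for z
  have M: "meet p q r s \<longleftrightarrow> meet (\<rho> p) (\<rho> q) (\<rho> r) (\<rho> s)" for p q r s
    unfolding \<rho>_def by (rule meet_affine[where a = "-1" and b = 0 and e = 1 and c = 0 and d = 1 and f = 0]) auto
  have \<rho>2: "\<rho> (\<rho> z) = z" for z by (simp add: \<rho>_def)
  have v: "\<rho> (0,0) = (1,0)" "\<rho> (1,0) = (0,0)" "\<rho> (0,1) = (1,1)" "\<rho> (1,1) = (0,1)" by (auto simp: \<rho>_def)
  have "meet (0,0) (1,1) (\<rho> g) (\<rho> h)" using m unfolding M[of "(1,0)"] v .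
  moreover have "coprime (fst (\<rho> h) - fst (\<rho> g)) (snd (\<rho> h) - snd (\<rho> g))"
  proof -
    have "fst (\<rho> h) - fst (\<rho> g) = - (fst h - fst g)" "snd (\<rho> h) - snd (\<rho> g) = snd h - snd g" by (auto simp: \<rho>_def)
    then show ?thesis using cop by (simp only: coprime_minus_left_iff)
  qed
  ultimately have "meet (0,0) (1,0) (\<rho> g) (\<rho> h) \<or> meet (0,0) (0,1) (\<rho> g) (\<rho> h) \<or> meet (1,0) (1,1) (\<rho> g) (\<rho> h)
     \<or> meet (0,1) (1,1) (\<rho> g) (\<rho> h) \<or> {\<rho> g,\<rho> h} = {(0,0),(1,1)} \<or> {\<rho> g,\<rho> h} = {(1,0),(0,1)}"
    by (rule square_cross)
  moreover have "meet (0,0) (1,0) (\<rho> g) (\<rho> h) \<longleftrightarrow> meet (0,0) (1,0) g h"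
    using M[of "(1,0)" "(0,0)" g h] meet_swap[of "(1,0)" "(0,0)" g h] unfolding v by blast
  moreover have "meet (0,0) (0,1) (\<rho> g) (\<rho> h) \<longleftrightarrow> meet (1,0) (1,1) g h"
    using M[of "(1,0)" "(1,1)" g h] unfolding v by blast
  moreover have "meet (1,0) (1,1) (\<rho> g) (\<rho> h) \<longleftrightarrow> meet (0,0) (0,1) g h"
    using M[of "(0,0)" "(0,1)" g h] unfolding v by blast
  moreover have "meet (0,1) (1,1) (\<rho> g) (\<rho> h) \<longleftrightarrow> meet (0,1) (1,1) g h"
    using M[of "(1,1)" "(0,1)" g h] meet_swap[of "(1,1)" "(0,1)" g h] unfolding v by blast
  moreover have "{\<rho> g,\<rho> h} = {(0,0),(1,1)} \<Longrightarrow> {g,h} = {(1,0),(0,1)}"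
  proof -
    assume "{\<rho> g,\<rho> h} = {(0,0),(1,1)}"
    then have "\<rho> ` {\<rho> g,\<rho> h} = \<rho> ` {(0,0),(1,1)}" by simp
    then show ?thesis by (simp add: \<rho>2 v)
  qed
  moreover have "{\<rho> g,\<rho> h} = {(1,0),(0,1)} \<Longrightarrow> {g,h} = {(0,0),(1,1)}"
  proof -
    assume "{\<rho> g,\<rho> h} = {(1,0),(0,1)}"
    then have "\<rho> ` {\<rho> g,\<rho> h} = \<rho> ` {(1,0),(0,1)}" by simp
    then show ?thesis by (simp add: \<rho>2 v)
  qed
  ultimately show ?thesis by blast
qed

lemma coprime_wedge_coords:
  assumes "wedge d c = 1" "coprime (fst w) (snd w)"
  shows "coprime (wedge w c) (wedge d w)"
proof (rule coprimeI)
  fix x assume x: "x dvd wedge w c" "x dvd wedge d w"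
  have "x dvd wedge w c * fst d + wedge d w * fst c" "x dvd wedge w c * snd d + wedge d w * snd c"
    using x by (simp_all add: dvd_add)
  then have "x dvd fst w" "x dvd snd w" using wedge_expand[OF assms(1), of w] by metis+
  then show "is_unit x" by (rule coprime_common_divisor[OF assms(2)])
qed

text \<open>In the basis \<open>r - p\<close>, \<open>s - p\<close> the parallelogram is the unit
  square. Once its four sides belong to a configuration, only the diagonals themselves can cross a
  diagonal.\<close>

lemma parallelogram_cross:
  assumes D: "wedge (r - p) (s - p) = 1" and q: "q = r + s - p"
    and cop: "coprime (fst h - fst g) (snd h - snd g)"
    and m: "meet p q g h \<or> meet r s g h"
  shows "meet p r g h \<or> meet p s g h \<or> meet r q g h \<or> meet s q g h \<or> {g,h} = {p,q} \<or> {g,h} = {r,s}"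
proof -
  define \<phi> where "\<phi> z = (wedge (z-p) (s-p), wedge (r-p) (z-p))" for z
  have M: "meet a b c d \<longleftrightarrow> meet (\<phi> a) (\<phi> b) (\<phi> c) (\<phi> d)" for a b c d
    unfolding \<phi>_def by (rule meet_wedge_coords[OF D])
  have inj: "\<phi> a = \<phi> b \<longleftrightarrow> a = b" for a b unfolding \<phi>_def using wedge_coords_inj[OF D, of a p b] by auto
  have v: "\<phi> p = (0,0)" "\<phi> r = (1,0)" "\<phi> s = (0,1)" "\<phi> q = (1,1)"
    using D unfolding \<phi>_def q by (auto simp: wedge_def algebra_simps)
  have w: "\<phi> h = (fst (\<phi> g) + wedge (h - g) (s-p), snd (\<phi> g) + wedge (r-p) (h-g))"
    unfolding \<phi>_def by (simp add: wedge_linear)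
  have "coprime (fst (\<phi> h) - fst (\<phi> g)) (snd (\<phi> h) - snd (\<phi> g))"
    using coprime_wedge_coords[OF D, of "h - g"] cop unfolding w by simp
  then have "meet (0,0) (1,0) (\<phi> g) (\<phi> h) \<or> meet (0,0) (0,1) (\<phi> g) (\<phi> h) \<or> meet (1,0) (1,1) (\<phi> g) (\<phi> h) \<or> meet (0,1) (1,1) (\<phi> g) (\<phi> h)
    \<or> {\<phi> g,\<phi> h} = {(0,0),(1,1)} \<or> {\<phi> g,\<phi> h} = {(1,0),(0,1)}"
    using m square_cross[of "\<phi> g" "\<phi> h"] square_cross_anti[of "\<phi> g" "\<phi> h"] M[of p q g h] M[of r s g h] unfolding v by blast
  then show ?thesis unfolding M[of p r] M[of p s] M[of r q] M[of s q] v
    using inj v by (simp add: doubleton_eq_iff) metis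
qed

lemma meet_common_endpoint:
  assumes "wedge (b - a) (c - a) \<noteq> 0"
  shows "\<not> meet a b a c"
proof
  assume "meet a b a c"
  then show False
  proof (rule meetE)
    fix \<alpha> \<beta> :: real
    assume *: "0 < \<alpha>"
     "real_of_int (fst a) + \<alpha> * real_of_int (fst b - fst a) = real_of_int (fst a) + \<beta> * real_of_int (fst c - fst a)"
     "real_of_int (snd a) + \<alpha> * real_of_int (snd b - snd a) = real_of_int (snd a) + \<beta> * real_of_int (snd c - snd a)"
    have "\<alpha> * real_of_int (wedge (b-a) (c-a)) = (\<alpha> * real_of_int (fst b - fst a)) * real_of_int (snd c - snd a)
         - (\<alpha> * real_of_int (snd b - snd a)) * real_of_int (fst c - fst a)"
      unfolding wedge_def by (simp add: algebra_simps)
    also have "\<dots> = (\<beta> * real_of_int (fst c - fst a)) * real_of_int (snd c - snd a)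
         - (\<beta> * real_of_int (snd c - snd a)) * real_of_int (fst c - fst a)" using * by simp
    also have "\<dots> = 0" by (simp add: algebra_simps)
    finally show False using * assms by simp
  qed
qed

lemma meet_doubleton:
  assumes "{p,q} = {p',q'}" "{r,s} = {r',s'}"
  shows "meet p q r s \<longleftrightarrow> meet p' q' r' s'"
  using assms meet_swap[of p q r s] meet_swap2[of p q r s] meet_swap[of q p r s] meet_swap2[of q p r s]
  by (auto simp: doubleton_eq_iff)

lemma diagonals_meet: "s = p + q - r \<Longrightarrow> meet p q r s"
  by (simp only:, rule meetI[of "1/2" "1/2"]) (simp_all add: field_simps)

text \<open>The triangles at \<open>p q\<close> form a parallelogram of area 1. An old edge crossing
  the new diagonal would have to cross a side or be the old diagonal, which gives disjointness;
  maximality rests on the same alternative.\<close>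

lemma flip_triangulation_aux:
  assumes tri: "triangulation n k \<sigma>" and pq: "{p,q} \<in> \<sigma>"
    and sides: "{p,r} \<in> \<sigma>" "{r,q} \<in> \<sigma>" "{p,s} \<in> \<sigma>" "{s,q} \<in> \<sigma>"
    and s: "s = p + q - r" and D: "wedge (r - p) (s - p) = 1"
  shows "triangulation n k (insert {r,s} (\<sigma> - {{p,q}})) \<and> {r,s} \<notin> \<sigma>"
proof -
  have q: "q = r + s - p" unfolding s by simp
  have rs: "r \<noteq> s" using D by (auto simp: wedge_def)
  have rp: "r \<noteq> p" "r \<noteq> q" "s \<noteq> p" "s \<noteq> q" using tri_edge[OF tri] sides by metis+
  have nots: "{p,q} \<noteq> {r,s}" "{p,r} \<noteq> {p,q}" "{r,q} \<noteq> {p,q}" "{p,s} \<noteq> {p,q}" "{s,q} \<noteq> {p,q}"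
    using rp rs tri_edge(1)[OF tri pq] by (auto simp: doubleton_eq_iff)
  have rsn: "{r,s} \<notin> \<sigma>" using tri_not_meet[OF tri pq _ nots(1)] diagonals_meet[OF s] by blast
  define \<sigma>' where "\<sigma>' = insert {r,s} (\<sigma> - {{p,q}})"
  have sides': "{p,r} \<in> \<sigma>'" "{r,q} \<in> \<sigma>'" "{p,s} \<in> \<sigma>'" "{s,q} \<in> \<sigma>'" using sides nots unfolding \<sigma>'_def by auto
  have val: "valid_edge n k {r,s}"
  proof -
    have "wedge (s - r) (r - p) = -1" using D unfolding wedge_def by (simp add: algebra_simps)
    then have "coprime (fst (s - r)) (snd (s - r))" using coprime_of_wedge[of "s-r" "r-p"] by simp
    then show ?thesis using tri_edge[OF tri sides(1)] tri_edge[OF tri sides(3)] rs unfolding valid_edge_iff by simp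
  qed
  have side_rs: "\<not> meet r s r p" "\<not> meet r s r q" "\<not> meet s r s p" "\<not> meet s r s q"
    by (rule meet_common_endpoint; use D in \<open>simp add: q wedge_def algebra_simps\<close>)+
  have old: "\<not> meet r s g h" if gh: "{g,h} \<in> \<sigma>" "{g,h} \<noteq> {p,q}" for g h
  proof (cases "{g,h} = {p,r} \<or> {g,h} = {r,q} \<or> {g,h} = {p,s} \<or> {g,h} = {s,q}")
    case True
    have t: "\<not> meet r s p r" "\<not> meet r s r q" "\<not> meet r s p s" "\<not> meet r s s q"
      using side_rs meet_swap2[of r s p r] meet_swap[of r s s p] meet_swap[of r s s q] meet_swap2[of r s p s] by simp_all
    have e: "meet r s g h \<longleftrightarrow> meet r s a b" if "{g,h} = {a,b}" for a b
      by (rule meet_doubleton) (use that in auto)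
    from True show ?thesis
      using t e[of p r] e[of r q] e[of p s] e[of s q] by (elim disjE) simp_all
  next
    case False
    show ?thesis
    proof
      assume "meet r s g h"
      then have "meet p r g h \<or> meet p s g h \<or> meet r q g h \<or> meet s q g h \<or> {g,h} = {p,q} \<or> {g,h} = {r,s}"
        using parallelogram_cross[OF D q tri_edge(4)[OF tri gh(1)]] by blast
      moreover have "\<not> meet a b g h" if "{a,b} \<in> \<sigma>" "{a,b} \<noteq> {g,h}" for a b
        using tri_not_meet[OF tri that(1) gh(1) that(2)] .
      ultimately show False using False gh sides rsn by metis
    qed
  qed
  have disj: "oseg e \<inter> oseg {r,s} = {}" if e: "e \<in> \<sigma>" "e \<noteq> {p,q}" for e
  proof -
    obtain g h where "e = {g,h}" "g \<noteq> h" by (rule valid_edgeE[OF tri_valid[OF tri e(1)]])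
    then show ?thesis using old e oseg_meet[OF rs, of g h] by blast
  qed
  have disj': "oseg {r,s} \<inter> oseg e = {}" if e: "e \<in> \<sigma>" "e \<noteq> {p,q}" for e
    using disj[OF e] by blast
  have conf: "edge_config n k \<sigma>" using tri unfolding triangulation_def by simp
  have "edge_config n k \<sigma>'"
    unfolding edge_config_def
  proof (intro conjI ballI impI)
    fix e assume "e \<in> \<sigma>'"
    then show "valid_edge n k e" using val tri_valid[OF tri] unfolding \<sigma>'_def by auto
  next
    fix e e' assume a: "e \<in> \<sigma>'" "e' \<in> \<sigma>'" "e \<noteq> e'"
    have "oseg e \<inter> oseg e' = {}" if "e \<in> \<sigma>" "e' \<in> \<sigma>"
      using conf a(3) that unfolding edge_config_def by simp
    then show "oseg e \<inter> oseg e' = {}" using a disj disj' unfolding \<sigma>'_def by (metis Diff_iff insert_iff)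
  qed
  moreover have "E = \<sigma>'" if E: "edge_config n k E" "\<sigma>' \<subseteq> E" for E
  proof (rule ccontr)
    assume "E \<noteq> \<sigma>'"
    then obtain e where e: "e \<in> E" "e \<notin> \<sigma>'" using E(2) by blast
    have ve: "valid_edge n k e" using E(1) e(1) unfolding edge_config_def by simp
    obtain g h where gh: "e = {g,h}" "g \<noteq> h" by (rule valid_edgeE[OF ve])
    have nm: "\<not> meet a b g h" if ab: "{a,b} \<in> \<sigma>'" for a b
    proof -
      have "{a,b} \<in> E" using ab E(2) by blast
      moreover have "{a,b} \<noteq> e" using ab e(2) by auto
      ultimately have "oseg {a,b} \<inter> oseg e = {}" using E(1) e(1) unfolding edge_config_def by simp
      moreover have "a \<noteq> b"
      proof -
        have "valid_edge n k {a,b}" using E(1) \<open>{a,b} \<in> E\<close> unfolding edge_config_def by simp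
        then show ?thesis unfolding valid_edge_iff by simp
      qed
      ultimately show ?thesis using oseg_meet[of a b g h] gh by simp
    qed
    have "e \<noteq> {p,q}"
    proof
      assume "e = {p,q}"
      then have "meet r s g h" using meet_doubleton[of r s r s g h p q] gh diagonals_meet[OF s] meet_commute[of p q r s] by simp
      then show False using nm[of r s] unfolding \<sigma>'_def by simp
    qed
    then have "e \<notin> \<sigma>" using e(2) unfolding \<sigma>'_def by simp
    \<comment> \<open>An edge outside \<sigma> meets some edge of \<sigma>; compatibility with the
      new configuration leaves only the removed diagonal.\<close>
    then obtain a b where ab: "{a,b} \<in> \<sigma>" "meet g h a b" using tri_memI[OF tri, of g h] ve unfolding gh(1) by metis
    then have "{a,b} \<notin> \<sigma>'" using nm[of a b] meet_commute[of g h a b] by metis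
    then have "{a,b} = {p,q}" using ab(1) unfolding \<sigma>'_def by simp
    then have "meet p q g h" using ab(2) meet_commute[of g h a b] meet_doubleton[of a b p q g h g h] by simp
    moreover have "coprime (fst h - fst g) (snd h - snd g)" using ve unfolding gh valid_edge_iff by simp
    ultimately have "meet p r g h \<or> meet p s g h \<or> meet r q g h \<or> meet s q g h \<or> {g,h} = {p,q} \<or> {g,h} = {r,s}"
      using parallelogram_cross[OF D q] by blast
    moreover have "{r,s} \<in> \<sigma>'" unfolding \<sigma>'_def by simp
    ultimately show False using nm[OF sides'(1)] nm[OF sides'(2)] nm[OF sides'(3)] nm[OF sides'(4)]
        \<open>e \<noteq> {p,q}\<close> e(2) gh(1) by metis
  qed
  ultimately show ?thesis using rsn unfolding triangulation_def \<sigma>'_def by blast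
qed

theorem flip_triangulation:
  assumes tri: "triangulation n k \<sigma>" and pq: "{p,q} \<in> \<sigma>"
    and sides: "{p,r} \<in> \<sigma>" "{r,q} \<in> \<sigma>" "{p,s} \<in> \<sigma>" "{s,q} \<in> \<sigma>"
    and s: "s = p + q - r" and D: "\<bar>wedge (q - p) (r - p)\<bar> = 1"
  shows "triangulation n k (insert {r,s} (\<sigma> - {{p,q}}))" "{r,s} \<notin> \<sigma>"
proof -
  have e: "wedge (r - p) (s - p) = - wedge (q - p) (r - p)" unfolding s by (simp add: wedge_def algebra_simps)
  have "triangulation n k (insert {r,s} (\<sigma> - {{p,q}})) \<and> {r,s} \<notin> \<sigma>"
  proof (cases "wedge (q - p) (r - p) = -1")
    case True then show ?thesis using flip_triangulation_aux[OF tri pq sides s] e by simp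
  next
    case False
    then have "wedge (s - p) (r - p) = 1" using D e wedge_antisym[of "s-p" "r-p"] by linarith
    moreover have "r = p + q - s" unfolding s by simp
    ultimately show ?thesis using flip_triangulation_aux[OF tri pq sides(3,4,1,2)] by (simp add: insert_commute)
  qed
  then show "triangulation n k (insert {r,s} (\<sigma> - {{p,q}}))" "{r,s} \<notin> \<sigma>" by auto
qed

section \<open>Removing the crossings of a column\<close>

definition ext :: "(int \<times> int) set \<Rightarrow> int" where
  "ext e = Max (fst ` e) - Min (fst ` e)"

definition ht :: "(int \<times> int) set \<Rightarrow> int" where
  "ht e = Max (snd ` e) - Min (snd ` e)"

text \<open>The inequalities are strict because an edge that merely ends on the column does not
  obstruct its unit verticals.\<close>

definition crosses :: "int \<Rightarrow> (int \<times> int) set \<Rightarrow> bool" where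
  "crosses b e \<longleftrightarrow> Min (fst ` e) < b \<and> b < Max (fst ` e)"

text \<open>Twice the midpoint, so that it stays integral; a flip exchanges the diagonals of a
  parallelogram and therefore preserves it.\<close>

definition mid :: "(int \<times> int) set \<Rightarrow> int \<times> int" where
  "mid e = (sum fst e, sum snd e)"

lemma ext_pair [simp]: "ext {p,q} = \<bar>fst p - fst q\<bar>"
  unfolding ext_def by (cases "fst p \<le> fst q") auto

lemma ht_pair [simp]: "ht {p,q} = \<bar>snd p - snd q\<bar>"
  unfolding ht_def by (cases "snd p \<le> snd q") auto

lemma crosses_pair [simp]:
  "crosses b {p,q} \<longleftrightarrow> (fst p < b \<and> b < fst q) \<or> (fst q < b \<and> b < fst p)"
  unfolding crosses_def by auto

lemma mid_pair: "p \<noteq> q \<Longrightarrow> mid {p,q} = p + q"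
  unfolding mid_def by (simp add: prod_eq_iff)

lemma elen_pair: "p \<noteq> q \<Longrightarrow> elen {p,q} = real_of_int (ext {p,q} + ht {p,q})"
  unfolding elen_def l1dist_def by simp

lemma crosses_obtain:
  assumes "valid_edge n k e" "crosses b e"
  obtains p q where "e = {p,q}" "fst p < b" "b < fst q"
proof -
  obtain p q where e: "e = {p,q}" "p \<noteq> q" by (rule valid_edgeE[OF assms(1)])
  then have "e = {q,p}" by (simp add: insert_commute)
  moreover have "(fst p < b \<and> b < fst q) \<or> (fst q < b \<and> b < fst p)" using assms(2) unfolding e(1) by auto
  ultimately show thesis using that[of p q] that[of q p] e(1) by blast
qed

text \<open>If one vector were vertical, the determinant would force width 1 on the other, against
  total width 2. If the vertical parts had opposite signs, the two terms of the determinant would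
  add up to at least the total width. Hence heights add along the widest side of a triangle.\<close>

lemma unimodular_wide:
  assumes "\<bar>wedge u v\<bar> = 1" "fst u \<ge> 0" "fst v \<ge> 0" "fst u + fst v \<ge> 2"
  shows "fst u \<ge> 1" "fst v \<ge> 1" "snd u * snd v \<ge> 0"
proof -
  have D: "\<bar>fst u * snd v - snd u * fst v\<bar> = 1" using assms(1) unfolding wedge_def .
  show u: "fst u \<ge> 1"
  proof (rule ccontr)
    assume "\<not> fst u \<ge> 1"
    then have "fst u = 0" using assms by simp
    then have "\<bar>snd u\<bar> * \<bar>fst v\<bar> = 1" using D by (simp add: abs_mult)
    then have "\<bar>fst v\<bar> = 1" using zmult_eq_1_iff[of "\<bar>snd u\<bar>" "\<bar>fst v\<bar>"] by auto
    then show False using \<open>fst u = 0\<close> assms by simp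
  qed
  show v: "fst v \<ge> 1"
  proof (rule ccontr)
    assume "\<not> fst v \<ge> 1"
    then have "fst v = 0" using assms by simp
    then have "\<bar>fst u\<bar> * \<bar>snd v\<bar> = 1" using D by (simp add: abs_mult)
    then have "\<bar>fst u\<bar> = 1" using zmult_eq_1_iff[of "\<bar>fst u\<bar>" "\<bar>snd v\<bar>"] by auto
    then show False using \<open>fst v = 0\<close> assms by simp
  qed
  show "snd u * snd v \<ge> 0"
  proof (rule ccontr)
    assume "\<not> snd u * snd v \<ge> 0"
    then consider "snd u \<ge> 1" "snd v \<le> -1" | "snd u \<le> -1" "snd v \<ge> 1"
      by (auto simp: zero_le_mult_iff not_le)
    then show False
    proof cases
      case 1
      have "fst u * snd v \<le> fst u * (-1)" by (rule mult_left_mono) (use 1 u in auto)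
      moreover have "snd u * fst v \<ge> 1 * fst v" by (rule mult_right_mono) (use 1 v in auto)
      ultimately show False using D u v by linarith
    next
      case 2
      have "fst u * snd v \<ge> fst u * 1" by (rule mult_left_mono) (use 2 u in auto)
      moreover have "snd u * fst v \<le> (-1) * fst v" by (rule mult_right_mono) (use 2 v in auto)
      ultimately show False using D u v by linarith
    qed
  qed
qed

lemma abs_add_same_sign: "x * y \<ge> 0 \<Longrightarrow> \<bar>x + y\<bar> = \<bar>x\<bar> + \<bar>y\<bar>" for x y :: int
  by (auto simp: zero_le_mult_iff)

text \<open>An edge crossing a column has extent at least 2, so being primitive it is not
  horizontal. The top and bottom points of the column then lie strictly on its two sides, and each
  side carries a triangle.\<close>

lemma apexes:
  assumes tri: "triangulation n k \<sigma>" and pq: "{p,q} \<in> \<sigma>" and b: "fst p < b" "b < fst q"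
  obtains r s where "wedge (q - p) (r - p) = 1" "{p,r} \<in> \<sigma>" "{q,r} \<in> \<sigma>"
    "wedge (q - p) (s - p) = -1" "{p,s} \<in> \<sigma>" "{q,s} \<in> \<sigma>"
proof -
  note e = tri_edge[OF tri pq]
  have L: "(b, 0) \<in> Lam0 n k" "(b, int k) \<in> Lam0 n k" using e(2,3) b unfolding Lam0_iff by auto
  have sp: "0 \<le> snd p" "snd p \<le> int k" "0 \<le> snd q" "snd q \<le> int k" using e(2,3) unfolding Lam0_iff by auto
  have nh: "snd p \<noteq> snd q"
  proof
    assume "snd p = snd q"
    then have "is_unit (fst q - fst p)" using e(4) by simp
    then show False using b by auto
  qed
  have wedge_b: "wedge (q - p) ((b,y) - p) = (y - snd p) * (fst q - b) + (y - snd q) * (b - fst p)" for y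
    unfolding wedge_def by (simp add: algebra_simps)
  have "wedge (q - p) ((b,int k) - p) > 0"
  proof -
    have "(int k - snd p) * (fst q - b) \<ge> 0" "(int k - snd q) * (b - fst p) \<ge> 0" using sp b by auto
    moreover have "(int k - snd p) * (fst q - b) > 0 \<or> (int k - snd q) * (b - fst p) > 0"
      using sp b nh by (cases "snd p < int k") auto
    ultimately show ?thesis unfolding wedge_b by linarith
  qed
  then obtain r where r: "wedge (q - p) (r - p) = 1" "{p,r} \<in> \<sigma>" "{q,r} \<in> \<sigma>"
    using apex_exists[OF tri pq L(2)] by blast
  have "wedge (p - q) ((b,0) - q) > 0"
  proof -
    have "snd p * (fst q - b) \<ge> 0" "snd q * (b - fst p) \<ge> 0" using sp b by auto
    moreover have "snd p * (fst q - b) > 0 \<or> snd q * (b - fst p) > 0"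
      using sp b nh by (cases "snd p > 0") auto
    moreover have "wedge (p - q) ((b,0) - q) = snd p * (fst q - b) + snd q * (b - fst p)"
      unfolding wedge_def by (simp add: algebra_simps)
    ultimately show ?thesis by linarith
  qed
  moreover have "{q,p} \<in> \<sigma>" using pq by (simp add: insert_commute)
  ultimately obtain s where s: "wedge (p - q) (s - q) = 1" "{q,s} \<in> \<sigma>" "{p,s} \<in> \<sigma>"
    using apex_exists[OF tri _ L(1)] by blast
  have "wedge (q - p) (s - p) = -1" using s(1) unfolding wedge_def by (simp add: algebra_simps)
  then show thesis using that r s by blast
qed

text \<open>The edge is the widest side of both adjacent triangles, and these form a parallelogram
  with fourth vertex \<open>p + q - r\<close>.\<close>

definition flippable :: "(int \<times> int) set set \<Rightarrow> int \<times> int \<Rightarrow> int \<times> int \<Rightarrow> int \<times> int \<Rightarrow> bool" where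
  "flippable \<sigma> p q r \<longleftrightarrow> {p,q} \<in> \<sigma> \<and> fst p < fst r \<and> fst r < fst q \<and> \<bar>wedge (q - p) (r - p)\<bar> = 1 \<and>
     {p,r} \<in> \<sigma> \<and> {q,r} \<in> \<sigma> \<and> {p, p + q - r} \<in> \<sigma> \<and> {q, p + q - r} \<in> \<sigma>"

text \<open>Unimodularity places both apexes strictly between the ends horizontally. As they lie at
  heights 1 and -1 over the edge, \<open>(r - p) + (s - p)\<close> is a multiple \<open>t\<close> of
  \<open>q - p\<close>; comparing abscissas gives \<open>0 < t < 2\<close>, so the two triangles
  form a parallelogram.\<close>

lemma longest_flippable:
  assumes tri: "triangulation n k \<sigma>" and pq: "{p,q} \<in> \<sigma>" and b: "fst p < b" "b < fst q"
    and longest: "\<And>r. {p,r} \<in> \<sigma> \<Longrightarrow> {q,r} \<in> \<sigma> \<Longrightarrow> \<bar>wedge (q - p) (r - p)\<bar> = 1 \<Longrightarrow> fst p \<le> fst r \<and> fst r \<le> fst q"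
  shows "\<exists>r. flippable \<sigma> p q r"
proof -
  obtain r s where r: "wedge (q - p) (r - p) = 1" "{p,r} \<in> \<sigma>" "{q,r} \<in> \<sigma>"
    and s: "wedge (q - p) (s - p) = -1" "{p,s} \<in> \<sigma>" "{q,s} \<in> \<sigma>"
    by (rule apexes[OF tri pq b])
  have strict: "fst p < fst z \<and> fst z < fst q" if z: "\<bar>wedge (q - p) (z - p)\<bar> = 1" "{p,z} \<in> \<sigma>" "{q,z} \<in> \<sigma>" for z
  proof -
    have "\<bar>wedge (z - p) (q - z)\<bar> = 1" using z(1) unfolding wedge_def by (simp add: algebra_simps abs_minus_commute)
    then have "fst (z-p) \<ge> 1" "fst (q-z) \<ge> 1"
      using unimodular_wide[of "z-p" "q-z"] longest[OF z(2,3,1)] b by auto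
    then show ?thesis by auto
  qed
  have rr: "fst p < fst r" "fst r < fst q" and ss: "fst p < fst s" "fst s < fst q" using strict[of r] strict[of s] r s by auto
  define t where "t = wedge (s - p) (r - p)"
  have ex: "fst s - fst p = t * (fst q - fst p) - (fst r - fst p)" "snd s - snd p = t * (snd q - snd p) - (snd r - snd p)"
    using wedge_expand[OF r(1), of "s - p"] s(1) unfolding t_def by (simp_all add: algebra_simps)
  have "t = 1"
  proof -
    define w where "w = fst q - fst p"
    have "t * w = (fst s - fst p) + (fst r - fst p)" using ex(1) unfolding w_def by linarith
    then have w: "w > 0" and tw: "0 < t * w" "t * w < 2 * w" using rr ss w_def by linarith+
    have "t > 0" using tw(1) w by (simp add: zero_less_mult_iff)
    moreover have "t < 2" using tw(2) w by (simp only: mult_less_cancel_right_pos)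
    ultimately show ?thesis by simp
  qed
  then have "s = p + q - r" using ex by (auto simp: prod_eq_iff)
  then show ?thesis unfolding flippable_def using pq r s rr by (intro exI[of _ r]) auto
qed

text \<open>With \<open>u = r - p\<close> and \<open>v = q - r\<close> the edge is
  \<open>u + v\<close> and its replacement \<open>v - u\<close>. Both widths are positive and the
  vertical parts do not have opposite signs, so neither coordinate grows in absolute value.\<close>

lemma flip_effect:
  assumes f: "flippable \<sigma> p q r" and s: "s = p + q - r"
  shows "ext {r,s} + 2 * min (fst r - fst p) (fst q - fst r) = ext {p,q}" "ht {r,s} \<le> ht {p,q}"
    "fst p < fst s" "fst s < fst q"
proof -
  define u where "u = r - p"
  define v where "v = q - r"
  have uv: "fst u \<ge> 1" "fst v \<ge> 1" "\<bar>wedge u v\<bar> = 1"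
    using f unfolding flippable_def u_def v_def wedge_def by (auto simp: algebra_simps abs_minus_commute)
  have "snd u * snd v \<ge> 0" using unimodular_wide(3)[OF uv(3)] uv by simp
  then have "\<bar>snd u + snd v\<bar> = \<bar>snd u\<bar> + \<bar>snd v\<bar>" by (rule abs_add_same_sign)
  then have "\<bar>snd u - snd v\<bar> \<le> \<bar>snd u + snd v\<bar>" by linarith
  then show "ht {r,s} \<le> ht {p,q}" unfolding u_def v_def s by (simp add: algebra_simps abs_minus_commute)
  show "ext {r,s} + 2 * min (fst r - fst p) (fst q - fst r) = ext {p,q}"
    using uv unfolding u_def v_def s by (auto simp: min_def)
  show "fst p < fst s" "fst s < fst q" using uv unfolding u_def v_def s by auto
qed

text \<open>With total height at least 2 neither part of the edge is horizontal. The unit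
  determinant makes the widths of the parts nearly proportional to their heights, which lie between
  1 and \<open>k\<close>; so each width is at most \<open>2 * k\<close> times the other.\<close>

lemma flip_gain_high:
  assumes f: "flippable \<sigma> p q r" and tri: "triangulation n k \<sigma>" and ht: "ht {p,q} \<ge> 2"
  shows "ext {p,q} \<le> (2 * int k + 1) * min (fst r - fst p) (fst q - fst r)"
proof -
  define u where "u = r - p"
  define v where "v = q - r"
  have uv: "fst u \<ge> 1" "fst v \<ge> 1" "\<bar>wedge u v\<bar> = 1"
    using f unfolding flippable_def u_def v_def wedge_def by (auto simp: algebra_simps abs_minus_commute)
  have sg: "snd u * snd v \<ge> 0" using unimodular_wide(3)[OF uv(3)] uv by simp
  have hs: "\<bar>snd u + snd v\<bar> \<ge> 2" using ht unfolding u_def v_def by (simp add: algebra_simps abs_minus_commute)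
  have D: "\<bar>fst u * snd v - snd u * fst v\<bar> = 1" using uv(3) unfolding wedge_def .
  have "{p,q} \<in> \<sigma>" "{p,r} \<in> \<sigma>" using f unfolding flippable_def by auto
  then have L: "p \<in> Lam0 n k" "q \<in> Lam0 n k" "r \<in> Lam0 n k" using tri_edge[OF tri] by blast+
  have k: "\<bar>snd u\<bar> \<le> int k" "\<bar>snd v\<bar> \<le> int k" using L unfolding Lam0_iff u_def v_def by auto
  have nz: "snd u \<noteq> 0" "snd v \<noteq> 0"
  proof -
    show "snd u \<noteq> 0"
    proof
      assume "snd u = 0"
      then have "\<bar>fst u\<bar> * \<bar>snd v\<bar> = 1" using D by (simp add: abs_mult)
      then have "\<bar>snd v\<bar> = 1" using zmult_eq_1_iff[of "\<bar>fst u\<bar>" "\<bar>snd v\<bar>"] by auto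
      then show False using hs \<open>snd u = 0\<close> by simp
    qed
    show "snd v \<noteq> 0"
    proof
      assume "snd v = 0"
      then have "\<bar>snd u\<bar> * \<bar>fst v\<bar> = 1" using D by (simp add: abs_mult)
      then have "\<bar>snd u\<bar> = 1" using zmult_eq_1_iff[of "\<bar>snd u\<bar>" "\<bar>fst v\<bar>"] by auto
      then show False using hs \<open>snd v = 0\<close> by simp
    qed
  qed
  have bal: "b \<le> 2 * int k * a" if "a \<ge> 1" "b \<ge> 1" "x \<ge> 1" "y \<ge> 1" "x \<le> int k" "y \<le> int k" "x * b \<le> y * a + 1" for a b x y :: int
  proof -
    have "1 * b \<le> x * b" using that by (intro mult_right_mono) auto
    moreover have "y * a \<le> int k * a" using that by (intro mult_right_mono) auto
    moreover have "1 * 1 \<le> int k * a" using that by (intro mult_mono) auto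
    ultimately show ?thesis using that by linarith
  qed
  have A: "\<bar>\<bar>snd v\<bar> * fst u - \<bar>snd u\<bar> * fst v\<bar> = 1"
  proof (cases "snd u > 0")
    case True then have "snd v > 0" using sg nz by (auto simp: zero_le_mult_iff)
    then show ?thesis using True D by (simp add: mult.commute)
  next
    case False then have "snd u < 0" "snd v < 0" using sg nz by (auto simp: zero_le_mult_iff)
    then show ?thesis using D by (simp add: mult.commute abs_minus_commute)
  qed
  have "fst v \<le> 2 * int k * fst u" by (rule bal[of _ _ "\<bar>snd u\<bar>" "\<bar>snd v\<bar>"]) (use uv nz k A in auto)
  moreover have "fst u \<le> 2 * int k * fst v" by (rule bal[of _ _ "\<bar>snd v\<bar>" "\<bar>snd u\<bar>"]) (use uv nz k A in auto)
  moreover have "ext {p,q} = fst u + fst v" using uv unfolding u_def v_def by simp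
  ultimately show ?thesis unfolding u_def[symmetric] v_def[symmetric] fst_diff[symmetric] by (auto simp: min_def algebra_simps)
qed

lemma flip_Omega:
  assumes \<sigma>: "\<sigma> \<in> Omega n k \<xi>" and f: "flippable \<sigma> p q r" and nx: "{p,q} \<notin> \<xi>" and s: "s = p + q - r"
  shows "insert {r,s} (\<sigma> - {{p,q}}) \<in> Omega n k \<xi>" "{r,s} \<notin> \<sigma>" "r \<noteq> s" "mid {r,s} = mid {p,q}"
proof -
  have tri: "triangulation n k \<sigma>" and \<xi>: "\<xi> \<subseteq> \<sigma>" using \<sigma> unfolding Omega_def by auto
  have F: "{p,q} \<in> \<sigma>" "{p,r} \<in> \<sigma>" "{r,q} \<in> \<sigma>" "{p,s} \<in> \<sigma>" "{s,q} \<in> \<sigma>" "\<bar>wedge (q-p) (r-p)\<bar> = 1"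
    using f unfolding flippable_def s by (auto simp: insert_commute)
  note fl = flip_triangulation[OF tri F(1-5) s F(6)]
  show "insert {r,s} (\<sigma> - {{p,q}}) \<in> Omega n k \<xi>" using fl(1) \<xi> nx unfolding Omega_def by blast
  show "{r,s} \<notin> \<sigma>" by (rule fl(2))
  show rs: "r \<noteq> s" using tri_edge(1)[OF fl(1), of r s] by simp
  show "mid {r,s} = mid {p,q}" unfolding mid_pair[OF rs] mid_pair[OF tri_edge(1)[OF tri F(1)]] unfolding s by simp
qed

text \<open>Repeatedly flipping the longest edge that crosses a column removes all crossings of that column; every
  flip shortens the edge while keeping its midpoint.\<close>
theorem cut_column:
  assumes free: "\<And>e. e \<in> \<xi> \<Longrightarrow> \<not> crosses b e"
  shows "\<sigma> \<in> Omega n k \<xi> \<Longrightarrow> \<exists>\<sigma>'\<in>Omega n k \<xi>. \<exists>\<phi>. bij_betw \<phi> \<sigma> \<sigma>' \<and> (\<forall>e\<in>\<sigma>'. \<not> crosses b e) \<and>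
    (\<forall>e\<in>\<sigma>. mid (\<phi> e) = mid e \<and> ext (\<phi> e) \<le> ext e \<and> ht (\<phi> e) \<le> ht e \<and> (\<not> crosses b e \<longrightarrow> \<phi> e = e))"
proof (induction "nat (\<Sum>e\<in>\<sigma>. ext e)" arbitrary: \<sigma> rule: less_induct)
  case less
  have tri: "triangulation n k \<sigma>" and \<xi>: "\<xi> \<subseteq> \<sigma>" using less.prems unfolding Omega_def by auto
  have fin: "finite \<sigma>" by (rule tri_finite[OF tri])
  show ?case
  proof (cases "\<exists>e\<in>\<sigma>. crosses b e")
    case False
    then show ?thesis using less.prems by (intro bexI[of _ \<sigma>] exI[of _ "\<lambda>e. e"]) (auto simp: bij_betw_def)
  next
    case True
    then obtain e where e: "e \<in> \<sigma>" "crosses b e" "\<And>f. f \<in> \<sigma> \<Longrightarrow> crosses b f \<Longrightarrow> ext f \<le> ext e"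
      using finite_has_max_value[of "{e\<in>\<sigma>. crosses b e}" ext] fin by auto
    obtain p q where pq: "e = {p,q}" "fst p < b" "b < fst q"
      by (rule crosses_obtain[OF tri_valid[OF tri e(1)] e(2)])
    \<comment> \<open>As the edge is the longest one across the column, an apex beyond one of its
      ends would give a longer crossing edge.\<close>
    have "\<exists>r. flippable \<sigma> p q r"
    proof (rule longest_flippable[OF tri _ pq(2,3)])
      show "{p,q} \<in> \<sigma>" using e pq by simp
      fix r assume r: "{p,r} \<in> \<sigma>" "{q,r} \<in> \<sigma>"
      show "fst p \<le> fst r \<and> fst r \<le> fst q"
      proof (intro conjI; rule ccontr)
        assume "\<not> fst p \<le> fst r"
        then show False using e(3)[OF r(2)] pq by simp
      next
        assume "\<not> fst r \<le> fst q"
        then show False using e(3)[OF r(1)] pq by simp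
      qed
    qed
    then obtain r where f: "flippable \<sigma> p q r" ..
    define s where "s = p + q - r"
    have nx: "{p,q} \<notin> \<xi>" using free e pq by blast
    note fl = flip_Omega[OF less.prems f nx s_def]
    note ef = flip_effect[OF f s_def]
    define \<sigma>1 where "\<sigma>1 = insert {r,s} (\<sigma> - {{p,q}})"
    have r: "fst p < fst r" "fst r < fst q" using f unfolding flippable_def by auto
    have "(\<Sum>e\<in>\<sigma>1. ext e) = ext {r,s} + (\<Sum>e\<in>\<sigma> - {{p,q}}. ext e)"
      unfolding \<sigma>1_def using fin fl(2) by (intro sum.insert) auto
    moreover have "(\<Sum>e\<in>\<sigma>. ext e) = ext {p,q} + (\<Sum>e\<in>\<sigma> - {{p,q}}. ext e)"
      using fin e(1) pq(1) by (intro sum.remove) auto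
    moreover have "ext {r,s} < ext {p,q}" using ef(1) r by (simp del: ext_pair add: min_def split: if_splits)
    moreover have "(\<Sum>e\<in>\<sigma> - {{p,q}}. ext e) \<ge> 0"
    proof (rule sum_nonneg)
      fix e assume "e \<in> \<sigma> - {{p,q}}"
      then have "e \<in> \<sigma>" by simp
      obtain p0 q0 where "e = {p0,q0}" "p0 \<noteq> q0" by (rule valid_edgeE[OF tri_valid[OF tri \<open>e \<in> \<sigma>\<close>]])
      then show "ext e \<ge> 0" by simp
    qed
    moreover have "ext {r,s} \<ge> 0" by simp
    ultimately have "nat (\<Sum>e\<in>\<sigma>1. ext e) < nat (\<Sum>e\<in>\<sigma>. ext e)" by (simp only: zless_nat_conj) linarith
    from less.hyps[OF this] fl(1)
    obtain \<sigma>' \<phi> where IH: "\<sigma>' \<in> Omega n k \<xi>" "bij_betw \<phi> \<sigma>1 \<sigma>'" "\<forall>e\<in>\<sigma>'. \<not> crosses b e"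
      "\<And>e. e\<in>\<sigma>1 \<Longrightarrow> mid (\<phi> e) = mid e \<and> ext (\<phi> e) \<le> ext e \<and> ht (\<phi> e) \<le> ht e \<and> (\<not> crosses b e \<longrightarrow> \<phi> e = e)"
      unfolding \<sigma>1_def by meson
    define \<psi> where "\<psi> e = \<phi> (if e = {p,q} then {r,s} else e)" for e
    have "bij_betw (\<lambda>e. if e = {p,q} then {r,s} else e) \<sigma> \<sigma>1"
      unfolding \<sigma>1_def bij_betw_def inj_on_def using fl(2) e(1) pq(1) by (auto split: if_splits)
    then have bij: "bij_betw \<psi> \<sigma> \<sigma>'" unfolding \<psi>_def using bij_betw_trans[OF _ IH(2)] by (auto simp: comp_def)
    have "mid (\<psi> e) = mid e \<and> ext (\<psi> e) \<le> ext e \<and> ht (\<psi> e) \<le> ht e \<and> (\<not> crosses b e \<longrightarrow> \<psi> e = e)" if "e \<in> \<sigma>" for e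
    proof (cases "e = {p,q}")
      case True
      have "{r,s} \<in> \<sigma>1" unfolding \<sigma>1_def by simp
      from IH(4)[OF this] show ?thesis using True pq fl(4) ef \<open>ext {r,s} < ext {p,q}\<close> unfolding \<psi>_def by auto
    next
      case False
      then have "e \<in> \<sigma>1" using that unfolding \<sigma>1_def by simp
      from IH(4)[OF this] show ?thesis using False unfolding \<psi>_def by simp
    qed
    then show ?thesis using IH(1,3) bij by (intro bexI[of _ \<sigma>'] exI[of _ \<psi>]) auto
  qed
qed

text \<open>An edge meeting a unit vertical of the column either crosses the column or lies in it;
  in the second case primitivity makes it the same unit vertical. So without crossings maximality
  supplies all of them.\<close>

lemma uncrossed_vcrossing:
  assumes tri: "triangulation n k \<sigma>" and b: "\<bar>2 * b\<bar> \<le> int n" and nc: "\<And>e. e \<in> \<sigma> \<Longrightarrow> \<not> crosses b e"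
  shows "vcrossing k \<sigma> b"
  unfolding vcrossing_def
proof (intro allI impI)
  fix j :: int assume j: "0 \<le> j \<and> j < int k"
  show "{(b, j), (b, j+1)} \<in> \<sigma>"
  proof (rule tri_memI[OF tri])
    show "valid_edge n k {(b, j), (b, j+1)}" using b j unfolding valid_edge_iff Lam0_iff by auto
    fix r s assume rs: "{r,s} \<in> \<sigma>" "{r,s} \<noteq> {(b, j), (b, j+1)}"
    note e = tri_edge[OF tri rs(1)]
    show "\<not> meet (b, j) (b, j+1) r s"
    proof
      assume "meet (b, j) (b, j+1) r s"
      then show False
      proof (rule meetE)
        fix \<alpha> \<beta> :: real
        assume *: "0 < \<alpha>" "\<alpha> < 1" "0 < \<beta>" "\<beta> < 1"
          "real_of_int (fst (b, j)) + \<alpha> * real_of_int (fst (b,j+1) - fst (b, j)) = real_of_int (fst r) + \<beta> * real_of_int (fst s - fst r)"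
          "real_of_int (snd (b, j)) + \<alpha> * real_of_int (snd (b,j+1) - snd (b, j)) = real_of_int (snd r) + \<beta> * real_of_int (snd s - snd r)"
        have bx: "real_of_int b = real_of_int (fst r) + \<beta> * real_of_int (fst s - fst r)" using *(5) by simp
        consider "fst r < fst s" | "fst s < fst r" | "fst r = fst s" by linarith
        then show False
        proof cases
          case 1
          then have "\<beta> * real_of_int (fst s - fst r) > 0" "\<beta> * real_of_int (fst s - fst r) < 1 * real_of_int (fst s - fst r)"
            using * by (simp, intro mult_strict_right_mono) auto
          then have "fst r < b" "b < fst s" using bx by auto
          then show False using nc[OF rs(1)] by simp
        next
          case 2
          then have "\<beta> * real_of_int (fst r - fst s) > 0" "\<beta> * real_of_int (fst r - fst s) < 1 * real_of_int (fst r - fst s)"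
            using * by (simp, intro mult_strict_right_mono) auto
          then have "fst s < b" "b < fst r" using bx by (auto simp: algebra_simps)
          then show False using nc[OF rs(1)] by simp
        next
          case 3
          then have fb: "fst r = b" "fst s = b" using bx by auto
          have "\<bar>snd s - snd r\<bar> = 1" using e(4) 3 by simp
          then consider "snd s = snd r + 1" | "snd r = snd s + 1" by linarith
          then show False
          proof cases
            case 1
            then have "real_of_int j + \<alpha> = real_of_int (snd r) + \<beta>" using *(6) by simp
            then have "snd r = j" using * by linarith
            then show False using rs(2) fb 1 by (auto simp: doubleton_eq_iff prod_eq_iff)
          next
            case 2
            then have "real_of_int j + \<alpha> = real_of_int (snd s) + (1 - \<beta>)" using *(6) by simp
            then have "snd s = j" using * by linarith
            then show False using rs(2) fb 2 by (auto simp: doubleton_eq_iff prod_eq_iff)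
          qed
        qed
      qed
    qed
  qed
qed

section \<open>Columns crossed by long edges of height at least 2\<close>

text \<open>Two distinct edges with the same midpoint would meet there. This allows a flipped edge
  to be found again from its midpoint.\<close>

lemma mid_inj:
  assumes tri: "triangulation n k \<sigma>" and "e \<in> \<sigma>" "f \<in> \<sigma>" "mid e = mid f"
  shows "e = f"
proof (rule ccontr)
  assume ne: "e \<noteq> f"
  obtain p q where e: "e = {p,q}" "p \<noteq> q" by (rule valid_edgeE[OF tri_valid[OF tri assms(2)]])
  obtain r s where f: "f = {r,s}" "r \<noteq> s" by (rule valid_edgeE[OF tri_valid[OF tri assms(3)]])
  have "p + q = r + s" using assms(4) unfolding e(1) f(1) mid_pair[OF e(2)] mid_pair[OF f(2)] .
  then have "s = p + q - r" by simp
  then have "meet p q r s" by (rule diagonals_meet)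
  then show False using tri_not_meet[OF tri, of p q r s] assms(2,3) ne unfolding e(1) f(1) by blast
qed

lemma tri_elen:
  assumes "triangulation n k \<sigma>" "e \<in> \<sigma>"
  shows "elen e = real_of_int (ext e + ht e)" "ext e \<ge> 0" "ht e \<ge> 0"
proof -
  obtain p q where e: "e = {p,q}" "p \<noteq> q" by (rule valid_edgeE[OF tri_valid[OF assms]])
  show "elen e = real_of_int (ext e + ht e)" "ext e \<ge> 0" "ht e \<ge> 0" unfolding e(1) using elen_pair[OF e(2)] by simp_all
qed

lemma weight_pos: "0 < lam \<Longrightarrow> weight lam \<sigma> > 0"
  unfolding weight_def by simp

lemma weight_shrink:
  assumes lam: "0 < lam" "lam < 1" and tri: "triangulation n k \<sigma>" "triangulation n k \<sigma>'"
    and bij: "bij_betw \<phi> \<sigma> \<sigma>'"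
    and le: "\<And>e. e \<in> \<sigma> \<Longrightarrow> ext (\<phi> e) \<le> ext e" "\<And>e. e \<in> \<sigma> \<Longrightarrow> ht (\<phi> e) \<le> ht e"
    and S: "S \<subseteq> \<sigma>" and g: "\<And>e. e \<in> S \<Longrightarrow> g e \<le> ext e - ext (\<phi> e)"
  shows "weight lam \<sigma> \<le> lam powr (\<Sum>e\<in>S. real_of_int (g e)) * weight lam \<sigma>'"
proof -
  have fin: "finite \<sigma>" by (rule tri_finite[OF tri(1)])
  have mem: "\<phi> e \<in> \<sigma>'" if "e \<in> \<sigma>" for e using bij that unfolding bij_betw_def by blast
  have "(\<Sum>e\<in>\<sigma>'. elen e) = (\<Sum>e\<in>\<sigma>. elen (\<phi> e))" using sum.reindex_bij_betw[OF bij] by metis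
  moreover have "(\<Sum>e\<in>S. real_of_int (g e)) \<le> (\<Sum>e\<in>\<sigma>. elen e - elen (\<phi> e))"
  proof -
    have "(\<Sum>e\<in>S. real_of_int (g e)) \<le> (\<Sum>e\<in>S. elen e - elen (\<phi> e))"
    proof (rule sum_mono)
      fix e assume e: "e \<in> S"
      then have es: "e \<in> \<sigma>" using S by blast
      show "real_of_int (g e) \<le> elen e - elen (\<phi> e)"
        unfolding tri_elen(1)[OF tri(1) es] tri_elen(1)[OF tri(2) mem[OF es]] using g[OF e] le(2)[OF es] by linarith
    qed
    also have "\<dots> \<le> (\<Sum>e\<in>\<sigma>. elen e - elen (\<phi> e))"
    proof (rule sum_mono2[OF fin S])
      fix e assume "e \<in> \<sigma> - S"
      then have es: "e \<in> \<sigma>" by blast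
      show "0 \<le> elen e - elen (\<phi> e)"
        unfolding tri_elen(1)[OF tri(1) es] tri_elen(1)[OF tri(2) mem[OF es]] using le[OF es] by linarith
    qed
    finally show ?thesis .
  qed
  ultimately have "(\<Sum>e\<in>S. real_of_int (g e)) + (\<Sum>e\<in>\<sigma>'. elen e) \<le> (\<Sum>e\<in>\<sigma>. elen e)"
    by (simp add: sum_subtractf)
  then have "lam powr (\<Sum>e\<in>\<sigma>. elen e) \<le> lam powr ((\<Sum>e\<in>S. real_of_int (g e)) + (\<Sum>e\<in>\<sigma>'. elen e))"
    using lam by (intro powr_mono') auto
  then show ?thesis unfolding weight_def powr_add .
qed

lemma apex_unique_signed:
  assumes tri: "triangulation n k \<sigma>" and r: "{p,r} \<in> \<sigma>" "{q,r} \<in> \<sigma>" "\<bar>wedge (q-p) (r-p)\<bar> = 1"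
    and z: "{p,z} \<in> \<sigma>" "{q,z} \<in> \<sigma>" "wedge (q-p) (z-p) = wedge (q-p) (r-p)"
  shows "r = z"
proof (cases "wedge (q-p) (r-p) = 1")
  case True then show ?thesis using apex_unique[OF tri r(1,2) _ z(1,2)] z(3) by simp
next
  case False
  then have "wedge (q-p) (r-p) = -1" using r(3) by linarith
  moreover have "wedge (p-q) (x-q) = - wedge (q-p) (x-p)" for x by (simp add: wedge_def algebra_simps)
  ultimately have "wedge (p-q) (r-q) = 1" "wedge (p-q) (z-q) = 1" using z(3) by simp_all
  then show ?thesis using apex_unique[OF tri r(2,1) _ z(2,1)] by simp
qed

lemma flippable_opposite: "flippable \<sigma> p q r \<Longrightarrow> flippable \<sigma> p q (p + q - r)"
  unfolding flippable_def wedge_def by (auto simp: algebra_simps abs_minus_commute)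

text \<open>\<open>r\<close> and \<open>p + q - r\<close> lie on different sides of the edge, and
  each side has only one apex, so \<open>z\<close> is one of these two.\<close>

lemma flippable_apex:
  assumes tri: "triangulation n k \<sigma>" and f: "flippable \<sigma> p q r"
    and z: "{p,z} \<in> \<sigma>" "{q,z} \<in> \<sigma>" "\<bar>wedge (q-p) (z-p)\<bar> = 1"
  shows "fst p < fst z \<and> fst z < fst q"
proof -
  define s where "s = p + q - r"
  have F: "{p,r} \<in> \<sigma>" "{q,r} \<in> \<sigma>" "{p,s} \<in> \<sigma>" "{q,s} \<in> \<sigma>" "\<bar>wedge (q-p) (r-p)\<bar> = 1" "fst p < fst r" "fst r < fst q"
    using f unfolding flippable_def s_def by auto
  have ds: "wedge (q-p) (s-p) = - wedge (q-p) (r-p)" unfolding s_def by (simp add: wedge_def algebra_simps)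
  have "wedge (q-p) (z-p) = wedge (q-p) (r-p) \<or> wedge (q-p) (z-p) = wedge (q-p) (s-p)" using z(3) F(5) ds by linarith
  then have "z = r \<or> z = s"
    using apex_unique_signed[OF tri F(1,2,5) z(1,2)] apex_unique_signed[OF tri F(3,4) _ z(1,2)] ds F(5) by auto
  then show ?thesis using F(6,7) unfolding s_def by auto
qed

text \<open>If a flippable edge were a side of a triangle at another flippable edge, the far end of
  that other edge would be an apex outside its horizontal range. So flipping one edge leaves the
  parallelogram of any other intact.\<close>

lemma flippable_not_side:
  assumes tri: "triangulation n k \<sigma>" and f: "flippable \<sigma> p q r" and f': "flippable \<sigma> p' q' r'"
  shows "{p,q} \<noteq> {p',r'}" "{p,q} \<noteq> {q',r'}"
proof -
  have F: "fst p < fst q" using f unfolding flippable_def by auto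
  have F': "{p',q'} \<in> \<sigma>" "{p',r'} \<in> \<sigma>" "{q',r'} \<in> \<sigma>" "\<bar>wedge (q'-p') (r'-p')\<bar> = 1" "fst p' < fst r'" "fst r' < fst q'"
    using f' unfolding flippable_def by auto
  show "{p,q} \<noteq> {p',r'}"
  proof
    assume "{p,q} = {p',r'}"
    then have "p = p'" "q = r'" using F F' by (auto simp: doubleton_eq_iff)
    moreover have "\<bar>wedge (r'-p') (q'-p')\<bar> = 1" using F'(4) by (simp add: wedge_def algebra_simps abs_minus_commute)
    ultimately show False using flippable_apex[OF tri f, of q'] F' by (simp add: insert_commute)
  qed
  show "{p,q} \<noteq> {q',r'}"
  proof
    assume "{p,q} = {q',r'}"
    then have "q = q'" "p = r'" using F F' by (auto simp: doubleton_eq_iff)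
    moreover have "\<bar>wedge (q'-r') (p'-r')\<bar> = 1" using F'(4) by (simp add: wedge_def algebra_simps abs_minus_commute)
    ultimately show False using flippable_apex[OF tri f, of p'] F' by (simp add: insert_commute)
  qed
qed

definition bad :: "nat \<Rightarrow> int \<Rightarrow> (int \<times> int) set set \<Rightarrow> bool" where
  "bad L b \<sigma> \<longleftrightarrow> (\<exists>e\<in>\<sigma>. crosses b e \<and> int L \<le> ext e \<and> 2 \<le> ht e)"

text \<open>What the estimates use about the boundary condition: its edges cross no column of
  \<open>G\<close>. Every flip concerns an edge across such a column, so no edge of \<xi> is ever
  removed.\<close>

locale free_columns =
  fixes n k :: nat and \<xi> :: "(int \<times> int) set set" and lam :: real and G :: "int set"
  assumes lam: "0 < lam" "lam < 1"
    and finite_G: "finite G"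
    and G_range: "\<And>b. b \<in> G \<Longrightarrow> \<bar>2 * b\<bar> \<le> int n"
    and free: "\<And>b e. b \<in> G \<Longrightarrow> e \<in> \<xi> \<Longrightarrow> \<not> crosses b e"
begin

abbreviation "\<Omega> \<equiv> Omega n k \<xi>"
abbreviation "Z \<equiv> \<Sum>\<sigma>\<in>\<Omega>. weight lam \<sigma>"
text \<open>A flippable edge of height at least 2 loses at least the fraction
  \<open>2 * \<kappa>\<close> of its extent.\<close>

abbreviation "\<kappa> \<equiv> 1 / (2 * real k + 1)"

definition peaks :: "nat \<Rightarrow> (int \<times> int) set set \<Rightarrow> (int \<times> int) set set" where
  "peaks L \<sigma> = {{p,q} | p q. (\<exists>r. flippable \<sigma> p q r) \<and> 2 \<le> ht {p,q} \<and> int L \<le> ext {p,q} \<and> (\<exists>b\<in>G. fst p < b \<and> b < fst q)}"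

definition long_edges :: "nat \<Rightarrow> (int \<times> int) set set" where
  "long_edges L = {e. valid_edge n k e \<and> int L \<le> ext e \<and> (\<exists>b\<in>G. crosses b e)}"

lemma Omega_tri: "\<sigma> \<in> \<Omega> \<Longrightarrow> triangulation n k \<sigma>"
  unfolding Omega_def by simp

lemma w_pos: "weight lam \<sigma> > 0"
  using weight_pos lam by simp

lemma w_nonneg: "weight lam \<sigma> \<ge> 0"
  using w_pos less_imp_le by blast

lemma finite_long_edges: "finite (long_edges L)"
proof (rule finite_subset)
  show "long_edges L \<subseteq> Pow (Lam0 n k)" unfolding long_edges_def by (auto elim!: valid_edgeE)
qed (simp add: finite_Lam0)

lemma peaks_long: "\<sigma> \<in> \<Omega> \<Longrightarrow> peaks L \<sigma> \<subseteq> long_edges L"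
proof
  fix e assume \<sigma>: "\<sigma> \<in> \<Omega>" and "e \<in> peaks L \<sigma>"
  then obtain p q r b where e: "e = {p,q}" "flippable \<sigma> p q r" "int L \<le> ext {p,q}" "b \<in> G" "fst p < b" "b < fst q"
    unfolding peaks_def by blast
  then have "e \<in> \<sigma>" unfolding flippable_def by simp
  then have "valid_edge n k e" by (rule tri_valid[OF Omega_tri[OF \<sigma>]])
  then show "e \<in> long_edges L" using e unfolding long_edges_def by auto
qed

text \<open>Take the longest edge that makes the column bad. An apex beyond one of its ends would
  give a longer edge across the column; as the vertical parts do not have opposite signs, its height
  would still be at least 2, against the choice.\<close>

lemma bad_peak:
  assumes \<sigma>: "\<sigma> \<in> \<Omega>" and b: "b \<in> G" and bad: "bad L b \<sigma>"
  shows "\<exists>e\<in>peaks L \<sigma>. crosses b e"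
proof -
  have tri: "triangulation n k \<sigma>" by (rule Omega_tri[OF \<sigma>])
  have fin: "finite \<sigma>" by (rule tri_finite[OF tri])
  obtain e where e: "e \<in> \<sigma>" "crosses b e" "int L \<le> ext e" "2 \<le> ht e"
    and mx: "\<And>f. f \<in> \<sigma> \<Longrightarrow> crosses b f \<Longrightarrow> int L \<le> ext f \<Longrightarrow> 2 \<le> ht f \<Longrightarrow> ext f \<le> ext e"
    using finite_has_max_value[of "{e\<in>\<sigma>. crosses b e \<and> int L \<le> ext e \<and> 2 \<le> ht e}" ext] fin bad
    unfolding bad_def by auto
  obtain p q where pq: "e = {p,q}" "fst p < b" "b < fst q"
    by (rule crosses_obtain[OF tri_valid[OF tri e(1)] e(2)])
  have "\<exists>r. flippable \<sigma> p q r"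
  proof (rule longest_flippable[OF tri _ pq(2,3)])
    show "{p,q} \<in> \<sigma>" using e pq by simp
    fix r assume r: "{p,r} \<in> \<sigma>" "{q,r} \<in> \<sigma>" "\<bar>wedge (q - p) (r - p)\<bar> = 1"
    show "fst p \<le> fst r \<and> fst r \<le> fst q"
    proof (intro conjI; rule ccontr)
      assume *: "\<not> fst p \<le> fst r"
      have "\<bar>wedge (p - r) (q - p)\<bar> = 1" using r(3) by (simp add: wedge_def algebra_simps abs_minus_commute)
      then have "snd (p-r) * snd (q-p) \<ge> 0" using unimodular_wide(3)[of "p-r" "q-p"] * pq by simp
      then have "\<bar>snd (p-r) + snd (q-p)\<bar> = \<bar>snd (p-r)\<bar> + \<bar>snd (q-p)\<bar>" by (rule abs_add_same_sign)
      then have "ht {q,r} \<ge> ht {p,q}" by (simp add: abs_minus_commute)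
      then show False using mx[OF r(2)] * pq e by simp
    next
      assume *: "\<not> fst r \<le> fst q"
      have "\<bar>wedge (q - p) (r - q)\<bar> = 1" using r(3) by (simp add: wedge_def algebra_simps abs_minus_commute)
      then have "snd (q-p) * snd (r-q) \<ge> 0" using unimodular_wide(3)[of "q-p" "r-q"] * pq by simp
      then have "\<bar>snd (q-p) + snd (r-q)\<bar> = \<bar>snd (q-p)\<bar> + \<bar>snd (r-q)\<bar>" by (rule abs_add_same_sign)
      then have "ht {p,r} \<ge> ht {p,q}" by (simp add: abs_minus_commute)
      then show False using mx[OF r(1)] * pq e by simp
    qed
  qed
  then have "e \<in> peaks L \<sigma>" using pq e b unfolding peaks_def by blast
  then show ?thesis using e(2) by blast
qed

lemma flip_peaks:
  assumes \<sigma>: "\<sigma> \<in> \<Omega>" and f: "flippable \<sigma> p q r" and nx: "{p,q} \<notin> \<xi>"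
    and A: "A \<subseteq> peaks L \<sigma>" "{p,q} \<notin> A"
  shows "A \<subseteq> peaks L (insert {r, p+q-r} (\<sigma> - {{p,q}}))"
proof
  fix e assume e: "e \<in> A"
  have tri: "triangulation n k \<sigma>" by (rule Omega_tri[OF \<sigma>])
  obtain p' q' r' b where *: "e = {p',q'}" "flippable \<sigma> p' q' r'" "2 \<le> ht {p',q'}" "int L \<le> ext {p',q'}" "b \<in> G" "fst p' < b" "b < fst q'"
    using A e unfolding peaks_def by blast
  define s' where "s' = p' + q' - r'"
  have "{p',q'} \<noteq> {p,q}" using e A *(1) by auto
  moreover have "{p',r'} \<noteq> {p,q}" "{q',r'} \<noteq> {p,q}" using flippable_not_side[OF tri f *(2)] by auto
  moreover have "{p',s'} \<noteq> {p,q}" "{q',s'} \<noteq> {p,q}"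
    using flippable_not_side[OF tri f flippable_opposite[OF *(2)]] unfolding s'_def by auto
  ultimately have "flippable (insert {r, p+q-r} (\<sigma> - {{p,q}})) p' q' r'"
    using *(2) unfolding flippable_def s'_def[symmetric] by auto
  then show "e \<in> peaks L (insert {r, p+q-r} (\<sigma> - {{p,q}}))" using * unfolding peaks_def by blast
qed

lemma peak_weight:
  assumes \<sigma>: "\<sigma> \<in> \<Omega>" and f: "flippable \<sigma> p q r" and nx: "{p,q} \<notin> \<xi>" and ht: "2 \<le> ht {p,q}"
  shows "weight lam \<sigma> \<le> lam powr (2 * \<kappa> * real_of_int (ext {p,q})) * weight lam (insert {r, p+q-r} (\<sigma> - {{p,q}}))"
proof -
  have tri: "triangulation n k \<sigma>" by (rule Omega_tri[OF \<sigma>])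
  define s where "s = p + q - r"
  define \<sigma>' where "\<sigma>' = insert {r,s} (\<sigma> - {{p,q}})"
  define \<phi> where "\<phi> e = (if e = {p,q} then {r,s} else e)" for e
  define m where "m = min (fst r - fst p) (fst q - fst r)"
  have pq: "{p,q} \<in> \<sigma>" using f unfolding flippable_def by simp
  note fl = flip_Omega[OF \<sigma> f nx s_def]
  note ef = flip_effect[OF f s_def, folded m_def]
  have m0: "m \<ge> 0" using f unfolding flippable_def m_def by auto
  have bij: "bij_betw \<phi> \<sigma> \<sigma>'" unfolding \<sigma>'_def \<phi>_def bij_betw_def inj_on_def using fl(2) pq by (auto split: if_splits)
  have "weight lam \<sigma> \<le> lam powr (\<Sum>e\<in>{{p,q}}. real_of_int (2 * m)) * weight lam \<sigma>'"
  proof (rule weight_shrink[OF lam tri _ bij])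
    show "triangulation n k \<sigma>'" using Omega_tri[OF fl(1)] unfolding \<sigma>'_def .
    show "ext (\<phi> e) \<le> ext e" for e unfolding \<phi>_def using ef(1) m0 by (auto simp del: ext_pair)
    show "ht (\<phi> e) \<le> ht e" for e unfolding \<phi>_def using ef(2) by (auto simp del: ht_pair)
    show "{{p,q}} \<subseteq> \<sigma>" using pq by simp
    show "2 * m \<le> ext e - ext (\<phi> e)" if "e \<in> {{p,q}}" for e
      using that ef(1) unfolding \<phi>_def by (auto simp del: ext_pair)
  qed
  also have "\<dots> = lam powr (2 * real_of_int m) * weight lam \<sigma>'" by simp
  also have "\<dots> \<le> lam powr (2 * \<kappa> * real_of_int (ext {p,q})) * weight lam \<sigma>'"
  proof (rule mult_right_mono[OF _ w_nonneg])
    have "real_of_int (ext {p,q}) \<le> real_of_int ((2 * int k + 1) * m)"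
      unfolding m_def using flip_gain_high[OF f tri ht] of_int_le_iff by blast
    then have "\<kappa> * real_of_int (ext {p,q}) \<le> real_of_int m" by (simp add: field_simps del: ext_pair)
    then show "lam powr (2 * real_of_int m) \<le> lam powr (2 * \<kappa> * real_of_int (ext {p,q}))"
      using lam by (intro powr_mono') (auto simp del: ext_pair)
  qed
  finally show ?thesis unfolding \<sigma>'_def s_def .
qed

text \<open>Flip \<open>e\<close> and compare weights. The map is injective because the new edge is
  recognised by the midpoint of \<open>e\<close>, and the peaks in \<open>A\<close> remain
  peaks.\<close>

lemma peaks_insert:
  assumes eA: "e \<notin> A"
  shows "(\<Sum>\<sigma>\<in>{\<sigma>\<in>\<Omega>. insert e A \<subseteq> peaks L \<sigma>}. weight lam \<sigma>)
    \<le> lam powr (2 * \<kappa> * real_of_int (ext e)) * (\<Sum>\<sigma>\<in>{\<sigma>\<in>\<Omega>. A \<subseteq> peaks L \<sigma>}. weight lam \<sigma>)" (is "sum _ ?S \<le> _ * sum _ ?T")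
proof (cases "?S = {}")
  case True
  show ?thesis unfolding True sum.empty by (intro mult_nonneg_nonneg sum_nonneg w_nonneg) simp
next
  case False
  then obtain \<sigma>0 where "\<sigma>0 \<in> ?S" by blast
  then obtain p q r0 b where pq: "e = {p,q}" "flippable \<sigma>0 p q r0" "2 \<le> ht {p,q}" "b \<in> G" "fst p < b" "b < fst q"
    unfolding peaks_def by blast
  have nx: "{p,q} \<notin> \<xi>" using free[OF pq(4), of e] pq by auto
  have fl: "\<exists>r. flippable \<sigma> p q r" if S: "\<sigma> \<in> ?S" for \<sigma>
  proof -
    have "e \<in> peaks L \<sigma>" using S by auto
    then obtain p' q' r' where "e = {p',q'}" "flippable \<sigma> p' q' r'" "fst p' < fst q'"
      unfolding peaks_def by force
    moreover from this have "p = p'" "q = q'" using pq by (auto simp: doubleton_eq_iff)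
    ultimately show ?thesis by blast
  qed
  define r where "r \<sigma> = (SOME r. flippable \<sigma> p q r)" for \<sigma>
  have r: "flippable \<sigma> p q (r \<sigma>)" if "\<sigma> \<in> ?S" for \<sigma> unfolding r_def using fl[OF that] by (rule someI_ex)
  define d where "d \<sigma> = {r \<sigma>, p + q - r \<sigma>}" for \<sigma>
  define f where "f \<sigma> = insert (d \<sigma>) (\<sigma> - {e})" for \<sigma>
  have f\<Omega>: "f \<sigma> \<in> \<Omega>" "d \<sigma> \<notin> \<sigma>" "mid (d \<sigma>) = mid e" "e \<in> \<sigma>" if S: "\<sigma> \<in> ?S" for \<sigma>
    using flip_Omega[OF _ r[OF S] nx refl] S r[OF S] unfolding f_def d_def pq(1) flippable_def by auto
  have fT: "f \<sigma> \<in> ?T" if S: "\<sigma> \<in> ?S" for \<sigma>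
  proof -
    have "A \<subseteq> peaks L (f \<sigma>)" using flip_peaks[OF _ r[OF S] nx, of A L] S eA unfolding f_def d_def pq(1) by auto
    then show ?thesis using f\<Omega>(1)[OF S] by simp
  qed
  have inj: "inj_on f ?S"
  proof (rule inj_onI)
    fix \<sigma>1 \<sigma>2 assume S: "\<sigma>1 \<in> ?S" "\<sigma>2 \<in> ?S" and eq: "f \<sigma>1 = f \<sigma>2"
    have "d \<sigma>1 \<in> f \<sigma>1" "d \<sigma>2 \<in> f \<sigma>1" using eq unfolding f_def by auto
    then have d: "d \<sigma>1 = d \<sigma>2"
      using mid_inj[OF Omega_tri[OF f\<Omega>(1)[OF S(1)]]] f\<Omega>(3)[OF S(1)] f\<Omega>(3)[OF S(2)] by simp
    have "\<sigma> = insert e (f \<sigma> - {d \<sigma>})" if "\<sigma> \<in> ?S" for \<sigma>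
      using f\<Omega>(2)[OF that] f\<Omega>(4)[OF that] unfolding f_def by blast
    from this[OF S(1)] this[OF S(2)] show "\<sigma>1 = \<sigma>2" using d eq by simp
  qed
  have "sum (weight lam) ?S \<le> (\<Sum>\<sigma>\<in>?S. lam powr (2 * \<kappa> * real_of_int (ext e)) * weight lam (f \<sigma>))"
  proof (rule sum_mono)
    fix \<sigma> assume S: "\<sigma> \<in> ?S"
    then show "weight lam \<sigma> \<le> lam powr (2 * \<kappa> * real_of_int (ext e)) * weight lam (f \<sigma>)"
      using peak_weight[OF _ r[OF S] nx pq(3)] unfolding f_def d_def pq(1) by blast
  qed
  also have "\<dots> = lam powr (2 * \<kappa> * real_of_int (ext e)) * sum (weight lam) (f ` ?S)"
    unfolding sum.reindex[OF inj] sum_distrib_left by simp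
  also have "\<dots> \<le> lam powr (2 * \<kappa> * real_of_int (ext e)) * sum (weight lam) ?T"
  proof (rule mult_left_mono)
    show "sum (weight lam) (f ` ?S) \<le> sum (weight lam) ?T"
      using fT finite_Omega[of n k \<xi>] w_nonneg by (intro sum_mono2) auto
  qed simp
  finally show ?thesis .
qed

lemma peaks_family:
  assumes "finite A"
  shows "(\<Sum>\<sigma>\<in>{\<sigma>\<in>\<Omega>. A \<subseteq> peaks L \<sigma>}. weight lam \<sigma>) \<le> (\<Prod>e\<in>A. lam powr (2 * \<kappa> * real_of_int (ext e))) * Z"
  using assms
proof induction
  case (insert e A)
  have "(\<Sum>\<sigma>\<in>{\<sigma>\<in>\<Omega>. insert e A \<subseteq> peaks L \<sigma>}. weight lam \<sigma>)
    \<le> lam powr (2 * \<kappa> * real_of_int (ext e)) * (\<Sum>\<sigma>\<in>{\<sigma>\<in>\<Omega>. A \<subseteq> peaks L \<sigma>}. weight lam \<sigma>)"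
    by (rule peaks_insert[OF insert.hyps(2)])
  also have "\<dots> \<le> lam powr (2 * \<kappa> * real_of_int (ext e)) * ((\<Prod>e\<in>A. lam powr (2 * \<kappa> * real_of_int (ext e))) * Z)"
    by (rule mult_left_mono[OF insert.IH]) simp
  finally show ?case using insert.hyps by (simp add: mult.assoc)
qed simp

text \<open>Expanding the product over subsets of the peaks reduces it to
  \<open>peaks_family\<close>. Half of the gain \<open>2 * \<kappa> * ext e\<close> pays for the
  exponential moment; the other half remains against the number of possible long edges.\<close>

lemma peaks_exp_moment:
  "(\<Sum>\<sigma>\<in>\<Omega>. weight lam \<sigma> * (\<Prod>e\<in>peaks L \<sigma>. 1 + lam powr (- \<kappa> * real_of_int (ext e))))
    \<le> (\<Prod>e\<in>long_edges L. 1 + lam powr (\<kappa> * real_of_int (ext e))) * Z"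
proof -
  let ?U = "long_edges L"
  let ?y = "\<lambda>e. lam powr (- \<kappa> * real_of_int (ext e))"
  have finP: "finite (peaks L \<sigma>)" if "\<sigma> \<in> \<Omega>" for \<sigma> using peaks_long[OF that] finite_long_edges finite_subset by blast
  have lin: "- c * x + 2 * c * x = c * x" for c x :: real by simp
  have expand: "(\<Prod>e\<in>B. 1 + g e) = (\<Sum>A\<in>Pow B. prod g A)" if "finite B" for B and g :: "(int\<times>int) set \<Rightarrow> real"
    using prod_add[OF that, of g "\<lambda>_. 1"] by (simp add: add.commute)
  have "(\<Sum>\<sigma>\<in>\<Omega>. weight lam \<sigma> * (\<Prod>e\<in>peaks L \<sigma>. 1 + ?y e))
      = (\<Sum>\<sigma>\<in>\<Omega>. \<Sum>A\<in>Pow ?U. if A \<subseteq> peaks L \<sigma> then weight lam \<sigma> * prod ?y A else 0)"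
  proof (rule sum.cong[OF refl])
    fix \<sigma> assume \<sigma>: "\<sigma> \<in> \<Omega>"
    have "(\<Sum>A\<in>Pow ?U. if A \<subseteq> peaks L \<sigma> then weight lam \<sigma> * prod ?y A else 0)
      = (\<Sum>A\<in>{A \<in> Pow ?U. A \<subseteq> peaks L \<sigma>}. weight lam \<sigma> * prod ?y A)"
      by (rule sum.inter_filter[symmetric]) (simp add: finite_long_edges)
    also have "{A \<in> Pow ?U. A \<subseteq> peaks L \<sigma>} = Pow (peaks L \<sigma>)" using peaks_long[OF \<sigma>] by blast
    finally show "weight lam \<sigma> * (\<Prod>e\<in>peaks L \<sigma>. 1 + ?y e) = (\<Sum>A\<in>Pow ?U. if A \<subseteq> peaks L \<sigma> then weight lam \<sigma> * prod ?y A else 0)"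
      unfolding expand[OF finP[OF \<sigma>]] sum_distrib_left by simp
  qed
  also have "\<dots> = (\<Sum>A\<in>Pow ?U. \<Sum>\<sigma>\<in>\<Omega>. if A \<subseteq> peaks L \<sigma> then weight lam \<sigma> * prod ?y A else 0)" by (rule sum.swap)
  also have "\<dots> = (\<Sum>A\<in>Pow ?U. prod ?y A * (\<Sum>\<sigma>\<in>{\<sigma>\<in>\<Omega>. A \<subseteq> peaks L \<sigma>}. weight lam \<sigma>))"
  proof (rule sum.cong[OF refl])
    fix A
    have "(\<Sum>\<sigma>\<in>\<Omega>. if A \<subseteq> peaks L \<sigma> then weight lam \<sigma> * prod ?y A else 0)
       = (\<Sum>\<sigma>\<in>{\<sigma>\<in>\<Omega>. A \<subseteq> peaks L \<sigma>}. weight lam \<sigma> * prod ?y A)"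
      by (rule sum.inter_filter[symmetric]) (rule finite_Omega)
    also have "\<dots> = (\<Sum>\<sigma>\<in>{\<sigma>\<in>\<Omega>. A \<subseteq> peaks L \<sigma>}. weight lam \<sigma>) * prod ?y A"
      by (rule sum_distrib_right[symmetric])
    finally show "(\<Sum>\<sigma>\<in>\<Omega>. if A \<subseteq> peaks L \<sigma> then weight lam \<sigma> * prod ?y A else 0) = prod ?y A * (\<Sum>\<sigma>\<in>{\<sigma>\<in>\<Omega>. A \<subseteq> peaks L \<sigma>}. weight lam \<sigma>)"
      by (simp only: mult.commute)
  qed
  also have "\<dots> \<le> (\<Sum>A\<in>Pow ?U. prod ?y A * ((\<Prod>e\<in>A. lam powr (2 * \<kappa> * real_of_int (ext e))) * Z))"
  proof (rule sum_mono)
    fix A assume "A \<in> Pow ?U"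
    then have "finite A" using finite_long_edges finite_subset by blast
    then show "prod ?y A * (\<Sum>\<sigma>\<in>{\<sigma>\<in>\<Omega>. A \<subseteq> peaks L \<sigma>}. weight lam \<sigma>) \<le> prod ?y A * ((\<Prod>e\<in>A. lam powr (2 * \<kappa> * real_of_int (ext e))) * Z)"
      by (intro mult_left_mono peaks_family prod_nonneg) auto
  qed
  also have "\<dots> = (\<Sum>A\<in>Pow ?U. (\<Prod>e\<in>A. lam powr (\<kappa> * real_of_int (ext e))) * Z)"
  proof (rule sum.cong[OF refl])
    fix A
    have "prod ?y A * (\<Prod>e\<in>A. lam powr (2 * \<kappa> * real_of_int (ext e))) = (\<Prod>e\<in>A. lam powr (\<kappa> * real_of_int (ext e)))"
      unfolding prod.distrib[symmetric] powr_add[symmetric] by (simp only: lin)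
    then show "prod ?y A * ((\<Prod>e\<in>A. lam powr (2 * \<kappa> * real_of_int (ext e))) * Z) = (\<Prod>e\<in>A. lam powr (\<kappa> * real_of_int (ext e))) * Z"
      by (simp only: mult.assoc[symmetric])
  qed
  also have "\<dots> = (\<Prod>e\<in>?U. 1 + lam powr (\<kappa> * real_of_int (ext e))) * Z"
    unfolding expand[OF finite_long_edges] sum_distrib_right ..
  finally show ?thesis .
qed

text \<open>Each bad column of \<open>G\<close> is crossed by a peak, and a peak crosses fewer
  columns than its extent; so the number of bad columns is at most the total extent of the peaks, to
  which Markov's inequality applies.\<close>

lemma bad_tail:
  "(\<Sum>\<sigma>\<in>{\<sigma>\<in>\<Omega>. T \<le> real (card {b\<in>G. bad L b \<sigma>})}. weight lam \<sigma>)
    \<le> lam powr (\<kappa> * T) * exp (\<Sum>e\<in>long_edges L. lam powr (\<kappa> * real_of_int (ext e))) * Z" (is "sum _ ?S \<le> _")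
proof -
  let ?P = "\<lambda>\<sigma>. \<Prod>e\<in>peaks L \<sigma>. 1 + lam powr (- \<kappa> * real_of_int (ext e))"
  have finP: "finite (peaks L \<sigma>)" if "\<sigma> \<in> \<Omega>" for \<sigma> using peaks_long[OF that] finite_long_edges finite_subset by blast
  have P1: "lam powr (- \<kappa> * T) \<le> ?P \<sigma>" if S: "\<sigma> \<in> ?S" for \<sigma>
  proof -
    have \<sigma>: "\<sigma> \<in> \<Omega>" and T: "T \<le> real (card {b\<in>G. bad L b \<sigma>})" using S by auto
    have card_e: "finite {b. crosses b e} \<and> int (card {b. crosses b e}) \<le> ext e" if e: "e \<in> peaks L \<sigma>" for e
    proof -
      obtain p q b where "e = {p,q}" "fst p < b" "b < fst q" using e unfolding peaks_def by blast
      then have "{b. crosses b e} = {fst p<..<fst q}" "ext e = fst q - fst p" by auto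
      then show ?thesis using \<open>fst p < b\<close> \<open>b < fst q\<close> by simp
    qed
    have "{b\<in>G. bad L b \<sigma>} \<subseteq> (\<Union>e\<in>peaks L \<sigma>. {b. crosses b e})" using bad_peak[OF \<sigma>] by blast
    then have "card {b\<in>G. bad L b \<sigma>} \<le> card (\<Union>e\<in>peaks L \<sigma>. {b. crosses b e})"
      using finP[OF \<sigma>] card_e by (intro card_mono) auto
    also have "\<dots> \<le> (\<Sum>e\<in>peaks L \<sigma>. card {b. crosses b e})" by (rule card_UN_le[OF finP[OF \<sigma>]])
    finally have "real (card {b\<in>G. bad L b \<sigma>}) \<le> real (\<Sum>e\<in>peaks L \<sigma>. card {b. crosses b e})"
      by (rule of_nat_mono)
    also have "\<dots> = (\<Sum>e\<in>peaks L \<sigma>. real (card {b. crosses b e}))" by (rule of_nat_sum)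
    also have "\<dots> \<le> (\<Sum>e\<in>peaks L \<sigma>. real_of_int (ext e))"
    proof (rule sum_mono)
      fix e assume "e \<in> peaks L \<sigma>"
      from card_e[OF this] show "real (card {b. crosses b e}) \<le> real_of_int (ext e)" by linarith
    qed
    finally have sum: "T \<le> (\<Sum>e\<in>peaks L \<sigma>. real_of_int (ext e))" using T by linarith
    then have "\<kappa> * T \<le> \<kappa> * (\<Sum>e\<in>peaks L \<sigma>. real_of_int (ext e))" by (intro mult_left_mono) auto
    then have "- (\<Sum>e\<in>peaks L \<sigma>. \<kappa> * real_of_int (ext e)) \<le> - (\<kappa> * T)" unfolding sum_distrib_left by linarith
    then have "(\<Sum>e\<in>peaks L \<sigma>. - \<kappa> * real_of_int (ext e)) \<le> - \<kappa> * T" by (simp add: sum_negf)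
    then have "lam powr (- \<kappa> * T) \<le> lam powr (\<Sum>e\<in>peaks L \<sigma>. - \<kappa> * real_of_int (ext e))"
      using lam by (intro powr_mono') auto
    also have "\<dots> = (\<Prod>e\<in>peaks L \<sigma>. lam powr (- \<kappa> * real_of_int (ext e)))"
      using lam by (intro powr_sum) (auto intro: finP[OF \<sigma>])
    also have "\<dots> \<le> ?P \<sigma>" by (intro prod_mono) auto
    finally show ?thesis .
  qed
  have P0: "?P \<sigma> \<ge> 0" for \<sigma> by (intro prod_nonneg) (simp add: add_nonneg_nonneg)
  have "lam powr (- \<kappa> * T) * sum (weight lam) ?S = (\<Sum>\<sigma>\<in>?S. weight lam \<sigma> * lam powr (- \<kappa> * T))"
    by (simp add: sum_distrib_left mult.commute)
  also have "\<dots> \<le> (\<Sum>\<sigma>\<in>?S. weight lam \<sigma> * ?P \<sigma>)" by (intro sum_mono mult_left_mono P1 w_nonneg)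
  also have "\<dots> \<le> (\<Sum>\<sigma>\<in>\<Omega>. weight lam \<sigma> * ?P \<sigma>)"
    using finite_Omega w_nonneg P0 by (intro sum_mono2) auto
  also have "\<dots> \<le> (\<Prod>e\<in>long_edges L. 1 + lam powr (\<kappa> * real_of_int (ext e))) * Z" by (rule peaks_exp_moment)
  also have "\<dots> \<le> exp (\<Sum>e\<in>long_edges L. lam powr (\<kappa> * real_of_int (ext e))) * Z"
  proof (rule mult_right_mono)
    show "(\<Prod>e\<in>long_edges L. 1 + lam powr (\<kappa> * real_of_int (ext e))) \<le> exp (\<Sum>e\<in>long_edges L. lam powr (\<kappa> * real_of_int (ext e)))"
      unfolding exp_sum[OF finite_long_edges] by (intro prod_mono) (auto simp: add_nonneg_nonneg)
    show "0 \<le> Z" by (intro sum_nonneg w_nonneg)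
  qed
  finally have "lam powr (- \<kappa> * T) * sum (weight lam) ?S \<le> exp (\<Sum>e\<in>long_edges L. lam powr (\<kappa> * real_of_int (ext e))) * Z" .
  then have "lam powr (\<kappa> * T) * (lam powr (- \<kappa> * T) * sum (weight lam) ?S)
     \<le> lam powr (\<kappa> * T) * (exp (\<Sum>e\<in>long_edges L. lam powr (\<kappa> * real_of_int (ext e))) * Z)"
    by (rule mult_left_mono) simp
  moreover have "lam powr (\<kappa> * T) * lam powr (- \<kappa> * T) = 1"
    using lam unfolding powr_add[symmetric] by simp
  ultimately show ?thesis by (simp only: mult.assoc[symmetric] mult_1_left)
qed

end

section \<open>Long edges of height 1\<close>

lemma geometric_bound:
  fixes x :: real
  assumes "0 < x" "x < 1" "finite I"
  shows "(\<Sum>i\<in>I. x ^ i) \<le> 1 / (1 - x)"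
proof -
  have "(\<Sum>i\<in>I. x ^ i) \<le> (\<Sum>i. x ^ i)"
    using assms by (intro sum_le_suminf summable_geometric) auto
  also have "\<dots> = 1 / (1 - x)" using assms by (intro suminf_geometric) auto
  finally show ?thesis .
qed

text \<open>The product is the generating function of partitions with parts in \<open>I\<close>.
  Each factor is at most \<open>exp (x ^ t / (1 - x))\<close> and the exponents form a geometric
  series, so the bound is uniform in \<open>I\<close>.\<close>

lemma euler_product_bound:
  fixes x :: real
  assumes "0 < x" "x < 1" "finite I" "0 \<notin> I"
  shows "(\<Prod>t\<in>I. 1 / (1 - x ^ t)) \<le> exp (1 / (1 - x)\<^sup>2)"
proof -
  have "(\<Prod>t\<in>I. 1 / (1 - x ^ t)) \<le> (\<Prod>t\<in>I. exp (x ^ t / (1 - x)))"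
  proof (rule prod_mono)
    fix t assume "t \<in> I"
    then have t: "t \<ge> 1" using assms(4) by (cases t) auto
    have "x ^ t \<le> x ^ 1" using t assms by (intro power_decreasing) auto
    then have le: "x ^ t \<le> x" by simp
    have pos: "1 - x ^ t > 0" using le assms by simp
    have "1 / (1 - x ^ t) = 1 + x ^ t / (1 - x ^ t)" using pos by (simp add: field_simps)
    also have "\<dots> \<le> exp (x ^ t / (1 - x ^ t))" by (rule exp_ge_add_one_self)
    also have "\<dots> \<le> exp (x ^ t / (1 - x))" using le assms by (simp add: frac_le)
    finally show "0 \<le> 1 / (1 - x ^ t) \<and> 1 / (1 - x ^ t) \<le> exp (x ^ t / (1 - x))" using pos by simp
  qed
  also have "\<dots> = exp ((\<Sum>t\<in>I. x ^ t) / (1 - x))" unfolding sum_divide_distrib exp_sum[OF assms(3)] ..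
  also have "\<dots> \<le> exp (1 / (1 - x) / (1 - x))"
    using geometric_bound[OF assms(1-3)] assms by (intro exp_le_cancel_iff[THEN iffD2] divide_right_mono) auto
  finally show ?thesis by (simp add: power2_eq_square)
qed

lemma sum_UN_le:
  fixes f :: "'b \<Rightarrow> real"
  assumes "finite I" "\<And>i. i \<in> I \<Longrightarrow> finite (A i)" "\<And>x. 0 \<le> f x"
  shows "sum f (\<Union>i\<in>I. A i) \<le> (\<Sum>i\<in>I. sum f (A i))"
  using assms(1,2)
proof induction
  case (insert i I)
  have "sum f (A i \<union> (\<Union>i\<in>I. A i)) \<le> sum f (A i) + sum f (\<Union>i\<in>I. A i)"
    using sum.union_inter[of "A i" "\<Union>i\<in>I. A i" f] insert
      sum_nonneg[of "A i \<inter> (\<Union>i\<in>I. A i)" f] assms(3) by simp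
  then show ?case using insert by simp
qed simp

context free_columns
begin

text \<open>Bound for the long edges across one column: the square of \<open>k + 1\<close> counts
  the rows of the two ends, and two geometric series account for their distances from the
  column.\<close>

definition eta :: "nat \<Rightarrow> real" where
  "eta L = (real k + 1)\<^sup>2 * ((lam powr (\<kappa> / 2)) ^ L / (1 - lam powr (\<kappa> / 2))\<^sup>2)"

lemma long_edges_sum: "(\<Sum>e\<in>long_edges L. lam powr (\<kappa> * real_of_int (ext e))) \<le> real (card G) * eta L"
proof -
  define \<nu> where "\<nu> = lam powr (\<kappa> / 2)"
  have \<nu>: "0 < \<nu>" "\<nu> < 1"
  proof -
    show "0 < \<nu>" unfolding \<nu>_def using lam by simp
    have "lam powr (\<kappa> / 2) < lam powr 0" using lam by (intro powr_less_mono') (auto intro!: divide_pos_pos)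
    then show "\<nu> < 1" unfolding \<nu>_def using lam by simp
  qed
  let ?f = "\<lambda>e. lam powr (\<kappa> * real_of_int (ext e))"
  define I where "I = {(x,y). x \<le> n \<and> y \<le> n \<and> L \<le> x + y} \<times> ({0..k} \<times> {0..k})"
  have finI: "finite I"
  proof (rule finite_subset)
    show "I \<subseteq> ({0..n} \<times> {0..n}) \<times> ({0..k} \<times> {0..k})" unfolding I_def by auto
  qed simp
  define h where "h b = (\<lambda>((x::nat,y::nat),(i::nat,j::nat)). {(b - int x, int i), (b + int y, int j)})" for b :: int
  have sub: "long_edges L \<subseteq> (\<Union>b\<in>G. h b ` I)"
  proof
    fix e assume e: "e \<in> long_edges L"
    then obtain b where b: "b \<in> G" "crosses b e" "valid_edge n k e" "int L \<le> ext e" unfolding long_edges_def by blast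
    obtain p q where pq: "e = {p,q}" "fst p < b" "b < fst q" by (rule crosses_obtain[OF b(3,2)])
    have pL: "p \<in> Lam0 n k" "q \<in> Lam0 n k" using b(3) unfolding pq(1) valid_edge_iff by auto
    note R = pL[unfolded Lam0_iff] G_range[OF b(1)]
    define z where "z = ((nat (b - fst p), nat (fst q - b)), (nat (snd p), nat (snd q)))"
    have "z \<in> I" unfolding z_def I_def using R pq b(4) by auto
    moreover have "h b z = e" unfolding z_def h_def pq(1) using R pq by (simp add: prod_eq_iff)
    ultimately show "e \<in> (\<Union>b\<in>G. h b ` I)" using b(1) by blast
  qed
  have "(\<Sum>e\<in>long_edges L. ?f e) \<le> (\<Sum>e\<in>(\<Union>b\<in>G. h b ` I). ?f e)"
    using sub finI finite_G by (intro sum_mono2) auto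
  also have "\<dots> \<le> (\<Sum>b\<in>G. \<Sum>e\<in>h b ` I. ?f e)"
    by (rule sum_UN_le[OF finite_G]) (use finI in auto)
  also have "\<dots> \<le> (\<Sum>b\<in>G. eta L)"
  proof (rule sum_mono)
    fix b
    have "(\<Sum>e\<in>h b ` I. ?f e) \<le> (\<Sum>z\<in>I. ?f (h b z))"
      using sum_image_le[OF finI, of ?f "h b"] by (simp add: comp_def)
    also have "\<dots> \<le> (\<Sum>z\<in>I. \<nu> ^ L * \<nu> ^ fst (fst z) * \<nu> ^ snd (fst z))"
    proof (rule sum_mono)
      fix z assume "z \<in> I"
      then obtain x y i j where z: "z = ((x,y),(i,j))" "L \<le> x + y" unfolding I_def by auto
      have ex: "real_of_int (ext (h b z)) = real (x + y)" unfolding z h_def by simp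
      have "c * real m = c / 2 * real (2 * m)" for c m by simp
      then have "?f (h b z) = lam powr (\<kappa> / 2 * real (2 * (x + y)))" unfolding ex by (simp only:)
      also have "\<dots> = \<nu> ^ (2 * (x + y))"
        unfolding \<nu>_def powr_realpow[symmetric, OF \<nu>(1)[unfolded \<nu>_def]] powr_powr ..
      \<comment> \<open>Half of the exponent yields the small factor \<open>\<nu> ^ L\<close>; the
        other half keeps the series over \<open>x\<close> and \<open>y\<close> convergent.\<close>
      also have "\<dots> \<le> \<nu> ^ (L + x + y)" using z(2) \<nu> by (intro power_decreasing) auto
      also have "\<dots> = \<nu> ^ L * \<nu> ^ x * \<nu> ^ y" by (simp add: power_add)
      finally show "?f (h b z) \<le> \<nu> ^ L * \<nu> ^ fst (fst z) * \<nu> ^ snd (fst z)" unfolding z by simp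
    qed
    also have "\<dots> \<le> (\<Sum>z\<in>({0..n} \<times> {0..n}) \<times> ({0..k} \<times> {0..k}). \<nu> ^ L * \<nu> ^ fst (fst z) * \<nu> ^ snd (fst z))"
      unfolding I_def using \<nu> by (intro sum_mono2) auto
    also have "\<dots> = (real k + 1)\<^sup>2 * (\<nu> ^ L * ((\<Sum>x\<in>{0..n}. \<nu> ^ x) * (\<Sum>y\<in>{0..n}. \<nu> ^ y)))"
      by (simp add: sum.cartesian_product' sum_product sum_distrib_left sum_distrib_right power2_eq_square algebra_simps)
    also have "\<dots> \<le> (real k + 1)\<^sup>2 * (\<nu> ^ L * (1 / (1 - \<nu>) * (1 / (1 - \<nu>))))"
      using \<nu> by (intro mult_left_mono mult_mono geometric_bound sum_nonneg) auto
    also have "\<dots> = eta L" unfolding eta_def \<nu>_def[symmetric] by (simp add: power2_eq_square)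
    finally show "(\<Sum>e\<in>h b ` I. ?f e) \<le> eta L" .
  qed
  finally show ?thesis by simp
qed

end

text \<open>In direction \<open>(j, \<eta>, \<theta>)\<close> these are the edges of height 1 across column \<open>b\<close> whose end in row \<open>j\<close> lies
  at distance \<open>x\<close> from the column, on the side \<open>-\<theta>\<close>, and whose other end, in row \<open>j + \<eta>\<close>, lies at distance \<open>t\<close>.\<close>
definition uedge :: "int \<Rightarrow> int \<times> int \<times> int \<Rightarrow> nat \<Rightarrow> nat \<Rightarrow> (int \<times> int) set" where
  "uedge b = (\<lambda>(j,\<eta>,\<theta>) x t. {(b - \<theta> * int x, j), (b + \<theta> * int t, j + \<eta>)})"

definition dirs :: "nat \<Rightarrow> (int \<times> int \<times> int) set" where
  "dirs k = {0..int k} \<times> {-1,1} \<times> {-1,1}"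

text \<open>Here \<open>t \<le> x\<close> makes the end in row \<open>j\<close> the far one, and
  \<open>L \<le> x + t\<close> says that the edge is long. The size of a level plays the role of the
  multiplicity of the part \<open>t\<close> in a partition.\<close>

definition level :: "nat \<Rightarrow> int \<Rightarrow> (int \<times> int) set set \<Rightarrow> int \<times> int \<times> int \<Rightarrow> nat \<Rightarrow> nat set" where
  "level L b \<sigma> \<tau> t = {x. t \<le> x \<and> L \<le> x + t \<and> uedge b \<tau> x t \<in> \<sigma>}"

text \<open>If \<open>x < x'\<close>, the second edge reaches farther than the first on both sides
  of the column, and two such segments between the same rows cross.\<close>

lemma uedge_monotone:
  assumes tri: "triangulation n k \<sigma>" and \<tau>: "\<tau> \<in> dirs k"
    and "uedge b \<tau> x t \<in> \<sigma>" "uedge b \<tau> x' (Suc t) \<in> \<sigma>"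
  shows "x' \<le> x"
proof (rule ccontr)
  assume "\<not> x' \<le> x"
  then have lt: "x < x'" by simp
  obtain j \<eta> \<theta> where t: "\<tau> = (j,\<eta>,\<theta>)" "\<eta> = 1 \<or> \<eta> = -1" "\<theta> = 1 \<or> \<theta> = -1" using \<tau> unfolding dirs_def by auto
  define \<alpha> where "\<alpha> = (real x' - real x) / (1 + real x' - real x)"
  have \<alpha>: "0 < \<alpha>" "\<alpha> < 1" "\<alpha> * (1 + real x' - real x) = real x' - real x" unfolding \<alpha>_def using lt by auto
  have "meet (b - \<theta> * int x, j) (b + \<theta> * int t, j + \<eta>) (b - \<theta> * int x', j) (b + \<theta> * int (Suc t), j + \<eta>)"
  proof (rule meetI[OF \<alpha>(1,2) \<alpha>(1,2)])
    have "real_of_int \<theta> * (\<alpha> * (1 + real x' - real x)) = real_of_int \<theta> * (real x' - real x)" using \<alpha>(3) by simp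
    then show "real_of_int (fst (b - \<theta> * int x, j)) + \<alpha> * real_of_int (fst (b + \<theta> * int t, j + \<eta>) - fst (b - \<theta> * int x, j))
      = real_of_int (fst (b - \<theta> * int x', j)) + \<alpha> * real_of_int (fst (b + \<theta> * int (Suc t), j + \<eta>) - fst (b - \<theta> * int x', j))"
      by (simp add: algebra_simps)
  qed simp
  moreover have "uedge b \<tau> x t \<noteq> uedge b \<tau> x' (Suc t)"
    unfolding uedge_def t(1) using t(2,3) lt by (auto simp: doubleton_eq_iff)
  ultimately show False using tri_not_meet[OF tri] assms(3,4) unfolding uedge_def t(1) by auto
qed

text \<open>The triangle on one side of the edge decides. If its apex is in the row of an end, it is
  a neighbour of that end and gives one of the two edges claimed. In any other row, one of its sides
  is a long edge of height at least 2 across \<open>b\<close>, so the column would be bad.\<close>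

lemma uedge_next:
  assumes tri: "triangulation n k \<sigma>" and \<tau>: "\<tau> \<in> dirs k" and nb: "\<not> bad L b \<sigma>"
    and e: "uedge b \<tau> x t \<in> \<sigma>" and xt: "1 \<le> x" "1 \<le> t" "L \<le> x + t"
  shows "uedge b \<tau> (x - 1) t \<in> \<sigma> \<or> uedge b \<tau> x (Suc t) \<in> \<sigma>"
proof -
  obtain j \<eta> \<theta> where t: "\<tau> = (j,\<eta>,\<theta>)" and \<eta>: "\<eta> = 1 \<or> \<eta> = -1" and \<theta>: "\<theta> = 1 \<or> \<theta> = -1" using \<tau> unfolding dirs_def by auto
  define P where "P = (b - \<theta> * int x, j)"
  define Q where "Q = (b + \<theta> * int t, j + \<eta>)"
  have PQ: "{P,Q} \<in> \<sigma>" using e unfolding uedge_def t P_def Q_def by simp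
  have sg: "- (\<theta> * \<eta>) = 1 \<or> - (\<theta> * \<eta>) = -1" using \<eta> \<theta> by auto
  have sides: "\<exists>z. wedge (Q - P) (z - P) = - (\<theta> * \<eta>) \<and> {P,z} \<in> \<sigma> \<and> {Q,z} \<in> \<sigma>"
  proof (cases "\<theta> = 1")
    case True
    have "fst P < b" "b < fst Q" using True xt unfolding P_def Q_def by auto
    then obtain r s where "wedge (Q - P) (r - P) = 1" "{P,r} \<in> \<sigma>" "{Q,r} \<in> \<sigma>" "wedge (Q - P) (s - P) = -1" "{P,s} \<in> \<sigma>" "{Q,s} \<in> \<sigma>"
      by (rule apexes[OF tri PQ])
    then show ?thesis using sg by metis
  next
    case False
    have "fst Q < b" "b < fst P" using False \<theta> xt unfolding P_def Q_def by auto
    moreover have "{Q,P} \<in> \<sigma>" using PQ by (simp add: insert_commute)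
    ultimately obtain r s where rs: "wedge (P - Q) (r - Q) = 1" "{Q,r} \<in> \<sigma>" "{P,r} \<in> \<sigma>" "wedge (P - Q) (s - Q) = -1" "{Q,s} \<in> \<sigma>" "{P,s} \<in> \<sigma>"
      using apexes[OF tri] by metis
    have "wedge (Q - P) (z - P) = - wedge (P - Q) (z - Q)" for z by (simp add: wedge_def algebra_simps)
    then have "wedge (Q - P) (r - P) = -1" "wedge (Q - P) (s - P) = 1" using rs by simp_all
    then show ?thesis using rs sg by metis
  qed
  then obtain z where z: "wedge (Q - P) (z - P) = - (\<theta> * \<eta>)" "{P,z} \<in> \<sigma>" "{Q,z} \<in> \<sigma>" by blast
  \<comment> \<open>Coordinates relative to \<open>P\<close>, reflected so that the four sign
    choices of \<eta> and \<theta> look alike.\<close>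
  define \<rho>1 where "\<rho>1 = \<theta> * (fst z - fst P)"
  define \<rho>2 where "\<rho>2 = \<eta> * (snd z - snd P)"
  have zf: "fst z = fst P + \<theta> * \<rho>1" "snd z = snd P + \<eta> * \<rho>2" unfolding \<rho>1_def \<rho>2_def using \<eta> \<theta> by auto
  have "wedge (Q - P) (z - P) = \<theta> * \<eta> * ((int x + int t) * \<rho>2 - \<rho>1)"
    unfolding wedge_def P_def Q_def \<rho>1_def \<rho>2_def using \<eta> \<theta> by (auto simp: algebra_simps)
  \<comment> \<open>The unit area of the triangle ties the coordinates together, so the row of the
    apex determines its position.\<close>
  then have \<rho>: "\<rho>1 = 1 + (int x + int t) * \<rho>2" using z(1) \<eta> \<theta> by auto
  consider "\<rho>2 = 0" | "\<rho>2 = 1" | "\<rho>2 \<ge> 2" | "\<rho>2 \<le> -1" by linarith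
  then show ?thesis
  proof cases
    case 1
    then have "z = (b - \<theta> * int (x - 1), j)" using zf \<rho> xt unfolding P_def by (auto simp: prod_eq_iff algebra_simps of_nat_diff)
    then show ?thesis using z(3) unfolding Q_def uedge_def t by (simp add: insert_commute)
  next
    case 2
    then have "z = (b + \<theta> * int (Suc t), j + \<eta>)" using zf \<rho> unfolding P_def by (auto simp: prod_eq_iff algebra_simps)
    then show ?thesis using z(2) unfolding P_def uedge_def t by simp
  next
    case 3
    have "(int x + int t) * \<rho>2 \<ge> (int x + int t) * 2" using 3 by (intro mult_left_mono) auto
    then have r: "\<rho>1 \<ge> 1 + 2 * (int x + int t)" using \<rho> by linarith
    have "crosses b {P,z}" using \<theta> r xt zf unfolding P_def by auto
    moreover have "int L \<le> ext {P,z}" using \<theta> r xt zf by auto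
    moreover have "2 \<le> ht {P,z}" using \<eta> 3 zf by auto
    ultimately show ?thesis using nb z(2) unfolding bad_def by blast
  next
    case 4
    have "(int x + int t) * \<rho>2 \<le> - (int x + int t)" using mult_left_mono[of \<rho>2 "-1" "int x + int t"] 4 by simp
    then have r: "\<rho>1 \<le> 1 - (int x + int t)" using \<rho> by linarith
    have "crosses b {Q,z}" using \<theta> r xt zf unfolding P_def Q_def by auto
    moreover have "int L \<le> ext {Q,z}" using \<theta> r xt zf unfolding P_def Q_def by auto
    moreover have "2 \<le> ht {Q,z}" using \<eta> 4 zf unfolding P_def Q_def by auto
    ultimately show ?thesis using nb z(3) unfolding bad_def by blast
  qed
qed

lemma predecessor_closed_interval:
  fixes S :: "nat set"
  assumes fin: "finite S" and lb: "\<And>x. x \<in> S \<Longrightarrow> a \<le> x" and pred: "\<And>x. x \<in> S \<Longrightarrow> a < x \<Longrightarrow> x - 1 \<in> S"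
  shows "S = {a..<a + card S}"
proof (cases "S = {}")
  case False
  define M where "M = Max S"
  have M: "M \<in> S" "\<And>x. x \<in> S \<Longrightarrow> x \<le> M" unfolding M_def using fin False by auto
  have down: "M - i \<in> S" if "a + i \<le> M" for i
    using that
  proof (induction i)
    case (Suc i)
    then have "M - i \<in> S" "a < M - i" by auto
    then show ?case using pred[of "M - i"] by simp
  qed (use M in simp)
  have "x \<in> S" if "a \<le> x" "x \<le> M" for x using down[of "M - x"] that by simp
  moreover have "a \<le> x \<and> x \<le> M" if "x \<in> S" for x using lb[OF that] M(2)[OF that] by simp
  ultimately have S: "S = {a..M}" unfolding set_eq_iff atLeastAtMost_iff by metis
  then have "card S = M + 1 - a" by simp
  moreover have "a \<le> M" using lb M by blast
  ultimately have "{a..<a + card S} = {a..M}" by auto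
  then show ?thesis using S by simp
qed simp

lemma uedge_inj:
  assumes "\<tau> = (j,\<eta>,\<theta>)" "\<tau>' = (j',\<eta>',\<theta>)" "\<theta> = 1 \<or> \<theta> = -1" "1 \<le> x" "1 \<le> x'" "1 \<le> t" "1 \<le> t'"
    "uedge b \<tau> x t = uedge b \<tau>' x' t'"
  shows "\<tau> = \<tau>' \<and> x = x' \<and> t = t'"
  using assms unfolding uedge_def by (auto simp: doubleton_eq_iff)

lemma finite_level:
  assumes "finite \<sigma>" "\<tau> \<in> dirs k" "1 \<le> t"
  shows "finite (level L b \<sigma> \<tau> t)"
proof -
  obtain j \<eta> \<theta> where t: "\<tau> = (j,\<eta>,\<theta>)" and \<theta>: "\<theta> = 1 \<or> \<theta> = -1" using assms(2) unfolding dirs_def by auto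
  have "inj_on (\<lambda>x. uedge b \<tau> x t) (level L b \<sigma> \<tau> t)"
  proof (rule inj_onI)
    fix x y assume "x \<in> level L b \<sigma> \<tau> t" "y \<in> level L b \<sigma> \<tau> t" "uedge b \<tau> x t = uedge b \<tau> y t"
    then show "x = y" using uedge_inj[OF t t \<theta>, of x y t t b] assms(3) unfolding level_def by auto
  qed
  moreover have "(\<lambda>x. uedge b \<tau> x t) ` level L b \<sigma> \<tau> t \<subseteq> \<sigma>" unfolding level_def by auto
  ultimately show ?thesis using assms(1) by (meson finite_imageD finite_subset)
qed

text \<open>By monotonicity no element of a level is below one of the next level, and
  \<open>uedge_next\<close> allows a step from \<open>x\<close> to \<open>x - 1\<close> unless
  \<open>x\<close> also occurs at near distance \<open>t + 1\<close>. So the start of the interval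
  is dictated by \<open>t\<close>, \<open>L - t\<close> and the next level, and only its length is
  free.\<close>

lemma level_interval:
  assumes tri: "triangulation n k \<sigma>" and \<tau>: "\<tau> \<in> dirs k" and nb: "\<not> bad L b \<sigma>" and t: "1 \<le> t"
    and a: "a = Max (insert t (insert (L - t) (level L b \<sigma> \<tau> (Suc t))))"
  shows "level L b \<sigma> \<tau> t = {a..<a + card (level L b \<sigma> \<tau> t)}"
proof (rule predecessor_closed_interval)
  have fin: "finite (level L b \<sigma> \<tau> t)" "finite (level L b \<sigma> \<tau> (Suc t))" using finite_level[OF tri_finite[OF tri] \<tau>] t by auto
  show "finite (level L b \<sigma> \<tau> t)" by fact
  fix x assume x: "x \<in> level L b \<sigma> \<tau> t"
  then have xx: "t \<le> x" "L \<le> x + t" "uedge b \<tau> x t \<in> \<sigma>" unfolding level_def by auto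
  have "y \<le> x" if "y \<in> level L b \<sigma> \<tau> (Suc t)" for y
    using uedge_monotone[OF tri \<tau> xx(3), of y] that unfolding level_def by auto
  then show "a \<le> x" unfolding a using fin xx by auto
  assume "a < x"
  then have ax: "t < x" "L - t < x" "x \<notin> level L b \<sigma> \<tau> (Suc t)" unfolding a using fin by auto
  have "uedge b \<tau> (x - 1) t \<in> \<sigma> \<or> uedge b \<tau> x (Suc t) \<in> \<sigma>"
    by (rule uedge_next[OF tri \<tau> nb xx(3)]) (use t xx in auto)
  moreover have "uedge b \<tau> x (Suc t) \<notin> \<sigma>" using ax xx unfolding level_def by auto
  ultimately show "x - 1 \<in> level L b \<sigma> \<tau> t" using ax unfolding level_def by auto
qed

text \<open>Levels beyond \<open>T\<close> are empty. Going down in \<open>t\<close>, each level is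
  an interval whose start is known from the next level and whose length is its cardinality.\<close>

lemma level_eqI:
  assumes "triangulation n k \<sigma>" "\<not> bad L b \<sigma>" "triangulation n k \<sigma>'" "\<not> bad L b \<sigma>'" "\<tau> \<in> dirs k"
    and card: "\<And>t. 1 \<le> t \<Longrightarrow> t \<le> T \<Longrightarrow> card (level L b \<sigma> \<tau> t) = card (level L b \<sigma>' \<tau> t)"
    and empty: "\<And>t. T < t \<Longrightarrow> level L b \<sigma> \<tau> t = {}" "\<And>t. T < t \<Longrightarrow> level L b \<sigma>' \<tau> t = {}"
    and t: "1 \<le> t"
  shows "level L b \<sigma> \<tau> t = level L b \<sigma>' \<tau> t"
  using t
proof (induction "T - t" arbitrary: t rule: less_induct)
  case less
  show ?case
  proof (cases "T < t")
    case True then show ?thesis using empty by simp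
  next
    case False
    have "level L b \<sigma> \<tau> (Suc t) = level L b \<sigma>' \<tau> (Suc t)"
    proof (cases "T < Suc t")
      case True then show ?thesis using empty by simp
    next
      case False then show ?thesis by (intro less.hyps) auto
    qed
    then show ?thesis
      using level_interval[OF assms(1,5,2) less.prems refl] level_interval[OF assms(3,5,4) less.prems refl]
        card[OF less.prems] False by simp
  qed
qed

section \<open>Counting the edges across a column\<close>

text \<open>The distance of the near end; a cut at \<open>b\<close> shortens the edge by at least
  twice this amount.\<close>

definition depth :: "int \<Rightarrow> (int \<times> int) set \<Rightarrow> int" where
  "depth b e = min (b - Min (fst ` e)) (Max (fst ` e) - b)"

lemma depth_pair: "fst p < b \<Longrightarrow> b < fst q \<Longrightarrow> depth b {p,q} = min (b - fst p) (fst q - b)"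
  unfolding depth_def by simp

definition crossing :: "int \<Rightarrow> (int \<times> int) set set \<Rightarrow> (int \<times> int) set set" where
  "crossing b \<sigma> = {e\<in>\<sigma>. crosses b e}"

lemma uedge_crosses:
  assumes "\<tau> \<in> dirs k" "1 \<le> t" "t \<le> x"
  shows "crosses b (uedge b \<tau> x t)" "depth b (uedge b \<tau> x t) = int t"
proof -
  obtain j \<eta> \<theta> where t: "\<tau> = (j,\<eta>,\<theta>)" "\<theta> = 1 \<or> \<theta> = -1" using assms(1) unfolding dirs_def by auto
  show "crosses b (uedge b \<tau> x t)" "depth b (uedge b \<tau> x t) = int t"
    using t assms(2,3) unfolding uedge_def depth_def by auto
qed

lemma level_crossing: "\<tau> \<in> dirs k \<Longrightarrow> 1 \<le> t \<Longrightarrow> level L b (crossing b \<sigma>) \<tau> t = level L b \<sigma> \<tau> t"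
  unfolding level_def crossing_def using uedge_crosses(1)[of \<tau> k t _ b] by blast

lemma level_bound:
  assumes "triangulation n k \<sigma>" "\<tau> \<in> dirs k" "\<bar>2 * b\<bar> \<le> int n" "1 \<le> t" "x \<in> level L b \<sigma> \<tau> t"
  shows "t \<le> n" "1 \<le> x" "x \<le> n"
proof -
  obtain j \<eta> \<theta> where t: "\<tau> = (j,\<eta>,\<theta>)" "\<theta> = 1 \<or> \<theta> = -1" using assms(2) unfolding dirs_def by auto
  have x: "t \<le> x" "{(b - \<theta> * int x, j), (b + \<theta> * int t, j + \<eta>)} \<in> \<sigma>" using assms(5) unfolding level_def uedge_def t by auto
  have "(b - \<theta> * int x, j) \<in> Lam0 n k" using tri_edge[OF assms(1) x(2)] by blast
  then have "x \<le> n" using t(2) assms(3) unfolding Lam0_iff by auto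
  then show "t \<le> n" "1 \<le> x" "x \<le> n" using x(1) assms(4) by auto
qed

text \<open>For each side \<theta> a crossing edge is read off at most once and contributes its near
  distance, which is its depth. The two sides give the factor 2, matching the gain of twice the
  depth in a cut.\<close>

lemma depth_sum:
  assumes tri: "triangulation n k \<sigma>" and b: "\<bar>2 * b\<bar> \<le> int n"
  shows "(\<Sum>(\<tau>,t)\<in>dirs k \<times> {1..n}. int (t * card (level L b \<sigma> \<tau> t))) \<le> 2 * (\<Sum>e\<in>crossing b \<sigma>. depth b e)"
proof -
  have fin: "finite \<sigma>" by (rule tri_finite[OF tri])
  define D where "D \<theta> = {0..int k} \<times> {-1,1::int} \<times> {\<theta>}" for \<theta> :: int
  have dirs: "dirs k = D 1 \<union> D (-1)" "D 1 \<inter> D (-1) = {}" unfolding D_def dirs_def by auto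
  have one: "(\<Sum>(\<tau>,t)\<in>D \<theta> \<times> {1..n}. int (t * card (level L b \<sigma> \<tau> t))) \<le> (\<Sum>e\<in>crossing b \<sigma>. depth b e)"
    if \<theta>: "\<theta> = 1 \<or> \<theta> = -1" for \<theta>
  proof -
    have Dd: "\<tau> \<in> dirs k" if "\<tau> \<in> D \<theta>" for \<tau> using that \<theta> unfolding D_def dirs_def by auto
    define S where "S = (SIGMA z:D \<theta> \<times> {1..n}. level L b \<sigma> (fst z) (snd z))"
    have finD: "finite (D \<theta> \<times> {1..n})" unfolding D_def by simp
    have fl: "finite (level L b \<sigma> (fst z) (snd z))" if "z \<in> D \<theta> \<times> {1..n}" for z
    proof -
      have "fst z \<in> D \<theta>" "1 \<le> snd z" using that by auto
      then show ?thesis by (intro finite_level[OF fin Dd])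
    qed
    have inS: "\<tau> \<in> dirs k \<and> 1 \<le> t \<and> t \<le> x \<and> uedge b \<tau> x t \<in> \<sigma>" if "((\<tau>,t),x) \<in> S" for \<tau> t x
      using that Dd unfolding S_def level_def by auto
    define u where "u = (\<lambda>((\<tau>,t),x). uedge b \<tau> x t)"
    have inj: "inj_on u S"
    proof (rule inj_onI)
      fix z z' assume z: "z \<in> S" "z' \<in> S" and eq: "u z = u z'"
      obtain j \<eta> t x where zz: "z = (((j,\<eta>,\<theta>),t),x)" using z(1) unfolding S_def D_def by auto
      obtain j' \<eta>' t' x' where zz': "z' = (((j',\<eta>',\<theta>),t'),x')" using z(2) unfolding S_def D_def by auto
      have "1 \<le> t" "t \<le> x" "1 \<le> t'" "t' \<le> x'"
        using inS[of "(j,\<eta>,\<theta>)" t x] inS[of "(j',\<eta>',\<theta>)" t' x'] z unfolding zz zz' by auto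
      moreover have "uedge b (j,\<eta>,\<theta>) x t = uedge b (j',\<eta>',\<theta>) x' t'" using eq unfolding zz zz' u_def by simp
      ultimately have "(j,\<eta>,\<theta>) = (j',\<eta>',\<theta>) \<and> x = x' \<and> t = t'"
        using uedge_inj[OF refl refl \<theta>, of x x' t t' b j \<eta> j' \<eta>'] by linarith
      then show "z = z'" using zz zz' by simp
    qed
    have "(\<Sum>(\<tau>,t)\<in>D \<theta> \<times> {1..n}. int (t * card (level L b \<sigma> \<tau> t))) = (\<Sum>z\<in>D \<theta> \<times> {1..n}. \<Sum>x\<in>level L b \<sigma> (fst z) (snd z). int (snd z))"
      by (rule sum.cong) (auto simp: mult.commute)
    also have "\<dots> = (\<Sum>(z,x)\<in>S. int (snd z))"
      unfolding S_def using sum.Sigma[OF finD, of "\<lambda>z. level L b \<sigma> (fst z) (snd z)" "\<lambda>z x. int (snd z)"] fl by blast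
    also have "\<dots> = (\<Sum>z\<in>S. depth b (u z))"
    proof (rule sum.cong[OF refl])
      fix z assume "z \<in> S"
      obtain \<tau> t x where z: "z = ((\<tau>,t),x)" by (metis surj_pair)
      show "(case z of (z,x) \<Rightarrow> int (snd z)) = depth b (u z)"
        using inS[of \<tau> t x] uedge_crosses(2)[of \<tau> k t x b] \<open>z \<in> S\<close> unfolding z u_def by simp
    qed
    also have "\<dots> = (\<Sum>e\<in>u ` S. depth b e)"
      unfolding sum.reindex[OF inj] by simp
    also have "\<dots> \<le> (\<Sum>e\<in>crossing b \<sigma>. depth b e)"
    proof (rule sum_mono2)
      show "finite (crossing b \<sigma>)" using fin unfolding crossing_def by simp
      show "u ` S \<subseteq> crossing b \<sigma>"
      proof
        fix e assume "e \<in> u ` S"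
        then obtain \<tau> t x where "((\<tau>,t),x) \<in> S" "e = uedge b \<tau> x t" unfolding u_def by auto
        then show "e \<in> crossing b \<sigma>"
          using inS[of \<tau> t x] uedge_crosses(1)[of \<tau> k t x b] unfolding crossing_def by simp
      qed
      show "0 \<le> depth b e" if "e \<in> crossing b \<sigma> - u ` S" for e
        using that unfolding crossing_def crosses_def depth_def by auto
    qed
    finally show ?thesis .
  qed
  have finD: "finite (D \<theta> \<times> {1..n})" for \<theta> unfolding D_def by simp
  have "(\<Sum>(\<tau>,t)\<in>dirs k \<times> {1..n}. int (t * card (level L b \<sigma> \<tau> t)))
     = (\<Sum>(\<tau>,t)\<in>D 1 \<times> {1..n}. int (t * card (level L b \<sigma> \<tau> t))) + (\<Sum>(\<tau>,t)\<in>D (-1) \<times> {1..n}. int (t * card (level L b \<sigma> \<tau> t)))"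
    unfolding dirs(1) Sigma_Un_distrib1 using dirs(2) finD by (intro sum.union_disjoint) auto
  then show ?thesis using one[of 1] one[of "-1"] by simp
qed

text \<open>At a column that is not bad a long crossing edge has height below 2, and primitivity
  excludes 0. The direction is chosen so that row \<open>j\<close> contains the farther end.\<close>

lemma crossing_high_uedge:
  assumes tri: "triangulation n k \<sigma>" and nb: "\<not> bad L b \<sigma>" and e: "e \<in> \<sigma>" "crosses b e" "int L \<le> ext e"
  shows "\<exists>\<tau>\<in>dirs k. \<exists>t x. 1 \<le> t \<and> x \<in> level L b \<sigma> \<tau> t \<and> e = uedge b \<tau> x t"
proof -
  obtain p q where pq: "e = {p,q}" "fst p < b" "b < fst q" by (rule crosses_obtain[OF tri_valid[OF tri e(1)] e(2)])
  note E = tri_edge[OF tri e(1)[unfolded pq(1)]]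
  have "ht e < 2" using nb e unfolding bad_def by auto
  moreover have "snd p \<noteq> snd q"
  proof
    assume "snd p = snd q"
    then have "is_unit (fst q - fst p)" using E(4) by simp
    then show False using pq by auto
  qed
  ultimately have h: "snd q = snd p + 1 \<or> snd q = snd p - 1" unfolding pq(1) by auto
  have rows: "0 \<le> snd p" "snd p \<le> int k" "0 \<le> snd q" "snd q \<le> int k" using E unfolding Lam0_iff by auto
  define x where "x = nat (b - fst p)"
  define y where "y = nat (fst q - b)"
  have xy: "int x = b - fst p" "int y = fst q - b" "1 \<le> x" "1 \<le> y" unfolding x_def y_def using pq by auto
  have Lxy: "L \<le> x + y" using e(3) xy unfolding pq(1) by simp
  show ?thesis
  proof (cases "y \<le> x")
    case True
    define \<tau> where "\<tau> = (snd p, snd q - snd p, 1::int)"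
    have "\<tau> \<in> dirs k" unfolding \<tau>_def dirs_def using h rows by auto
    moreover have "e = uedge b \<tau> x y" unfolding pq(1) uedge_def \<tau>_def using xy by (simp add: prod_eq_iff)
    moreover from this have "x \<in> level L b \<sigma> \<tau> y" using True Lxy e(1) unfolding level_def by simp
    ultimately show ?thesis using xy(4) by blast
  next
    case False
    define \<tau> where "\<tau> = (snd q, snd p - snd q, -1::int)"
    have "\<tau> \<in> dirs k" unfolding \<tau>_def dirs_def using h rows by auto
    moreover have "e = uedge b \<tau> y x" unfolding pq(1) uedge_def \<tau>_def using xy by (auto simp: prod_eq_iff insert_commute)
    moreover from this have "y \<in> level L b \<sigma> \<tau> x" using False Lxy e(1) unfolding level_def by simp
    ultimately show ?thesis using xy(3) by blast
  qed
qed

text \<open>The first factor bounds the number of sets of short crossing edges, which after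
  translation live in a fixed window; the second holds one partition generating function for each
  direction. Neither depends on \<open>n\<close>.\<close>

definition Bc :: "nat \<Rightarrow> real \<Rightarrow> nat \<Rightarrow> real" where
  "Bc k lam L = real (card (Pow (Pow ({- int L..int L} \<times> {0..int k})))) * exp (1 / (1 - lam)\<^sup>2) ^ card (dirs k)"

lemma Bc_ge_1: "lam < 1 \<Longrightarrow> 1 \<le> Bc k lam L"
proof -
  have "card (Pow (Pow ({- int L..int L} \<times> {0..int k}))) \<ge> 1" by (simp add: card_Pow)
  then have "1 \<le> real (card (Pow (Pow ({- int L..int L} \<times> {0..int k}))))" by linarith
  moreover have "1 \<le> exp (1 / (1 - lam)\<^sup>2) ^ card (dirs k)" by (intro one_le_power) simp
  ultimately show ?thesis unfolding Bc_def using mult_mono[of 1 _ 1] by fastforce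
qed

context free_columns
begin

text \<open>The weight of a crossing set is at most the product of \<open>lam ^ (t * N)\<close> over
  directions and near distances \<open>t\<close>, with \<open>N\<close> the level size. Short edges
  and level sizes determine the set, and the sum over all possible sizes factors into geometric
  series.\<close>

theorem crossing_count:
  assumes b: "b \<in> G"
  shows "(\<Sum>X\<in>crossing b ` {\<sigma>\<in>\<Omega>. \<not> bad L b \<sigma>}. lam powr (\<Sum>e\<in>X. real_of_int (2 * depth b e))) \<le> Bc k lam L"
proof -
  define \<X> where "\<X> = crossing b ` {\<sigma>\<in>\<Omega>. \<not> bad L b \<sigma>}"
  define J where "J = dirs k \<times> {1..n}"
  \<comment> \<open>Moving the column to abscissa 0 makes the range of the short edges independent
    of \<open>b\<close>.\<close>
  define tr where "tr e = (\<lambda>z. (fst z - b, snd z)) ` e" for e :: "(int \<times> int) set"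
  define short where "short X = tr ` {e\<in>X. ext e < int L}" for X :: "(int \<times> int) set set"
  define cnt where "cnt X = restrict (\<lambda>(\<tau>,t). card (level L b X \<tau> t)) J" for X
  define Sm where "Sm = Pow (Pow ({- int L..int L} \<times> {0..int k}))"
  define g where "g N = (\<Prod>z\<in>J. lam ^ (snd z * N z))" for N :: "(int \<times> int \<times> int) \<times> nat \<Rightarrow> nat"
  have finJ: "finite J" unfolding J_def dirs_def by simp
  have finX: "finite \<X>" unfolding \<X>_def using finite_Omega[of n k \<xi>] by simp
  have br: "\<bar>2 * b\<bar> \<le> int n" by (rule G_range[OF b])
  have tr_inj: "inj tr"
  proof -
    have "inj (\<lambda>z::int \<times> int. (fst z - b, snd z))" by (auto simp: inj_on_def prod_eq_iff)
    then show ?thesis unfolding tr_def by (metis (no_types, lifting) inj_def inj_image_eq_iff)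
  qed
  have XE: "\<exists>\<sigma>. \<sigma> \<in> \<Omega> \<and> \<not> bad L b \<sigma> \<and> X = crossing b \<sigma>" if "X \<in> \<X>" for X using that unfolding \<X>_def by auto
  have lvl: "level L b (crossing b \<sigma>) \<tau> t = level L b \<sigma> \<tau> t" if "\<tau> \<in> dirs k" "1 \<le> t" for \<sigma> \<tau> t
    by (rule level_crossing[OF that])
  have bound: "lam powr (\<Sum>e\<in>X. real_of_int (2 * depth b e)) \<le> g (cnt X)" if X: "X \<in> \<X>" for X
  proof -
    obtain \<sigma> where \<sigma>: "\<sigma> \<in> \<Omega>" "X = crossing b \<sigma>" using XE[OF X] by blast
    have "(\<Sum>z\<in>J. snd z * cnt X z) = (\<Sum>(\<tau>,t)\<in>J. t * card (level L b \<sigma> \<tau> t))"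
      unfolding cnt_def \<sigma>(2) by (rule sum.cong) (auto simp: J_def lvl)
    then have "int (\<Sum>z\<in>J. snd z * cnt X z) = (\<Sum>(\<tau>,t)\<in>J. int (t * card (level L b \<sigma> \<tau> t)))"
      by (simp add: case_prod_beta)
    also have "\<dots> \<le> 2 * (\<Sum>e\<in>X. depth b e)"
      unfolding J_def \<sigma>(2) by (rule depth_sum[OF Omega_tri[OF \<sigma>(1)] br])
    finally have "int (\<Sum>z\<in>J. snd z * cnt X z) \<le> (\<Sum>e\<in>X. 2 * depth b e)" by (simp add: sum_distrib_left)
    then have "real_of_int (int (\<Sum>z\<in>J. snd z * cnt X z)) \<le> real_of_int (\<Sum>e\<in>X. 2 * depth b e)"
      by (simp only: of_int_le_iff)
    then have "real (\<Sum>z\<in>J. snd z * cnt X z) \<le> (\<Sum>e\<in>X. real_of_int (2 * depth b e))" by simp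
    then have "lam powr (\<Sum>e\<in>X. real_of_int (2 * depth b e)) \<le> lam powr (real (\<Sum>z\<in>J. snd z * cnt X z))"
      using lam by (intro powr_mono') auto
    also have "\<dots> = lam ^ (\<Sum>z\<in>J. snd z * cnt X z)" using lam by (intro powr_realpow)
    also have "\<dots> = g (cnt X)" unfolding g_def by (rule power_sum)
    finally show ?thesis .
  qed
  have target: "(short X, cnt X) \<in> Sm \<times> (J \<rightarrow>\<^sub>E {0..n})" if X: "X \<in> \<X>" for X
  proof -
    obtain \<sigma> where \<sigma>: "\<sigma> \<in> \<Omega>" "X = crossing b \<sigma>" using XE[OF X] by blast
    have tri: "triangulation n k \<sigma>" by (rule Omega_tri[OF \<sigma>(1)])
    have "short X \<in> Sm"
      unfolding Sm_def short_def
    proof (rule PowI, rule subsetI)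
      fix f assume "f \<in> tr ` {e \<in> X. ext e < int L}"
      then obtain e where e: "f = tr e" "e \<in> \<sigma>" "crosses b e" "ext e < int L" unfolding \<sigma>(2) crossing_def by auto
      obtain p q where pq: "e = {p,q}" "fst p < b" "b < fst q" by (rule crosses_obtain[OF tri_valid[OF tri e(2)] e(3)])
      have "p \<in> Lam0 n k" "q \<in> Lam0 n k" using tri_edge[OF tri] e(2) unfolding pq(1) by blast+
      then show "f \<in> Pow ({- int L..int L} \<times> {0..int k})"
        using e(4) pq(2,3) unfolding e(1) tr_def pq(1) Lam0_iff by auto
    qed
    moreover have "cnt X \<in> J \<rightarrow>\<^sub>E {0..n}"
    proof -
      have "card (level L b X \<tau> t) \<le> n" if "\<tau> \<in> dirs k" "1 \<le> t" for \<tau> t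
      proof -
        have "level L b \<sigma> \<tau> t \<subseteq> {1..n}" using level_bound[OF tri that(1) br that(2)] by auto
        then have "card (level L b \<sigma> \<tau> t) \<le> card {1..n}" by (intro card_mono) auto
        then show ?thesis unfolding \<sigma>(2) lvl[OF that] by simp
      qed
      then show ?thesis unfolding cnt_def J_def by auto
    qed
    ultimately show ?thesis by simp
  qed
  have inj: "inj_on (\<lambda>X. (short X, cnt X)) \<X>"
  proof -
    have sub: "X \<subseteq> X'" if X: "X \<in> \<X>" "X' \<in> \<X>" and eq: "short X = short X'" "cnt X = cnt X'" for X X'
    proof
      fix e assume e: "e \<in> X"
      obtain \<sigma> where \<sigma>: "\<sigma> \<in> \<Omega>" "X = crossing b \<sigma>" "\<not> bad L b \<sigma>" using XE[OF X(1)] by blast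
      obtain \<sigma>' where \<sigma>': "\<sigma>' \<in> \<Omega>" "X' = crossing b \<sigma>'" "\<not> bad L b \<sigma>'" using XE[OF X(2)] by blast
      note tri = Omega_tri[OF \<sigma>(1)]
      note tri' = Omega_tri[OF \<sigma>'(1)]
      have es: "e \<in> \<sigma>" "crosses b e" using e unfolding \<sigma>(2) crossing_def by auto
      show "e \<in> X'"
      proof (cases "ext e < int L")
        case True
        then have "tr e \<in> short X" using e unfolding short_def by (intro imageI) simp
        then have "tr e \<in> short X'" using eq(1) by simp
        then obtain e' where e': "e' \<in> X'" "tr e = tr e'" unfolding short_def by blast
        have "e = e'" by (rule injD[OF tr_inj e'(2)])
        then show ?thesis using e'(1) by simp
      next
        case False
        obtain \<tau> t x where u: "\<tau> \<in> dirs k" "1 \<le> t" "x \<in> level L b \<sigma> \<tau> t" "e = uedge b \<tau> x t"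
          using crossing_high_uedge[OF tri \<sigma>(3) es] False by auto
        have "level L b \<sigma> \<tau> t = level L b \<sigma>' \<tau> t"
        proof (rule level_eqI[OF tri \<sigma>(3) tri' \<sigma>'(3) u(1) _ _ _ u(2), where T = n])
          fix s assume s: "1 \<le> s" "s \<le> n"
          then have "(\<tau>,s) \<in> J" using u(1) unfolding J_def by simp
          then have "card (level L b X \<tau> s) = card (level L b X' \<tau> s)" using fun_cong[OF eq(2), of "(\<tau>,s)"] unfolding cnt_def by simp
          then show "card (level L b \<sigma> \<tau> s) = card (level L b \<sigma>' \<tau> s)" unfolding \<sigma>(2) \<sigma>'(2) lvl[OF u(1) s(1)] .
        next
          fix s assume s: "n < s"
          then have s1: "1 \<le> s" by simp
          show "level L b \<sigma> \<tau> s = {}" using level_bound(1)[OF tri u(1) br s1] s by fastforce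
          show "level L b \<sigma>' \<tau> s = {}" using level_bound(1)[OF tri' u(1) br s1] s by fastforce
        qed
        then have "e \<in> \<sigma>'" using u(3,4) unfolding level_def by auto
        then show ?thesis using es(2) unfolding \<sigma>'(2) crossing_def by simp
      qed
    qed
    show ?thesis
    proof (rule inj_onI)
      fix X X' assume "X \<in> \<X>" "X' \<in> \<X>" "(short X, cnt X) = (short X', cnt X')"
      then show "X = X'" using sub[of X X'] sub[of X' X] by auto
    qed
  qed
  have g0: "0 \<le> g N" for N unfolding g_def using lam by (intro prod_nonneg) auto
  have "(\<Sum>X\<in>\<X>. lam powr (\<Sum>e\<in>X. real_of_int (2 * depth b e))) \<le> (\<Sum>X\<in>\<X>. g (cnt X))"
    by (rule sum_mono[OF bound])
  also have "\<dots> = (\<Sum>z\<in>(\<lambda>X. (short X, cnt X)) ` \<X>. g (snd z))" unfolding sum.reindex[OF inj] by simp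
  also have "\<dots> \<le> (\<Sum>z\<in>Sm \<times> (J \<rightarrow>\<^sub>E {0..n}). g (snd z))"
  proof (rule sum_mono2)
    show "finite (Sm \<times> (J \<rightarrow>\<^sub>E {0..n}))" unfolding Sm_def using finJ by (intro finite_cartesian_product finite_PiE) auto
    show "(\<lambda>X. (short X, cnt X)) ` \<X> \<subseteq> Sm \<times> (J \<rightarrow>\<^sub>E {0..n})" using target by blast
  qed (rule g0)
  also have "\<dots> = real (card Sm) * (\<Sum>N\<in>J \<rightarrow>\<^sub>E {0..n}. g N)"
    by (simp add: sum.cartesian_product')
  also have "(\<Sum>N\<in>J \<rightarrow>\<^sub>E {0..n}. g N) = (\<Prod>z\<in>J. \<Sum>m\<in>{0..n}. lam ^ (snd z * m))"
    unfolding g_def by (rule prod_sum_PiE[symmetric, OF finJ]) auto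
  also have "\<dots> \<le> (\<Prod>z\<in>J. 1 / (1 - lam ^ snd z))"
  proof (rule prod_mono)
    fix z assume z: "z \<in> J"
    have "lam ^ snd z < 1" "0 < lam ^ snd z" using z lam unfolding J_def by (auto intro!: power_Suc_less_one simp: power_less_one_iff)
    then show "0 \<le> (\<Sum>m\<in>{0..n}. lam ^ (snd z * m)) \<and> (\<Sum>m\<in>{0..n}. lam ^ (snd z * m)) \<le> 1 / (1 - lam ^ snd z)"
      unfolding power_mult using geometric_bound[of "lam ^ snd z" "{0..n}"] by (auto intro!: sum_nonneg)
  qed
  also have "\<dots> = (\<Prod>\<tau>\<in>dirs k. \<Prod>t\<in>{1..n}. 1 / (1 - lam ^ t))"
    unfolding J_def by (subst prod.cartesian_product) (simp add: case_prod_beta)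
  also have "\<dots> \<le> (\<Prod>\<tau>\<in>dirs k. exp (1 / (1 - lam)\<^sup>2))"
  proof (rule prod_mono)
    fix \<tau>
    have "0 \<le> (\<Prod>t\<in>{1..n}. 1 / (1 - lam ^ t))"
      using lam by (intro prod_nonneg) (auto intro!: divide_nonneg_nonneg power_le_one)
    then show "0 \<le> (\<Prod>t\<in>{1..n}. 1 / (1 - lam ^ t)) \<and> (\<Prod>t\<in>{1..n}. 1 / (1 - lam ^ t)) \<le> exp (1 / (1 - lam)\<^sup>2)"
      using euler_product_bound[OF lam, of "{1..n}"] by auto
  qed
  also have "\<dots> = exp (1 / (1 - lam)\<^sup>2) ^ card (dirs k)" by simp
  finally show ?thesis unfolding Bc_def Sm_def \<X>_def by (simp add: mult_left_mono)
qed

end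

section \<open>Weighted status of a family of columns\<close>

context free_columns
begin

text \<open>The values are balanced so that multiplying by one more factor does not increase the mean, given that a column
  which is not \<open>bad\<close> is at most \<open>Bc\<close> times more likely to be uncrossed than crossed.\<close>
definition stat :: "nat \<Rightarrow> int \<Rightarrow> (int \<times> int) set set \<Rightarrow> real" where
  "stat L b \<sigma> = (if bad L b \<sigma> then 1 else if vcrossing k \<sigma> b then 1 / 2 else 1 + 1 / (2 * Bc k lam L))"

lemma stat_pos: "0 < stat L b \<sigma>"
  using Bc_ge_1[OF lam(2), of k L] unfolding stat_def by (auto intro!: add_pos_nonneg)

text \<open>As \<open>f\<close> keeps the midpoint and does not straddle \<open>b\<close>, its
  extent is at most twice the distance of the midpoint from the column, which is
  \<open>ext e - 2 * depth b e\<close>. A vertical \<open>f\<close> in column \<open>a\<close> gives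
  up this remainder too, and there it equals \<open>2 * \<bar>a - b\<bar>\<close>.\<close>

lemma cut_depth:
  assumes e: "valid_edge n k e" "crosses b e" and f: "valid_edge n k f" "\<not> crosses b f" "mid f = mid e"
  shows "2 * depth b e \<le> ext e - ext f"
    and "f = {(a,j),(a,j+1)} \<Longrightarrow> 2 * depth b e + 2 * \<bar>a - b\<bar> \<le> ext e - ext f"
proof -
  obtain p q where pq: "e = {p,q}" "fst p < b" "b < fst q" by (rule crosses_obtain[OF e])
  obtain r s where rs: "f = {r,s}" "r \<noteq> s" by (rule valid_edgeE[OF f(1)])
  have "p \<noteq> q" using pq by auto
  then have m: "fst r + fst s = fst p + fst q" using f(3) unfolding rs(1) pq(1) mid_pair[OF rs(2)] mid_pair[OF \<open>p \<noteq> q\<close>]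
    by (metis fst_add)
  have d: "depth b e = min (b - fst p) (fst q - b)" unfolding pq(1) by (rule depth_pair[OF pq(2,3)])
  have x: "ext e = fst q - fst p" using pq by simp
  have nc: "\<not> (fst r < b \<and> b < fst s)" "\<not> (fst s < b \<and> b < fst r)" using f(2) unfolding rs(1) by auto
  have "ext f \<le> \<bar>fst p + fst q - 2 * b\<bar>" unfolding rs(1) ext_pair using nc m by linarith
  moreover have "ext e - 2 * depth b e = \<bar>fst p + fst q - 2 * b\<bar>" unfolding d x using pq by (auto simp: min_def)
  ultimately show "2 * depth b e \<le> ext e - ext f" by linarith
  assume "f = {(a,j),(a,j+1)}"
  then have "ext f = 0" "mid f = (2 * a, 2 * j + 1)" by (auto simp: mid_pair)
  then have "fst p + fst q = 2 * a" using f(3) unfolding pq(1) mid_pair[OF \<open>p \<noteq> q\<close>] by (metis fst_add fst_conv)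
  then show "2 * depth b e + 2 * \<bar>a - b\<bar> \<le> ext e - ext f"
    unfolding \<open>ext f = 0\<close> d x using pq by (auto simp: min_def abs_if)
qed

text \<open>If the cut at \<open>b\<close> also turns column \<open>a\<close> into a crossing, then an edge with its midpoint in column \<open>a\<close> that reached
  beyond \<open>b\<close> has become vertical; its shortening pays for the factor at most 4 by which the status of \<open>a\<close> drops.\<close>
lemma cut_map:
  assumes b: "b \<in> G" and A: "finite A" and \<Delta>: "\<And>a. a \<in> A \<Longrightarrow> int \<Delta> \<le> \<bar>a - b\<bar>" "4 * lam powr (2 * real \<Delta>) \<le> 1"
    and \<sigma>: "\<sigma> \<in> \<Omega>" and nb: "\<not> bad L b \<sigma>"
  shows "\<exists>\<sigma>'\<in>\<Omega>. \<not> bad L b \<sigma>' \<and> vcrossing k \<sigma>' b \<and>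
    \<sigma> = {e\<in>\<sigma>'. \<forall>x\<in>crossing b \<sigma>. oseg e \<inter> oseg x = {}} \<union> crossing b \<sigma> \<and>
    weight lam \<sigma> * (\<Prod>a\<in>A. stat L a \<sigma>)
      \<le> lam powr (\<Sum>e\<in>crossing b \<sigma>. real_of_int (2 * depth b e)) * (weight lam \<sigma>' * (\<Prod>a\<in>A. stat L a \<sigma>'))"
proof -
  obtain \<sigma>' \<phi> where \<sigma>': "\<sigma>' \<in> \<Omega>" and bij: "bij_betw \<phi> \<sigma> \<sigma>'" and nc: "\<And>e. e\<in>\<sigma>' \<Longrightarrow> \<not> crosses b e"
    and \<phi>: "\<And>e. e\<in>\<sigma> \<Longrightarrow> mid (\<phi> e) = mid e \<and> ext (\<phi> e) \<le> ext e \<and> ht (\<phi> e) \<le> ht e \<and> (\<not> crosses b e \<longrightarrow> \<phi> e = e)"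
    using cut_column[OF free[OF b] \<sigma>] by meson
  have tri: "triangulation n k \<sigma>" and tri': "triangulation n k \<sigma>'" using Omega_tri \<sigma> \<sigma>' by auto
  have conf: "edge_config n k \<sigma>" "edge_config n k \<sigma>'" using tri tri' unfolding triangulation_def by auto
  have disj: "oseg e \<inter> oseg e' = {}" if "edge_config n k E" "e \<in> E" "e' \<in> E" "e \<noteq> e'" for E e e'
    using that unfolding edge_config_def by simp
  define X where "X = crossing b \<sigma>"
  have X: "X \<subseteq> \<sigma>" "\<And>e. e \<in> X \<Longrightarrow> crosses b e" unfolding X_def crossing_def by auto
  have keep: "e \<in> \<sigma>'" if "e \<in> \<sigma>" "\<not> crosses b e" for e
  proof -
    have "\<phi> e \<in> \<sigma>'" using bij that(1) unfolding bij_betw_def by blast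
    then show ?thesis using \<phi>[OF that(1)] that(2) by simp
  qed
  have orig: "\<exists>e\<in>\<sigma>. \<phi> e = f" if "f \<in> \<sigma>'" for f using bij that unfolding bij_betw_def by blast
  have fromX: "\<exists>e\<in>X. \<phi> e = f" if f: "f \<in> \<sigma>'" "f \<notin> \<sigma>" for f
  proof -
    obtain e where e: "e \<in> \<sigma>" "\<phi> e = f" using orig[OF f(1)] by blast
    then have "crosses b e" using \<phi>[OF e(1)] f(2) by auto
    then show ?thesis using e unfolding X_def crossing_def by auto
  qed
  \<comment> \<open>The cut alters only edges across \<open>b\<close>, none of which is long with
    height at least 2, and it enlarges neither extent nor height; so it neither creates nor destroys
    an edge that makes a column bad.\<close>
  have bad_iff: "bad L a \<sigma>' \<longleftrightarrow> bad L a \<sigma>" for a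
  proof
    assume "bad L a \<sigma>"
    then obtain e where e: "e \<in> \<sigma>" "crosses a e" "int L \<le> ext e" "2 \<le> ht e" unfolding bad_def by blast
    have "\<not> crosses b e" using nb e unfolding bad_def by blast
    then show "bad L a \<sigma>'" using keep e unfolding bad_def by blast
  next
    assume "bad L a \<sigma>'"
    then obtain f where f: "f \<in> \<sigma>'" "crosses a f" "int L \<le> ext f" "2 \<le> ht f" unfolding bad_def by blast
    obtain e where e: "e \<in> \<sigma>" "\<phi> e = f" using orig[OF f(1)] by blast
    have "int L \<le> ext e" "2 \<le> ht e" using \<phi>[OF e(1)] f e(2) by auto
    then have "\<not> crosses b e" using nb e(1) unfolding bad_def by blast
    then have "e = f" using \<phi>[OF e(1)] e(2) by simp
    then show "bad L a \<sigma>" using e(1) f unfolding bad_def by blast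
  qed
  have vc_keep: "vcrossing k \<sigma>' a" if "vcrossing k \<sigma> a" for a
    using that keep unfolding vcrossing_def by simp
  \<comment> \<open>The edges of \<sigma> outside \<open>X\<close> survive the cut. An edge of
    \<sigma>' disjoint from \<open>X\<close> thus meets no other edge of \<sigma> and belongs to it
    by maximality, so \<sigma>' and \<open>X\<close> determine \<sigma>.\<close>
  have recover: "\<sigma> = {e\<in>\<sigma>'. \<forall>x\<in>X. oseg e \<inter> oseg x = {}} \<union> X"
  proof (intro equalityI subsetI)
    fix e assume e: "e \<in> \<sigma>"
    show "e \<in> {e\<in>\<sigma>'. \<forall>x\<in>X. oseg e \<inter> oseg x = {}} \<union> X"
    proof (cases "crosses b e")
      case True then show ?thesis using e unfolding X_def crossing_def by simp
    next
      case False
      have "oseg e \<inter> oseg x = {}" if "x \<in> X" for x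
        by (rule disj[OF conf(1) e]) (use X that False in auto)
      then show ?thesis using keep[OF e False] by simp
    qed
  next
    fix e assume e0: "e \<in> {e\<in>\<sigma>'. \<forall>x\<in>X. oseg e \<inter> oseg x = {}} \<union> X"
    show "e \<in> \<sigma>"
    proof (cases "e \<in> X")
      case True then show ?thesis using X by blast
    next
      case False
      then have e: "e \<in> \<sigma>'" "\<And>x. x \<in> X \<Longrightarrow> oseg e \<inter> oseg x = {}" using e0 by auto
      obtain g h where gh: "e = {g,h}" "g \<noteq> h" by (rule valid_edgeE[OF tri_valid[OF tri' e(1)]])
      have "{g,h} \<in> \<sigma>"
      proof (rule tri_memI[OF tri])
        show "valid_edge n k {g,h}" using tri_valid[OF tri' e(1)] unfolding gh(1) .
        fix r s assume rs: "{r,s} \<in> \<sigma>" "{r,s} \<noteq> {g,h}"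
        have "oseg e \<inter> oseg {r,s} = {}"
        proof (cases "crosses b {r,s}")
          case True then show ?thesis using e(2) rs(1) unfolding X_def crossing_def by blast
        next
          case False
          show ?thesis by (rule disj[OF conf(2) e(1) keep[OF rs(1) False]]) (use rs gh in simp)
        qed
        then show "\<not> meet g h r s" using oseg_meet[OF gh(2) tri_edge(1)[OF tri rs(1)]] unfolding gh(1) by simp
      qed
      then show ?thesis using gh(1) by simp
    qed
  qed
  define K where "K = {a\<in>A. \<not> bad L a \<sigma> \<and> \<not> vcrossing k \<sigma> a \<and> vcrossing k \<sigma>' a}"
  have finK: "finite K" unfolding K_def using A by simp
  have "\<exists>e\<in>X. \<exists>j. \<phi> e = {(a,j),(a,j+1)}" if "a \<in> K" for a
  proof -
    have "\<not> vcrossing k \<sigma> a" "vcrossing k \<sigma>' a" using that unfolding K_def by auto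
    then obtain j :: int where "{(a,j),(a,j+1)} \<notin> \<sigma>" "{(a,j),(a,j+1)} \<in> \<sigma>'" unfolding vcrossing_def by blast
    then show ?thesis using fromX by blast
  qed
  then obtain E where E: "\<And>a. a \<in> K \<Longrightarrow> E a \<in> X" "\<And>a. a \<in> K \<Longrightarrow> \<exists>j. \<phi> (E a) = {(a,j),(a,j+1)}" by metis
  have injE: "inj_on E K"
  proof (rule inj_onI)
    fix a a' assume a: "a \<in> K" "a' \<in> K" "E a = E a'"
    obtain j j' where "\<phi> (E a) = {(a,j),(a,j+1)}" "\<phi> (E a') = {(a',j'),(a',j'+1)}" using E(2)[OF a(1)] E(2)[OF a(2)] by blast
    then have "{(a,j),(a,j+1)} = {(a',j'),(a',j'+1)}" using a(3) by simp
    then show "a = a'" by (auto simp: doubleton_eq_iff)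
  qed
  \<comment> \<open>One edge for each column of \<open>K\<close> loses \<open>2 * \<Delta>\<close>
    beyond twice its depth, as its midpoint lies at distance at least \<Delta> from column
    \<open>b\<close>.\<close>
  define g where "g e = 2 * depth b e + (if e \<in> E ` K then 2 * int \<Delta> else 0)" for e
  have gain: "g e \<le> ext e - ext (\<phi> e)" if e: "e \<in> X" for e
  proof -
    have es: "e \<in> \<sigma>" "crosses b e" using X e by auto
    have f: "\<phi> e \<in> \<sigma>'" using bij es(1) unfolding bij_betw_def by blast
    have c: "valid_edge n k e" "crosses b e" "valid_edge n k (\<phi> e)" "\<not> crosses b (\<phi> e)" "mid (\<phi> e) = mid e"
      using tri_valid[OF tri es(1)] es(2) tri_valid[OF tri' f] nc[OF f] \<phi>[OF es(1)] by auto
    show ?thesis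
    proof (cases "e \<in> E ` K")
      case False then show ?thesis using cut_depth(1)[OF c] unfolding g_def by simp
    next
      case True
      then obtain a j where a: "a \<in> K" "\<phi> e = {(a,j),(a,j+1)}" using E(2) by blast
      have "int \<Delta> \<le> \<bar>a - b\<bar>" using \<Delta>(1) a(1) unfolding K_def by simp
      then show ?thesis using cut_depth(2)[OF c a(2)] True unfolding g_def by simp
    qed
  qed
  have finX: "finite X" using finite_subset[OF X(1) tri_finite[OF tri]] .
  have EX: "E ` K \<subseteq> X" using E(1) by blast
  have "(\<Sum>e\<in>X. real_of_int (g e)) = (\<Sum>e\<in>X. real_of_int (2 * depth b e)) + (\<Sum>e\<in>X. if e \<in> E ` K then 2 * real \<Delta> else 0)"
    unfolding sum.distrib[symmetric] g_def by (rule sum.cong) auto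
  also have "(\<Sum>e\<in>X. if e \<in> E ` K then 2 * real \<Delta> else 0) = (\<Sum>e\<in>E ` K. 2 * real \<Delta>)"
    using EX finX by (simp add: sum.If_cases Int_absorb1)
  also have "\<dots> = real (card K) * (2 * real \<Delta>)" by (simp add: card_image[OF injE])
  finally have gsum: "(\<Sum>e\<in>X. real_of_int (g e)) = (\<Sum>e\<in>X. real_of_int (2 * depth b e)) + real (card K) * (2 * real \<Delta>)" .
  have w: "weight lam \<sigma> \<le> lam powr (\<Sum>e\<in>X. real_of_int (2 * depth b e)) * (lam powr (2 * real \<Delta>)) ^ card K * weight lam \<sigma>'"
  proof -
    have "weight lam \<sigma> \<le> lam powr (\<Sum>e\<in>X. real_of_int (g e)) * weight lam \<sigma>'"
      by (rule weight_shrink[OF lam tri tri' bij _ _ X(1) gain]) (use \<phi> in auto)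
    moreover have "lam powr (real (card K) * (2 * real \<Delta>)) = (lam powr (2 * real \<Delta>)) ^ card K"
      using lam by (simp add: powr_realpow[symmetric] powr_powr mult.commute)
    ultimately show ?thesis unfolding gsum powr_add by simp
  qed
  have B1: "1 \<le> Bc k lam L" by (rule Bc_ge_1[OF lam(2)])
  have p: "(\<Prod>a\<in>A. stat L a \<sigma>) \<le> 4 ^ card K * (\<Prod>a\<in>A. stat L a \<sigma>')"
  proof -
    have "(\<Prod>a\<in>A. stat L a \<sigma>) \<le> (\<Prod>a\<in>A. (if a \<in> K then 4 else 1) * stat L a \<sigma>')"
    proof (rule prod_mono)
      fix a assume a: "a \<in> A"
      \<comment> \<open>The status changes only on \<open>K\<close>, where it drops from at most 2
        to \<open>1 / 2\<close>.\<close>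
      have q: "1 / (2 * Bc k lam L) \<le> 1" using B1 by simp
      have "stat L a \<sigma> \<le> (if a \<in> K then 4 else 1) * stat L a \<sigma>'"
        using q B1 a vc_keep[of a] unfolding stat_def bad_iff K_def by auto
      then show "0 \<le> stat L a \<sigma> \<and> stat L a \<sigma> \<le> (if a \<in> K then 4 else 1) * stat L a \<sigma>'"
        using stat_pos less_imp_le by blast
    qed
    also have "\<dots> = (\<Prod>a\<in>A. if a \<in> K then 4 else 1) * (\<Prod>a\<in>A. stat L a \<sigma>')" by (rule prod.distrib)
    also have "(\<Prod>a\<in>A. if a \<in> K then 4 else (1::real)) = 4 ^ card K"
    proof -
      have "A \<inter> K = K" unfolding K_def by blast
      then show ?thesis using A by (simp add: prod.If_cases)
    qed
    finally show ?thesis .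
  qed
  have P0: "0 \<le> (\<Prod>a\<in>A. stat L a \<tau>)" for \<tau> by (intro prod_nonneg) (simp add: stat_pos less_imp_le)
  define c where "c = lam powr (\<Sum>e\<in>X. real_of_int (2 * depth b e))"
  define d where "d = lam powr (2 * real \<Delta>)"
  have cd: "0 \<le> c" "0 \<le> d" "d * 4 \<le> 1" unfolding c_def d_def using \<Delta>(2) by auto
  have "weight lam \<sigma> * (\<Prod>a\<in>A. stat L a \<sigma>) \<le> (c * d ^ card K * weight lam \<sigma>') * (4 ^ card K * (\<Prod>a\<in>A. stat L a \<sigma>'))"
    using w p cd P0 w_nonneg unfolding c_def[symmetric] d_def[symmetric] by (intro mult_mono) auto
  also have "\<dots> = (d * 4) ^ card K * (c * (weight lam \<sigma>' * (\<Prod>a\<in>A. stat L a \<sigma>')))"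
    by (simp add: power_mult_distrib mult_ac)
  also have "\<dots> \<le> 1 * (c * (weight lam \<sigma>' * (\<Prod>a\<in>A. stat L a \<sigma>')))"
    using cd P0 w_nonneg by (intro mult_right_mono power_le_one mult_nonneg_nonneg) auto
  finally have wt: "weight lam \<sigma> * (\<Prod>a\<in>A. stat L a \<sigma>) \<le> c * (weight lam \<sigma>' * (\<Prod>a\<in>A. stat L a \<sigma>'))" by simp
  have vc: "vcrossing k \<sigma>' b" by (rule uncrossed_vcrossing[OF tri' G_range[OF b] nc])
  have nb': "\<not> bad L b \<sigma>'" using bad_iff nb by simp
  show ?thesis
    by (rule bexI[OF _ \<sigma>'], intro conjI)
      (rule nb', rule vc, rule recover[unfolded X_def], rule wt[unfolded c_def X_def])
qed

text \<open>Group the uncrossed triangulations by their crossing set. Within a group the cut is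
  injective, because the removed set is known, and all members gain the same factor;
  \<open>crossing_count\<close> sums these factors.\<close>

lemma uncrossed_sum:
  assumes b: "b \<in> G" and A: "finite A" and \<Delta>: "\<And>a. a \<in> A \<Longrightarrow> int \<Delta> \<le> \<bar>a - b\<bar>" "4 * lam powr (2 * real \<Delta>) \<le> 1"
  shows "(\<Sum>\<sigma>\<in>{\<sigma>\<in>\<Omega>. \<not> bad L b \<sigma> \<and> \<not> vcrossing k \<sigma> b}. weight lam \<sigma> * (\<Prod>a\<in>A. stat L a \<sigma>))
    \<le> Bc k lam L * (\<Sum>\<sigma>\<in>{\<sigma>\<in>\<Omega>. \<not> bad L b \<sigma> \<and> vcrossing k \<sigma> b}. weight lam \<sigma> * (\<Prod>a\<in>A. stat L a \<sigma>))"
    (is "sum ?h ?U \<le> _ * sum ?h ?V")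
proof -
  have finU: "finite ?U" and finV: "finite ?V" using finite_Omega[of n k \<xi>] by auto
  have h0: "0 \<le> ?h \<sigma>" for \<sigma> using w_nonneg stat_pos by (intro mult_nonneg_nonneg prod_nonneg) (auto simp: less_imp_le)
  let ?c = "\<lambda>X. lam powr (\<Sum>e\<in>X. real_of_int (2 * depth b e))"
  have "\<forall>\<sigma>\<in>?U. \<exists>\<sigma>'\<in>?V. \<sigma> = {e\<in>\<sigma>'. \<forall>x\<in>crossing b \<sigma>. oseg e \<inter> oseg x = {}} \<union> crossing b \<sigma> \<and> ?h \<sigma> \<le> ?c (crossing b \<sigma>) * ?h \<sigma>'"
  proof
    fix \<sigma> assume "\<sigma> \<in> ?U"
    then have "\<sigma> \<in> \<Omega>" "\<not> bad L b \<sigma>" by auto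
    from cut_map[OF b A \<Delta> this] show "\<exists>\<sigma>'\<in>?V. \<sigma> = {e\<in>\<sigma>'. \<forall>x\<in>crossing b \<sigma>. oseg e \<inter> oseg x = {}} \<union> crossing b \<sigma> \<and> ?h \<sigma> \<le> ?c (crossing b \<sigma>) * ?h \<sigma>'"
      by blast
  qed
  from bchoice[OF this[unfolded Bex_def]] obtain \<kappa>' where k0: "\<forall>\<sigma>\<in>?U. \<kappa>' \<sigma> \<in> ?V \<and>
    \<sigma> = {e\<in>\<kappa>' \<sigma>. \<forall>x\<in>crossing b \<sigma>. oseg e \<inter> oseg x = {}} \<union> crossing b \<sigma> \<and> ?h \<sigma> \<le> ?c (crossing b \<sigma>) * ?h (\<kappa>' \<sigma>)"
    by (rule exE)
  have \<kappa>': "\<kappa>' \<sigma> \<in> ?V" "\<sigma> = {e\<in>\<kappa>' \<sigma>. \<forall>x\<in>crossing b \<sigma>. oseg e \<inter> oseg x = {}} \<union> crossing b \<sigma>"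
    "?h \<sigma> \<le> ?c (crossing b \<sigma>) * ?h (\<kappa>' \<sigma>)" if "\<sigma> \<in> ?U" for \<sigma>
    by (rule bspec[OF k0 that, THEN conjunct1], rule bspec[OF k0 that, THEN conjunct2, THEN conjunct1],
        rule bspec[OF k0 that, THEN conjunct2, THEN conjunct2])
  have "sum ?h ?U = (\<Sum>X\<in>crossing b ` ?U. sum ?h {\<sigma>\<in>?U. crossing b \<sigma> = X})"
    by (rule sum.image_gen[OF finU])
  also have "\<dots> \<le> (\<Sum>X\<in>crossing b ` ?U. ?c X * sum ?h ?V)"
  proof (rule sum_mono)
    fix X
    let ?W = "{\<sigma>\<in>?U. crossing b \<sigma> = X}"
    have inj: "inj_on \<kappa>' ?W"
    proof (rule inj_onI)
      fix \<sigma> \<tau> assume "\<sigma> \<in> ?W" "\<tau> \<in> ?W" and eq: "\<kappa>' \<sigma> = \<kappa>' \<tau>"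
      then have s: "\<sigma> \<in> ?U" "crossing b \<sigma> = X" and t: "\<tau> \<in> ?U" "crossing b \<tau> = X" by auto
      show "\<sigma> = \<tau>" using \<kappa>'(2)[OF s(1)] \<kappa>'(2)[OF t(1)] unfolding s(2) t(2) eq by (rule trans[OF _ sym])
    qed
    have "sum ?h ?W \<le> (\<Sum>\<sigma>\<in>?W. ?c X * ?h (\<kappa>' \<sigma>))"
    proof (rule sum_mono)
      fix \<sigma> assume "\<sigma> \<in> ?W"
      then have "\<sigma> \<in> ?U" "crossing b \<sigma> = X" by auto
      then show "?h \<sigma> \<le> ?c X * ?h (\<kappa>' \<sigma>)" using \<kappa>'(3)[of \<sigma>] by simp
    qed
    also have "\<dots> = ?c X * sum ?h (\<kappa>' ` ?W)" unfolding sum.reindex[OF inj] by (simp only: sum_distrib_left comp_def)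
    also have "\<dots> \<le> ?c X * sum ?h ?V"
      using \<kappa>'(1) by (intro mult_left_mono sum_mono2 finV h0) auto
    finally show "sum ?h ?W \<le> ?c X * sum ?h ?V" .
  qed
  also have "\<dots> = (\<Sum>X\<in>crossing b ` ?U. ?c X) * sum ?h ?V" by (simp only: sum_distrib_right)
  also have "\<dots> \<le> Bc k lam L * sum ?h ?V"
  proof (rule mult_right_mono)
    have "(\<Sum>X\<in>crossing b ` ?U. ?c X) \<le> (\<Sum>X\<in>crossing b ` {\<sigma>\<in>\<Omega>. \<not> bad L b \<sigma>}. ?c X)"
      using finite_Omega[of n k \<xi>] by (intro sum_mono2) auto
    also have "\<dots> \<le> Bc k lam L" by (rule crossing_count[OF b])
    finally show "(\<Sum>X\<in>crossing b ` ?U. ?c X) \<le> Bc k lam L" .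
    show "0 \<le> sum ?h ?V" by (intro sum_nonneg h0)
  qed
  finally show ?thesis .
qed

text \<open>Induction over the columns: the status of \<open>b\<close> adds
  \<open>1 / (2 * Bc k lam L)\<close> times the uncrossed sum and subtracts half of the crossed one,
  where the other statuses are part of the weight.\<close>

lemma stat_product:
  assumes "finite A" "A \<subseteq> G" and sp: "\<And>a b. a \<in> A \<Longrightarrow> b \<in> A \<Longrightarrow> a \<noteq> b \<Longrightarrow> int \<Delta> \<le> \<bar>a - b\<bar>"
    and \<Delta>: "4 * lam powr (2 * real \<Delta>) \<le> 1"
  shows "(\<Sum>\<sigma>\<in>\<Omega>. weight lam \<sigma> * (\<Prod>a\<in>A. stat L a \<sigma>)) \<le> Z"
  using assms(1,2) sp
proof (induction A)
  case (insert b A)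
  let ?h = "\<lambda>\<sigma>. weight lam \<sigma> * (\<Prod>a\<in>A. stat L a \<sigma>)"
  let ?U = "{\<sigma>\<in>\<Omega>. \<not> bad L b \<sigma> \<and> \<not> vcrossing k \<sigma> b}"
  let ?V = "{\<sigma>\<in>\<Omega>. \<not> bad L b \<sigma> \<and> vcrossing k \<sigma> b}"
  have B1: "1 \<le> Bc k lam L" by (rule Bc_ge_1[OF lam(2)])
  define \<epsilon> where "\<epsilon> = 1 / (2 * Bc k lam L)"
  have UV: "sum ?h ?U \<le> Bc k lam L * sum ?h ?V"
    by (rule uncrossed_sum[OF _ insert.hyps(1) _ \<Delta>]) (use insert in auto)
  have "(\<Sum>\<sigma>\<in>\<Omega>. weight lam \<sigma> * (\<Prod>a\<in>insert b A. stat L a \<sigma>)) = (\<Sum>\<sigma>\<in>\<Omega>. ?h \<sigma> * stat L b \<sigma>)"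
    using insert.hyps by (simp add: mult_ac)
  also have "\<dots> = (\<Sum>\<sigma>\<in>\<Omega>. ?h \<sigma> + \<epsilon> * (if \<not> bad L b \<sigma> \<and> \<not> vcrossing k \<sigma> b then ?h \<sigma> else 0)
      - (if \<not> bad L b \<sigma> \<and> vcrossing k \<sigma> b then ?h \<sigma> else 0) / 2)"
    by (rule sum.cong) (auto simp: stat_def \<epsilon>_def algebra_simps)
  also have "\<dots> = sum ?h \<Omega> + \<epsilon> * sum ?h ?U - sum ?h ?V / 2"
    unfolding sum_subtractf sum.distrib sum_distrib_left[symmetric] sum_divide_distrib[symmetric]
    by (simp only: sum.inter_filter[OF finite_Omega])
  also have "\<dots> \<le> sum ?h \<Omega>"
  proof -
    have "\<epsilon> * sum ?h ?U \<le> \<epsilon> * (Bc k lam L * sum ?h ?V)" using UV B1 unfolding \<epsilon>_def by (intro mult_left_mono) auto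
    also have "\<dots> = sum ?h ?V / 2" using B1 unfolding \<epsilon>_def by simp
    finally show ?thesis by simp
  qed
  also have "\<dots> \<le> Z" using insert by auto
  finally show ?case .
qed simp

end

section \<open>The tail bound\<close>

text \<open>An edge across \<open>b\<close> is not horizontal, so it meets the column at a height
  strictly between 0 and \<open>k\<close>, inside the open rectangle.\<close>

lemma not_crosses_of_strip:
  assumes e: "valid_edge n k e" and b: "x0 < real_of_int b" "real_of_int b < x1"
    and d: "oseg e \<inter> ({x0<..<x1} \<times> {0<..<real k}) = {}"
  shows "\<not> crosses b e"
proof
  assume "crosses b e"
  then obtain p q where pq: "e = {p,q}" "fst p < b" "b < fst q" by (rule crosses_obtain[OF e])
  have E: "p \<in> Lam0 n k" "q \<in> Lam0 n k" "p \<noteq> q" "coprime (fst q - fst p) (snd q - snd p)"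
    using e unfolding pq(1) valid_edge_iff by auto
  have rows: "0 \<le> snd p" "snd p \<le> int k" "0 \<le> snd q" "snd q \<le> int k" using E unfolding Lam0_iff by auto
  have nh: "snd p \<noteq> snd q"
  proof
    assume "snd p = snd q"
    then have "is_unit (fst q - fst p)" using E(4) by simp
    then show False using pq by auto
  qed
  define u where "u = (real_of_int b - real_of_int (fst p)) / real_of_int (fst q - fst p)"
  have u: "0 < u" "u < 1" unfolding u_def using pq by (auto simp: field_simps)
  define y where "y = real_of_int (snd p) + u * real_of_int (snd q - snd p)"
  have y: "y = (1-u) * real_of_int (snd p) + u * real_of_int (snd q)" unfolding y_def by (simp add: algebra_simps)
  have bx: "real_of_int b = real_of_int (fst p) + u * real_of_int (fst q - fst p)"
    unfolding u_def using pq by simp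
  have "(real_of_int b, y) \<in> oseg e"
    unfolding pq(1) oseg_pair[OF E(3)] in_open_segment_pt[OF E(3)] using u bx y_def by (intro exI[of _ u]) simp
  moreover have "0 < y"
  proof -
    have "0 \<le> (1-u) * real_of_int (snd p)" "0 \<le> u * real_of_int (snd q)" using u rows by auto
    moreover have "0 < (1-u) * real_of_int (snd p) \<or> 0 < u * real_of_int (snd q)"
      using u rows nh by (cases "snd p = 0") auto
    ultimately show ?thesis unfolding y by linarith
  qed
  moreover have "y < real k"
  proof -
    have "0 \<le> (1-u) * (real k - real_of_int (snd p))" "0 \<le> u * (real k - real_of_int (snd q))" using u rows by auto
    moreover have "0 < (1-u) * (real k - real_of_int (snd p)) \<or> 0 < u * (real k - real_of_int (snd q))"
      using u rows nh by (cases "snd p = int k") auto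
    moreover have "real k - y = (1-u) * (real k - real_of_int (snd p)) + u * (real k - real_of_int (snd q))"
      unfolding y by (simp add: algebra_simps)
    ultimately show ?thesis by linarith
  qed
  ultimately show False using d b by auto
qed

context free_columns
begin

text \<open>At least \<open>card G / 2\<close> columns, less the crossed ones, are neither bad nor
  crossed and contribute \<open>exp l\<close> each. A crossed column costs at most 2 in the
  exponent: \<open>l \<le> 1\<close> for the factor forgone and \<open>ln 2 \<le> 1\<close> for its
  own status.\<close>

lemma few_crossings_tail:
  assumes sp: "\<And>a b. a \<in> G \<Longrightarrow> b \<in> G \<Longrightarrow> a \<noteq> b \<Longrightarrow> int \<Delta> \<le> \<bar>a - b\<bar>" and \<Delta>: "4 * lam powr (2 * real \<Delta>) \<le> 1"
    and l: "l = ln (1 + 1 / (2 * Bc k lam L))"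
  shows "(\<Sum>\<sigma>\<in>{\<sigma>\<in>\<Omega>. real (card {b\<in>G. bad L b \<sigma>}) \<le> real (card G) / 2 \<and> real (card {b\<in>G. vcrossing k \<sigma> b}) \<le> s}. weight lam \<sigma>)
    \<le> exp (2 * s - real (card G) / 2 * l) * Z" (is "sum _ ?S \<le> _")
proof -
  define \<epsilon> where "\<epsilon> = 1 / (2 * Bc k lam L)"
  have \<epsilon>: "0 < \<epsilon>" "\<epsilon> \<le> 1" using Bc_ge_1[OF lam(2), of k L] unfolding \<epsilon>_def by auto
  have l': "l = ln (1 + \<epsilon>)" unfolding l \<epsilon>_def ..
  have l0: "0 \<le> l" "l \<le> 1" using \<epsilon> ln_add_one_self_le_self[of \<epsilon>] unfolding l' by auto
  let ?F = "\<lambda>\<sigma>. \<Prod>a\<in>G. stat L a \<sigma>"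
  have F: "exp (real (card G) / 2 * l - 2 * s) \<le> ?F \<sigma>" if S: "\<sigma> \<in> ?S" for \<sigma>
  proof -
    define U where "U = {a\<in>G. \<not> bad L a \<sigma> \<and> \<not> vcrossing k \<sigma> a}"
    define C where "C = {a\<in>G. \<not> bad L a \<sigma> \<and> vcrossing k \<sigma> a}"
    have "?F \<sigma> = (\<Prod>a\<in>G. (if \<not> bad L a \<sigma> \<and> \<not> vcrossing k \<sigma> a then 1 + \<epsilon> else 1) * (if \<not> bad L a \<sigma> \<and> vcrossing k \<sigma> a then 1/2 else 1))"
      by (rule prod.cong) (auto simp: stat_def \<epsilon>_def)
    also have "\<dots> = (\<Prod>a\<in>U. 1 + \<epsilon>) * (\<Prod>a\<in>C. 1/2)"
      unfolding prod.distrib U_def C_def prod.inter_filter[OF finite_G] ..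
    also have "\<dots> = (1 + \<epsilon>) ^ card U * (1/2) ^ card C" by simp
    also have "\<dots> = exp (real (card U) * l) * exp (- (real (card C) * ln 2))"
      using \<epsilon> unfolding l' by (simp add: exp_of_nat_mult exp_minus power_one_over inverse_eq_divide)
    also have "\<dots> = exp (real (card U) * l - real (card C) * ln 2)" by (simp add: exp_add[symmetric])
    finally have eq: "?F \<sigma> = exp (real (card U) * l - real (card C) * ln 2)" .
    have G3: "G = {b\<in>G. bad L b \<sigma>} \<union> (C \<union> U)" unfolding U_def C_def by blast
    have "card G \<le> card {b\<in>G. bad L b \<sigma>} + card (C \<union> U)" by (subst G3) (rule card_Un_le)
    also have "card (C \<union> U) \<le> card C + card U" by (rule card_Un_le)
    finally have "real (card G) \<le> real (card {b\<in>G. bad L b \<sigma>}) + real (card C) + real (card U)" by linarith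
    then have U: "real (card G) / 2 - real (card C) \<le> real (card U)" using S by simp
    have "card C \<le> card {b\<in>G. vcrossing k \<sigma> b}" unfolding C_def using finite_G by (intro card_mono) auto
    then have C: "real (card C) \<le> s" using S by simp
    have "(real (card G) / 2 - real (card C)) * l \<le> real (card U) * l" using U l0 by (intro mult_right_mono) auto
    moreover have "real (card C) * l \<le> real (card C)" using l0 by (simp add: mult_left_le)
    moreover have "real (card C) * ln 2 \<le> real (card C)" using ln_add_one_self_le_self[of 1] by (intro mult_left_le) auto
    ultimately have "real (card G) / 2 * l - 2 * s \<le> real (card U) * l - real (card C) * ln 2"
      using C by (simp add: left_diff_distrib)
    then show ?thesis unfolding eq by simp
  qed
  have F0: "0 \<le> ?F \<sigma>" for \<sigma> using stat_pos by (intro prod_nonneg) (simp add: less_imp_le)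
  have "exp (real (card G) / 2 * l - 2 * s) * sum (weight lam) ?S = (\<Sum>\<sigma>\<in>?S. weight lam \<sigma> * exp (real (card G) / 2 * l - 2 * s))"
    by (simp add: sum_distrib_left mult.commute)
  also have "\<dots> \<le> (\<Sum>\<sigma>\<in>?S. weight lam \<sigma> * ?F \<sigma>)" by (intro sum_mono mult_left_mono F w_nonneg)
  also have "\<dots> \<le> (\<Sum>\<sigma>\<in>\<Omega>. weight lam \<sigma> * ?F \<sigma>)"
    using w_nonneg F0 finite_Omega by (intro sum_mono2) auto
  also have "\<dots> \<le> Z" by (rule stat_product[OF finite_G subset_refl sp \<Delta>])
  finally have "exp (real (card G) / 2 * l - 2 * s) * sum (weight lam) ?S \<le> Z" .
  then have "exp (2 * s - real (card G) / 2 * l) * (exp (real (card G) / 2 * l - 2 * s) * sum (weight lam) ?S)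
     \<le> exp (2 * s - real (card G) / 2 * l) * Z" by (intro mult_left_mono) auto
  then show ?thesis by (simp add: mult.assoc[symmetric] exp_add[symmetric])
qed

text \<open>Either at least half of the columns are bad or \<open>few_crossings_tail\<close>
  applies. The bound on \<open>eta L\<close> and the bound on \<open>s\<close> each use up half of
  the exponent available in their case.\<close>

lemma piprob_tail:
  assumes sp: "\<And>a b. a \<in> G \<Longrightarrow> b \<in> G \<Longrightarrow> a \<noteq> b \<Longrightarrow> int \<Delta> \<le> \<bar>a - b\<bar>" and \<Delta>: "4 * lam powr (2 * real \<Delta>) \<le> 1"
    and l: "l = ln (1 + 1 / (2 * Bc k lam L))" and eta: "eta L \<le> \<kappa> / 4 * - ln lam"
    and P: "\<And>\<sigma>. \<sigma> \<in> \<Omega> \<Longrightarrow> P \<sigma> \<Longrightarrow> real (card {b\<in>G. vcrossing k \<sigma> b}) \<le> s" and s: "8 * s \<le> real (card G) * l"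
  shows "piprob n k lam \<xi> P \<le> exp (- (\<kappa> / 4 * - ln lam * real (card G))) + exp (- (l / 4 * real (card G)))"
proof -
  let ?S1 = "{\<sigma>\<in>\<Omega>. real (card G) / 2 \<le> real (card {b\<in>G. bad L b \<sigma>})}"
  let ?S2 = "{\<sigma>\<in>\<Omega>. real (card {b\<in>G. bad L b \<sigma>}) \<le> real (card G) / 2 \<and> real (card {b\<in>G. vcrossing k \<sigma> b}) \<le> s}"
  have Z0: "0 \<le> Z" by (intro sum_nonneg w_nonneg)
  have "sum (weight lam) {\<sigma>\<in>\<Omega>. P \<sigma>} \<le> sum (weight lam) (?S1 \<union> ?S2)"
    using P w_nonneg finite_Omega[of n k \<xi>] by (intro sum_mono2) auto
  also have "\<dots> \<le> sum (weight lam) ?S1 + sum (weight lam) ?S2"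
    using sum.union_inter[of ?S1 ?S2 "weight lam"] finite_Omega[of n k \<xi>] sum_nonneg[of "?S1 \<inter> ?S2" "weight lam"] w_nonneg by simp
  also have "sum (weight lam) ?S1 \<le> exp (- (\<kappa> / 4 * - ln lam * real (card G))) * Z"
  proof -
    have "sum (weight lam) ?S1 \<le> lam powr (\<kappa> * (real (card G) / 2)) * exp (\<Sum>e\<in>long_edges L. lam powr (\<kappa> * real_of_int (ext e))) * Z"
      by (rule bad_tail)
    also have "\<dots> = exp (\<kappa> * (real (card G) / 2) * ln lam + (\<Sum>e\<in>long_edges L. lam powr (\<kappa> * real_of_int (ext e)))) * Z"
      using lam by (simp add: powr_def exp_add)
    also have "\<dots> \<le> exp (- (\<kappa> / 4 * - ln lam * real (card G))) * Z"
    proof (rule mult_right_mono[OF _ Z0])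
      have "real (card G) * eta L \<le> real (card G) * (\<kappa> / 4 * - ln lam)" using eta by (intro mult_left_mono) auto
      then have "(\<Sum>e\<in>long_edges L. lam powr (\<kappa> * real_of_int (ext e))) \<le> real (card G) * (\<kappa> / 4 * - ln lam)"
        using long_edges_sum[of L] by linarith
      moreover have "c * (g / 2) * x + g * (c / 4 * - x) = - (c / 4 * - x * g)" for c g x :: real by (simp add: field_simps)
      ultimately have "\<kappa> * (real (card G) / 2) * ln lam + (\<Sum>e\<in>long_edges L. lam powr (\<kappa> * real_of_int (ext e))) \<le> - (\<kappa> / 4 * - ln lam * real (card G))"
        by (metis add_left_mono)
      then show "exp (\<kappa> * (real (card G) / 2) * ln lam + (\<Sum>e\<in>long_edges L. lam powr (\<kappa> * real_of_int (ext e)))) \<le> exp (- (\<kappa> / 4 * - ln lam * real (card G)))"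
        by (simp only: exp_le_cancel_iff)
    qed
    finally show ?thesis .
  qed
  also have "sum (weight lam) ?S2 \<le> exp (- (l / 4 * real (card G))) * Z"
  proof -
    have "sum (weight lam) ?S2 \<le> exp (2 * s - real (card G) / 2 * l) * Z" by (rule few_crossings_tail[OF sp \<Delta> l])
    also have "\<dots> \<le> exp (- (l / 4 * real (card G))) * Z" using s by (intro mult_right_mono[OF _ Z0]) (simp add: field_simps)
    finally show ?thesis .
  qed
  finally have tot: "sum (weight lam) {\<sigma>\<in>\<Omega>. P \<sigma>} \<le> (exp (- (\<kappa> / 4 * - ln lam * real (card G))) + exp (- (l / 4 * real (card G)))) * Z"
    by (simp add: distrib_right)
  show ?thesis
  proof (cases "Z = 0")
    \<comment> \<open>With \<open>Z = 0\<close> the quotient is 0 by the convention for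
      division.\<close>
    case True then show ?thesis unfolding piprob_def by (simp add: add_nonneg_nonneg)
  next
    case False
    then have "0 < Z" using Z0 by simp
    then show ?thesis unfolding piprob_def using tot by (simp only: pos_divide_le_eq)
  qed
qed

end

section \<open>Choice of the constants and of the grid\<close>

theorem mainTheorem18:
  fixes k :: nat and lam :: real
  assumes "k \<ge> 1" and "0 < lam" and "lam < 1"
  shows "\<exists>c>0. \<exists>\<delta>. 0 < \<delta> \<and> \<delta> < 1 \<and>
    (\<forall>\<^sub>F m in sequentially.
      \<forall>(n::nat) (x0::real) \<xi>.
        n \<ge> 1 \<and> - (real n / 2) \<le> x0 \<and> x0 + real m \<le> real n / 2 \<and>
        boundary_condition n k \<xi> \<and>
        (\<forall>e\<in>\<xi>. oseg e \<inter> ({x0<..<x0 + real m} \<times> {0<..<real k}) = {})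
        \<longrightarrow> piprob n k lam \<xi> (\<lambda>\<sigma>. real (CR k x0 (real m) \<sigma>) \<le> \<delta> * real m)
              \<le> exp (- c * real m))"
proof -
  define \<kappa> where "\<kappa> = 1 / (2 * real k + 1)"
  define \<Lambda> where "\<Lambda> = - ln lam"
  have \<kappa>0: "\<kappa> > 0" unfolding \<kappa>_def by simp
  have \<Lambda>0: "\<Lambda> > 0" unfolding \<Lambda>_def using assms by simp
  have "\<exists>\<Delta>\<ge>1. 4 * lam powr (2 * real \<Delta>) \<le> 1"
  proof -
    \<comment> \<open>The required inequality amounts to
      \<open>\<Delta> \<ge> ln 4 / (2 * \<Lambda>)\<close>.\<close>
    obtain N :: nat where N: "ln 4 / (2 * \<Lambda>) \<le> real N" using real_arch_simple by blast
    define \<Delta> where "\<Delta> = Suc N"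
    have "ln 4 / (2 * \<Lambda>) \<le> real \<Delta>" using N unfolding \<Delta>_def by simp
    then have "ln 4 \<le> 2 * real \<Delta> * \<Lambda>" using \<Lambda>0 by (simp add: field_simps)
    then have "ln 4 + 2 * real \<Delta> * ln lam \<le> 0" unfolding \<Lambda>_def by simp
    then have "exp (ln 4 + 2 * real \<Delta> * ln lam) \<le> 1" by (simp only: exp_le_one_iff)
    then have "4 * lam powr (2 * real \<Delta>) \<le> 1" using assms by (simp add: exp_add powr_def)
    then show ?thesis unfolding \<Delta>_def by (intro exI[of _ "Suc N"]) simp
  qed
  then obtain \<Delta> :: nat where \<Delta>: "\<Delta> \<ge> 1" "4 * lam powr (2 * real \<Delta>) \<le> 1" by blast
  have "\<exists>L. (real k + 1)\<^sup>2 * ((lam powr (\<kappa> / 2)) ^ L / (1 - lam powr (\<kappa> / 2))\<^sup>2) \<le> \<kappa> / 4 * \<Lambda>"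
  proof -
    define \<nu> where "\<nu> = lam powr (\<kappa> / 2)"
    have \<nu>: "0 < \<nu>" "\<nu> < 1"
    proof -
      show "0 < \<nu>" unfolding \<nu>_def using assms by simp
      have "lam powr (\<kappa> / 2) < lam powr 0" using assms \<kappa>0 by (intro powr_less_mono') auto
      then show "\<nu> < 1" unfolding \<nu>_def using assms by simp
    qed
    \<comment> \<open>The bound decays geometrically in the cutoff, so a large \<open>L\<close>
      makes the number of long edges harmless against their gain.\<close>
    have "(\<lambda>L. (real k + 1)\<^sup>2 * (\<nu> ^ L / (1 - \<nu>)\<^sup>2)) \<longlonglongrightarrow> (real k + 1)\<^sup>2 * (0 / (1 - \<nu>)\<^sup>2)"
      using \<nu> by (intro tendsto_intros LIMSEQ_realpow_zero) auto
    then have "\<forall>\<^sub>F L in sequentially. (real k + 1)\<^sup>2 * (\<nu> ^ L / (1 - \<nu>)\<^sup>2) < \<kappa> / 4 * \<Lambda>"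
      using \<kappa>0 \<Lambda>0 by (intro order_tendstoD(2)) auto
    then obtain L where "(real k + 1)\<^sup>2 * (\<nu> ^ L / (1 - \<nu>)\<^sup>2) < \<kappa> / 4 * \<Lambda>" by (auto simp: eventually_sequentially)
    then show ?thesis unfolding \<nu>_def by (intro exI[of _ L]) simp
  qed
  then obtain L where L: "(real k + 1)\<^sup>2 * ((lam powr (\<kappa> / 2)) ^ L / (1 - lam powr (\<kappa> / 2))\<^sup>2) \<le> \<kappa> / 4 * \<Lambda>" by blast
  have B1: "1 \<le> Bc k lam L" by (rule Bc_ge_1[OF assms(3)])
  define l where "l = ln (1 + 1 / (2 * Bc k lam L))"
  have l: "0 < l" "l \<le> 1"
  proof -
    define \<epsilon> where "\<epsilon> = 1 / (2 * Bc k lam L)"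
    have \<epsilon>: "0 < \<epsilon>" "\<epsilon> \<le> 1" unfolding \<epsilon>_def using B1 by auto
    show "0 < l" unfolding l_def \<epsilon>_def[symmetric] using \<epsilon> by (intro ln_gt_zero) simp
    show "l \<le> 1" unfolding l_def \<epsilon>_def[symmetric] using \<epsilon> ln_add_one_self_le_self[of \<epsilon>] by linarith
  qed
  \<comment> \<open>For a grid of \<open>M\<close> columns with
    \<open>m \<le> 2 * \<Delta> * M\<close> this gives \<open>8 * \<delta> * m \<le> M * l\<close>,
    as \<open>piprob_tail\<close> requires.\<close>
  define \<delta> where "\<delta> = l / (16 * real \<Delta>)"
  have \<delta>: "0 < \<delta>" "\<delta> < 1" unfolding \<delta>_def using l \<Delta>(1) by (auto simp: field_simps)
  \<comment> \<open>The rate per grid column, divided by \<open>2 * \<Delta>\<close> because the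
    grid has at least \<open>m / (2 * \<Delta>)\<close> columns.\<close>
  define c0 where "c0 = min (\<kappa> / 4 * \<Lambda>) (l / 4) / (2 * real \<Delta>)"
  have c0: "c0 > 0" unfolding c0_def using \<kappa>0 \<Lambda>0 l \<Delta>(1) by simp
  \<comment> \<open>The first bound guarantees that many columns; the second lets half of the rate
    absorb the factor 2 from adding two exponentials.\<close>
  define m0 where "m0 = max (2 * (2 + \<Delta>)) (nat \<lceil>ln 2 / (c0 / 2)\<rceil>)"
  have main: "piprob n k lam \<xi> (\<lambda>\<sigma>. real (CR k x0 (real m) \<sigma>) \<le> \<delta> * real m) \<le> exp (- (c0 / 2) * real m)"
    if m: "m0 \<le> m" and x0: "- (real n / 2) \<le> x0" "x0 + real m \<le> real n / 2"
      and bc: "boundary_condition n k \<xi>" and \<xi>: "\<forall>e\<in>\<xi>. oseg e \<inter> ({x0<..<x0 + real m} \<times> {0<..<real k}) = {}"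
    for m n x0 \<xi>
  proof -
    \<comment> \<open>The grid starts less than 2 to the right of \<open>x0\<close>; the reserve of
      2 keeps its columns strictly inside the rectangle.\<close>
    define M where "M = (m - 2) div \<Delta>"
    define G where "G = (\<lambda>i. \<lceil>x0\<rceil> + 1 + int \<Delta> * int i) ` {..<M}"
    have m2: "2 * (2 + \<Delta>) \<le> m" using m unfolding m0_def by simp
    have "\<Delta> * M \<le> m - 2" unfolding M_def by simp
    then have "real (\<Delta> * M) \<le> real (m - 2)" by (rule of_nat_mono)
    then have DM: "real \<Delta> * real M \<le> real m - 2" using m2 by (simp add: of_nat_diff)
    have "m - 2 < \<Delta> + \<Delta> * M" unfolding M_def using \<Delta>(1) by (intro dividend_less_times_div) simp
    moreover have "m \<le> 2 * P" if "m - 2 < \<Delta> + P" for P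
      using that m2 by presburger
    ultimately have "m \<le> 2 * (\<Delta> * M)" by blast
    then have "real m \<le> real (2 * (\<Delta> * M))" by (rule of_nat_mono)
    then have Mm: "real m \<le> 2 * real \<Delta> * real M" by simp
    have inj: "inj_on (\<lambda>i. \<lceil>x0\<rceil> + 1 + int \<Delta> * int i) {..<M}" using \<Delta>(1) by (auto simp: inj_on_def)
    have cardG: "card G = M" unfolding G_def using card_image[OF inj] by simp
    have Gx: "x0 < real_of_int b \<and> real_of_int b < x0 + real m" if bG: "b \<in> G" for b
    proof -
      obtain i where i: "i < M" "b = \<lceil>x0\<rceil> + 1 + int \<Delta> * int i" using bG unfolding G_def by auto
      have "real_of_int b = real_of_int \<lceil>x0\<rceil> + 1 + real \<Delta> * real i" unfolding i(2) by simp
      moreover have "real \<Delta> * real i \<le> real \<Delta> * real M" using i(1) by (intro mult_left_mono) auto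
      moreover have "0 \<le> real \<Delta> * real i" by simp
      moreover have "x0 \<le> real_of_int \<lceil>x0\<rceil>" "real_of_int \<lceil>x0\<rceil> < x0 + 1" by linarith+
      ultimately show ?thesis using DM by linarith
    qed
    interpret free_columns n k \<xi> lam G
    proof
      show "0 < lam" "lam < 1" using assms by auto
      show "finite G" unfolding G_def by simp
      show "\<bar>2 * b\<bar> \<le> int n" if "b \<in> G" for b using Gx[OF that] x0 by linarith
      show "\<not> crosses b e" if "b \<in> G" "e \<in> \<xi>" for b e
      proof (rule not_crosses_of_strip)
        show "valid_edge n k e" using bc that(2) unfolding boundary_condition_def edge_config_def by simp
        show "x0 < real_of_int b" "real_of_int b < x0 + real m" using Gx[OF that(1)] by auto
        show "oseg e \<inter> ({x0<..<x0 + real m} \<times> {0<..<real k}) = {}" using \<xi> that(2) by simp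
      qed
    qed
    have sp: "int \<Delta> \<le> \<bar>a - b\<bar>" if ab: "a \<in> G" "b \<in> G" "a \<noteq> b" for a b
    proof -
      obtain i j where ij: "a = \<lceil>x0\<rceil> + 1 + int \<Delta> * int i" "b = \<lceil>x0\<rceil> + 1 + int \<Delta> * int j" using ab unfolding G_def by auto
      then have "a - b = int \<Delta> * (int i - int j)" by (simp add: algebra_simps)
      then have e: "\<bar>a - b\<bar> = int \<Delta> * \<bar>int i - int j\<bar>" by (simp add: abs_mult)
      have "i \<noteq> j" using ab(3) ij by auto
      then have "int \<Delta> * 1 \<le> int \<Delta> * \<bar>int i - int j\<bar>" by (intro mult_left_mono) auto
      then show ?thesis unfolding e by simp
    qed
    have cr: "real (card {b\<in>G. vcrossing k \<sigma> b}) \<le> \<delta> * real m" if "real (CR k x0 (real m) \<sigma>) \<le> \<delta> * real m" for \<sigma>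
    proof -
      have "{b\<in>G. vcrossing k \<sigma> b} \<subseteq> {a::int. x0 \<le> real_of_int a \<and> real_of_int a \<le> x0 + real m \<and> vcrossing k \<sigma> a}"
        using Gx by (auto simp: less_imp_le)
      moreover have "finite {a::int. x0 \<le> real_of_int a \<and> real_of_int a \<le> x0 + real m \<and> vcrossing k \<sigma> a}"
      proof (rule finite_subset)
        show "{a::int. x0 \<le> real_of_int a \<and> real_of_int a \<le> x0 + real m \<and> vcrossing k \<sigma> a} \<subseteq> {\<lceil>x0\<rceil>..\<lfloor>x0 + real m\<rfloor>}"
          unfolding atLeastAtMost_def atLeast_def atMost_def ceiling_le_iff le_floor_iff by blast
      qed simp
      ultimately have "card {b\<in>G. vcrossing k \<sigma> b} \<le> CR k x0 (real m) \<sigma>" unfolding CR_def by (rule card_mono[rotated])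
      then show ?thesis using that by linarith
    qed
    have "piprob n k lam \<xi> (\<lambda>\<sigma>. real (CR k x0 (real m) \<sigma>) \<le> \<delta> * real m)
       \<le> exp (- (1 / (2 * real k + 1) / 4 * - ln lam * real (card G))) + exp (- (l / 4 * real (card G)))"
    proof (rule piprob_tail[OF sp \<Delta>(2) l_def])
      show "eta L \<le> 1 / (2 * real k + 1) / 4 * - ln lam" using L unfolding eta_def \<kappa>_def \<Lambda>_def .
      show "8 * (\<delta> * real m) \<le> real (card G) * l"
      proof -
        have "8 * (\<delta> * real m) \<le> 8 * (\<delta> * (2 * real \<Delta> * real M))" using Mm \<delta> by (intro mult_left_mono) auto
        also have "\<dots> = real M * l" unfolding \<delta>_def using \<Delta>(1) by simp
        finally show ?thesis unfolding cardG .
      qed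
    qed (assumption | erule cr)+
    also have "\<dots> \<le> exp (- (c0 * real m)) + exp (- (c0 * real m))"
    proof -
      have "c0 * real m \<le> c0 * (2 * real \<Delta> * real M)" using Mm c0 by (intro mult_left_mono) auto
      also have "\<dots> = min (\<kappa> / 4 * \<Lambda>) (l / 4) * real M" unfolding c0_def using \<Delta>(1) by simp
      finally have c: "c0 * real m \<le> min (\<kappa> / 4 * \<Lambda>) (l / 4) * real M" .
      have "min (\<kappa> / 4 * \<Lambda>) (l / 4) * real M \<le> \<kappa> / 4 * \<Lambda> * real M" "min (\<kappa> / 4 * \<Lambda>) (l / 4) * real M \<le> l / 4 * real M"
        by (intro mult_right_mono; simp)+
      then show ?thesis using c unfolding cardG \<kappa>_def[symmetric] \<Lambda>_def[symmetric] by (intro add_mono) auto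
    qed
    also have "\<dots> = exp (ln 2 - c0 * real m)" by (simp add: exp_diff exp_minus field_simps)
    also have "\<dots> \<le> exp (- (c0 / 2) * real m)"
    proof -
      have "real (nat \<lceil>ln 2 / (c0 / 2)\<rceil>) \<le> real m" using m unfolding m0_def by simp
      then have "ln 2 / (c0 / 2) \<le> real m" by linarith
      then have "ln 2 \<le> (c0 / 2) * real m" using c0 by (simp add: field_simps)
      then show ?thesis by (simp add: field_simps)
    qed
    finally show ?thesis .
  qed
  show ?thesis
  proof (rule exI[of _ "c0 / 2"], rule conjI[rotated], rule exI[of _ \<delta>], intro conjI)
    show "0 < c0 / 2" "0 < \<delta>" "\<delta> < 1" using c0 \<delta> by auto
    show "\<forall>\<^sub>F m in sequentially.
      \<forall>(n::nat) (x0::real) \<xi>.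
        n \<ge> 1 \<and> - (real n / 2) \<le> x0 \<and> x0 + real m \<le> real n / 2 \<and>
        boundary_condition n k \<xi> \<and>
        (\<forall>e\<in>\<xi>. oseg e \<inter> ({x0<..<x0 + real m} \<times> {0<..<real k}) = {})
        \<longrightarrow> piprob n k lam \<xi> (\<lambda>\<sigma>. real (CR k x0 (real m) \<sigma>) \<le> \<delta> * real m)
              \<le> exp (- (c0 / 2) * real m)"
      unfolding eventually_sequentially using main by (intro exI[of _ m0]) blast
  qed
qed

end
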